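(* Let $G=(V,E)$ be a DAG and let $\mathcal X_V=\prod_{v\in V}\mathcal X_v$, the space of Bayesian networks $\mathrm{BN}_G$, its metric $d_{TV}^\circ$, and the distribution map $D:\mathrm{BN}_G\to M_G$ be as in the context. Then the set of faithful Bayesian networks $D^{-1}(F_G)$ is open and dense in $(\mathrm{BN}_G,d_{TV}^\circ)$.
   Context: A DAG $G=(V,E)$ has a finite vertex set $V$, directed edges $E\subset V\times V$ and no directed cycles. $\mathrm{pa}(v)=\{w\in V: w\to v\in E\}$. The ancestors of $v$ are $v$ itself and all $w$ with a directed path from $w$ to $v$ in $G$; an ancestor of a set $C$ is an ancestor of some element of $C$. A collider on a path is a vertex $v$ with $\cdots\to v\leftarrow\cdots$ on the path; other vertices of the path (including endpoints) are non-colliders. For (not necessarily disjoint) $A,B,C\subseteq V$, $A\perp^d_G B\mid C$ ($d$-separation) means that for every path between some $a\in A$ and some $b\in B$ there is a collider on the path that is not an ancestor of $C$, or a non-collider on the path that lies in $C$; for $a=b$ the trivial path consisting of the single vertex $a$ counts as a path, blocked precisely when $a\in C$. $A\not\perp^d_G B\mid C$ is the negation. For each $v\in V$, $\mathcal X_v$ is a separable complete metric space with at least two points and its Borel $\sigma$-algebra; $\mathcal X_A=\prod_{v\in A}\mathcal X_v$; $\mathcal P(\mathcal X_A)$ is the set of Borel probability measures on $\mathcal X_A$, with the smallest $\sigma$-algebra making all evaluations $\mathbb P\mapsto\mathbb P(E)$ measurable; $X_A$ is the coordinate projection to $\mathcal X_A$. $X_A\perp\!\!\!\perp_{\mathbb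 P}X_B\mid X_C$ means $\mathbb P(X_A\in E_A,X_B\in E_B\mid X_C)=\mathbb P(X_A\in E_A\mid X_C)\,\mathbb P(X_B\in E_B\mid X_C)$ a.s. for all Borel $E_A,E_B$. $M_G=\{\mathbb P\in\mathcal P(\mathcal X_V): A\perp^d_G B\mid C\Rightarrow X_A\perp\!\!\!\perp_{\mathbb P}X_B\mid X_C\ \forall A,B,C\subseteq V\}$; $F_G$ is the set of $\mathbb P\in M_G$ such that for all $A,B,C\subseteq V$, $A\not\perp^d_G B\mid C$ implies that $X_A\perp\!\!\!\perp_{\mathbb P}X_B\mid X_C$ fails. $\mathrm{BN}_G=\prod_{v\in V}\{\mathbb P(X_v\mid X_{\mathrm{pa}(v)}):\mathcal X_{\mathrm{pa}(v)}\to\mathcal P(\mathcal X_v)\text{ measurable}\}$, i.e. tuples of Markov kernels. The distribution map $D:\mathrm{BN}_G\to M_G$ sends $(\mathbb P(X_v\mid X_{\mathrm{pa}(v)}))_{v\in V}$ to the product of kernels $\bigotimes_{v\in V}\mathbb P(X_v\mid X_{\mathrm{pa}(v)})$ (taken along a topological ordering of $G$). With $d_{TV}(\mathbb P,\mathbb Q)=\sup_E|\mathbb P(E)-\mathbb Q(E)|$ over Borel $E$, $$d_{TV}^\circ(m,m')=\sum_{v\in V}\ \sup_{x_{\mathrm{pa}(v)}\in\mathcal X_{\mathrm{pa}(v)}}d_{TV}\big(\mathbb P_m(X_v\mid x_{\mathrm{pa}(v)}),\mathbb P_{m'}(X_v\mid x_{\mathrm{pa}(v)})\big).$$ *)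

theory Defs
  imports "HOL-Probability.Probability"
begin

section \<open>Directed acyclic graphs and d-separation\<close>

text \<open>A pair \<open>(v, w) \<in> E\<close> is the edge \<open>v \<rightarrow> w\<close>.\<close>

definition dag :: "'v set \<Rightarrow> ('v \<times> 'v) set \<Rightarrow> bool" where
  "dag V E \<longleftrightarrow> finite V \<and> E \<subseteq> V \<times> V \<and> acyclic E"

definition pa :: "('v \<times> 'v) set \<Rightarrow> 'v \<Rightarrow> 'v set" where
  "pa E v = {w. (w, v) \<in> E}"

definition ancestors :: "('v \<times> 'v) set \<Rightarrow> 'v set \<Rightarrow> 'v set" where
  "ancestors E C = {w. \<exists>c\<in>C. (w, c) \<in> E\<^sup>*}"

text \<open>Paths do not repeat vertices and ignore edge directions. In an acyclic graph at most one
  of \<open>v \<rightarrow> w\<close> and \<open>w \<rightarrow> v\<close> is an edge, so the list of vertices determines the path. The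
  only path from a vertex to itself is the one-element list.\<close>

definition is_path :: "'v set \<Rightarrow> ('v \<times> 'v) set \<Rightarrow> 'v list \<Rightarrow> bool" where
  "is_path V E p \<longleftrightarrow> p \<noteq> [] \<and> set p \<subseteq> V \<and> distinct p \<and>
     (\<forall>i. Suc i < length p \<longrightarrow> (p ! i, p ! Suc i) \<in> E \<or> (p ! Suc i, p ! i) \<in> E)"

definition collider_at :: "('v \<times> 'v) set \<Rightarrow> 'v list \<Rightarrow> nat \<Rightarrow> bool" where
  "collider_at E p i \<longleftrightarrow> 0 < i \<and> Suc i < length p \<and>
     (p ! (i - 1), p ! i) \<in> E \<and> (p ! Suc i, p ! i) \<in> E"

definition blocked :: "('v \<times> 'v) set \<Rightarrow> 'v set \<Rightarrow> 'v list \<Rightarrow> bool" where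
  "blocked E C p \<longleftrightarrow> (\<exists>i<length p.
     (collider_at E p i \<and> p ! i \<notin> ancestors E C) \<or> (\<not> collider_at E p i \<and> p ! i \<in> C))"

definition d_separated ::
    "'v set \<Rightarrow> ('v \<times> 'v) set \<Rightarrow> 'v set \<Rightarrow> 'v set \<Rightarrow> 'v set \<Rightarrow> bool" where
  "d_separated V E A B C \<longleftrightarrow>
     (\<forall>p. is_path V E p \<and> hd p \<in> A \<and> last p \<in> B \<longrightarrow> blocked E C p)"


section \<open>Product spaces and conditional independence\<close>

text \<open>The spaces \<open>X v\<close> are metric spaces with carriers \<open>mspace (X v)\<close> inside a common type \<open>'a\<close>.
  They may differ arbitrarily from vertex to vertex.\<close>

definition borel_of :: "'a topology \<Rightarrow> 'a measure" where
  "borel_of T = sigma (topspace T) {U. openin T U}"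

definition borel_at :: "('v \<Rightarrow> 'a metric) \<Rightarrow> 'v \<Rightarrow> 'a measure" where
  "borel_at X v = borel_of (mtopology_of (X v))"

text \<open>The points of \<open>\<Prod>v\<in>A. X v\<close> are the functions that are \<open>undefined\<close> outside \<open>A\<close>, and the
  coordinate projection to the factors in \<open>A\<close> is \<open>\<lambda>x. restrict x A\<close>.\<close>

definition prod_borel :: "('v \<Rightarrow> 'a metric) \<Rightarrow> 'v set \<Rightarrow> ('v \<Rightarrow> 'a) measure" where
  "prod_borel X A = borel_of (product_topology (\<lambda>v. mtopology_of (X v)) A)"

definition proj_event :: "('v \<Rightarrow> 'a) measure \<Rightarrow> 'v set \<Rightarrow> ('v \<Rightarrow> 'a) set \<Rightarrow> ('v \<Rightarrow> 'a) set" where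
  "proj_event P A S = {x \<in> space P. restrict x A \<in> S}"

definition cond_prob_given ::
    "('v \<Rightarrow> 'a metric) \<Rightarrow> ('v \<Rightarrow> 'a) measure \<Rightarrow> 'v set \<Rightarrow> ('v \<Rightarrow> 'a) set \<Rightarrow> ('v \<Rightarrow> 'a) \<Rightarrow> real" where
  "cond_prob_given X P C S =
     real_cond_exp P (vimage_algebra (space P) (\<lambda>x. restrict x C) (prod_borel X C)) (indicator S)"

definition cond_indep ::
    "('v \<Rightarrow> 'a metric) \<Rightarrow> ('v \<Rightarrow> 'a) measure \<Rightarrow> 'v set \<Rightarrow> 'v set \<Rightarrow> 'v set \<Rightarrow> bool" where
  "cond_indep X P A B C \<longleftrightarrow>
     (\<forall>S \<in> sets (prod_borel X A). \<forall>T \<in> sets (prod_borel X B).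
        AE x in P. cond_prob_given X P C (proj_event P A S \<inter> proj_event P B T) x =
          cond_prob_given X P C (proj_event P A S) x * cond_prob_given X P C (proj_event P B T) x)"

definition markov_dists ::
    "'v set \<Rightarrow> ('v \<times> 'v) set \<Rightarrow> ('v \<Rightarrow> 'a metric) \<Rightarrow> ('v \<Rightarrow> 'a) measure set" where
  "markov_dists V E X = {P \<in> space (prob_algebra (prod_borel X V)).
     \<forall>A B C. A \<subseteq> V \<and> B \<subseteq> V \<and> C \<subseteq> V \<and> d_separated V E A B C \<longrightarrow> cond_indep X P A B C}"

definition faithful_dists ::
    "'v set \<Rightarrow> ('v \<times> 'v) set \<Rightarrow> ('v \<Rightarrow> 'a metric) \<Rightarrow> ('v \<Rightarrow> 'a) measure set" where
  "faithful_dists V E X = {P \<in> markov_dists V E X.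
     \<forall>A B C. A \<subseteq> V \<and> B \<subseteq> V \<and> C \<subseteq> V \<and> \<not> d_separated V E A B C \<longrightarrow> \<not> cond_indep X P A B C}"


section \<open>Bayesian networks\<close>

text \<open>Kernels are \<open>undefined\<close> outside their domain (\<open>extensional\<close>), so that equality of
  networks is equality of all kernels on their domains.\<close>

definition bayes_nets ::
    "'v set \<Rightarrow> ('v \<times> 'v) set \<Rightarrow> ('v \<Rightarrow> 'a metric) \<Rightarrow> ('v \<Rightarrow> ('v \<Rightarrow> 'a) \<Rightarrow> 'a measure) set" where
  "bayes_nets V E X = (\<Pi>\<^sub>E v\<in>V.
     measurable (prod_borel X (pa E v)) (prob_algebra (borel_at X v)) \<inter>
     extensional (space (prod_borel X (pa E v))))"

definition topological_ordering :: "'v set \<Rightarrow> ('v \<times> 'v) set \<Rightarrow> 'v list \<Rightarrow> bool" where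
  "topological_ordering V E vs \<longleftrightarrow> distinct vs \<and> set vs = V \<and>
     (\<forall>i<length vs. \<forall>j<length vs. (vs ! i, vs ! j) \<in> E \<longrightarrow> i < j)"

text \<open>The list is processed from its end: in \<open>v # vs\<close> the vertices of \<open>vs\<close> have been sampled
  before \<open>v\<close>, so \<open>kernel_product\<close> is to be applied to a reversed topological ordering.\<close>

primrec kernel_product ::
    "('v \<times> 'v) set \<Rightarrow> ('v \<Rightarrow> 'a metric) \<Rightarrow> ('v \<Rightarrow> ('v \<Rightarrow> 'a) \<Rightarrow> 'a measure) \<Rightarrow> 'v list \<Rightarrow>
     ('v \<Rightarrow> 'a) measure" where
  "kernel_product E X m [] = return (prod_borel X {}) (\<lambda>_. undefined)"
| "kernel_product E X m (v # vs) = bind (kernel_product E X m vs)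
     (\<lambda>x. distr (m v (restrict x (pa E v))) (prod_borel X (insert v (set vs))) (\<lambda>y. x(v := y)))"

definition distribution_map ::
    "'v set \<Rightarrow> ('v \<times> 'v) set \<Rightarrow> ('v \<Rightarrow> 'a metric) \<Rightarrow> ('v \<Rightarrow> ('v \<Rightarrow> 'a) \<Rightarrow> 'a measure) \<Rightarrow>
     ('v \<Rightarrow> 'a) measure" where
  "distribution_map V E X m =
     kernel_product E X m (rev (SOME vs. topological_ordering V E vs))"

definition tv_dist :: "'a measure \<Rightarrow> 'a measure \<Rightarrow> real" where
  "tv_dist P Q = (SUP S\<in>sets P. \<bar>measure P S - measure Q S\<bar>)"

text \<open>The value \<open>0\<close> for arguments that are not networks is there because \<open>Metric_space\<close>
  demands nonnegativity and symmetry on the whole type.\<close>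

definition tv_dist_nets ::
    "'v set \<Rightarrow> ('v \<times> 'v) set \<Rightarrow> ('v \<Rightarrow> 'a metric) \<Rightarrow> ('v \<Rightarrow> ('v \<Rightarrow> 'a) \<Rightarrow> 'a measure) \<Rightarrow>
     ('v \<Rightarrow> ('v \<Rightarrow> 'a) \<Rightarrow> 'a measure) \<Rightarrow> real" where
  "tv_dist_nets V E X m m' =
     (if m \<in> bayes_nets V E X \<and> m' \<in> bayes_nets V E X
      then \<Sum>v\<in>V. SUP x\<in>space (prod_borel X (pa E v)). tv_dist (m v x) (m' v x)
      else 0)"


section \<open>The distance on networks is a metric\<close>

lemma tv_bdd:
  assumes "P \<in> space (prob_algebra M)" "Q \<in> space (prob_algebra M)"
  shows "\<bar>measure P S - measure Q S\<bar> \<le> 1"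
proof -
  interpret P: prob_space P using assms(1) by (simp add: space_prob_algebra)
  interpret Q: prob_space Q using assms(2) by (simp add: space_prob_algebra)
  show ?thesis
    using P.prob_le_1[of S] Q.prob_le_1[of S] measure_nonneg[of P S] measure_nonneg[of Q S]
    by linarith
qed

lemma tv_dist_upper:
  assumes "P \<in> space (prob_algebra M)" "Q \<in> space (prob_algebra M)" "S \<in> sets M"
  shows "\<bar>measure P S - measure Q S\<bar> \<le> tv_dist P Q"
  unfolding tv_dist_def using assms
  by (intro cSUP_upper bdd_aboveI2[where M=1] tv_bdd[OF assms(1,2)])
     (auto simp: space_prob_algebra)

lemma tv_dist_least:
  assumes "P \<in> space (prob_algebra M)"
    and "\<And>S. S \<in> sets M \<Longrightarrow> \<bar>measure P S - measure Q S\<bar> \<le> c"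
  shows "tv_dist P Q \<le> c"
  unfolding tv_dist_def using assms
  by (intro cSUP_least) (auto simp: space_prob_algebra)

lemma tv_dist_bounds:
  assumes "P \<in> space (prob_algebra M)" "Q \<in> space (prob_algebra M)"
  shows "0 \<le> tv_dist P Q" "tv_dist P Q \<le> 1"
  using tv_dist_upper[OF assms sets.empty_sets] tv_dist_least[OF assms(1) tv_bdd[OF assms]]
  by auto

lemma tv_dist_commute:
  assumes "P \<in> space (prob_algebra M)" "Q \<in> space (prob_algebra M)"
  shows "tv_dist P Q = tv_dist Q P"
  using assms by (simp add: tv_dist_def space_prob_algebra abs_minus_commute)

lemma tv_dist_triangle:
  assumes "P \<in> space (prob_algebra M)" "Q \<in> space (prob_algebra M)" "R \<in> space (prob_algebra M)"
  shows "tv_dist P R \<le> tv_dist P Q + tv_dist Q R"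
proof (rule tv_dist_least[OF assms(1)])
  fix S assume "S \<in> sets M"
  from tv_dist_upper[OF assms(1,2) this] tv_dist_upper[OF assms(2,3) this]
  show "\<bar>measure P S - measure R S\<bar> \<le> tv_dist P Q + tv_dist Q R" by linarith
qed

lemma tv_dist_zeroD:
  assumes "P \<in> space (prob_algebra M)" "Q \<in> space (prob_algebra M)" "tv_dist P Q \<le> 0"
  shows "P = Q"
proof -
  interpret P: prob_space P using assms(1) by (simp add: space_prob_algebra)
  interpret Q: prob_space Q using assms(2) by (simp add: space_prob_algebra)
  show ?thesis
  proof (rule measure_eqI)
    show "sets P = sets Q" using assms by (simp add: space_prob_algebra)
    fix S assume "S \<in> sets P"
    then have "S \<in> sets M" using assms by (simp add: space_prob_algebra)
    from tv_dist_upper[OF assms(1,2) this] assms(3) have "measure P S = measure Q S" by linarith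
    then show "emeasure P S = emeasure Q S"
      by (simp add: P.emeasure_eq_measure Q.emeasure_eq_measure)
  qed
qed

lemma space_prod_borel: "space (prod_borel X A) = (\<Pi>\<^sub>E v\<in>A. mspace (X v))"
  unfolding prod_borel_def borel_of_def
  by (subst space_measure_of) (blast dest: openin_subset, simp)

lemma bayes_nets_kernel:
  assumes "m \<in> bayes_nets V E X" "v \<in> V" "x \<in> space (prod_borel X (pa E v))"
  shows "m v x \<in> space (prob_algebra (borel_at X v))"
proof -
  have "m v \<in> measurable (prod_borel X (pa E v)) (prob_algebra (borel_at X v))"
    using assms by (auto simp: bayes_nets_def)
  then show ?thesis using assms(3) by (rule measurable_space)
qed

lemma Metric_space_bayes_nets:
  fixes V :: "'v set" and X :: "'v \<Rightarrow> 'a metric"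
  assumes dag: "dag V E" and ne: "\<And>v. v \<in> V \<Longrightarrow> mspace (X v) \<noteq> {}"
  shows "Metric_space (bayes_nets V E X) (tv_dist_nets V E X)"
proof -
  let ?B = "bayes_nets V E X"
  let ?S = "\<lambda>v. space (prod_borel X (pa E v))"
  define s where "s m m' v = (SUP x\<in>?S v. tv_dist (m v x) (m' v x))" 
    for m m' :: "'v \<Rightarrow> ('v \<Rightarrow> 'a) \<Rightarrow> 'a measure" and v
  have d: "tv_dist_nets V E X m m' = (\<Sum>v\<in>V. s m m' v)" if "m \<in> ?B" "m' \<in> ?B" for m m'
    using that by (simp add: tv_dist_nets_def s_def)
  have fin: "finite V" using dag by (simp add: dag_def)
  have S_ne: "?S v \<noteq> {}" for v
  proof -
    have "pa E v \<subseteq> V" using dag by (auto simp: dag_def pa_def)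
    then show ?thesis using ne by (auto simp: space_prod_borel PiE_eq_empty_iff)
  qed
  note k = bayes_nets_kernel
  have up: "tv_dist (m v x) (m' v x) \<le> s m m' v"
    if "m \<in> ?B" "m' \<in> ?B" "v \<in> V" "x \<in> ?S v" for m m' v x
    unfolding s_def using that
    by (intro cSUP_upper bdd_aboveI2[where M=1] tv_dist_bounds(2)[OF k k])
  have s_nonneg: "0 \<le> s m m' v" if "m \<in> ?B" "m' \<in> ?B" "v \<in> V" for m m' v
  proof -
    obtain x where "x \<in> ?S v" using S_ne by blast
    then show ?thesis
      using up[OF that] tv_dist_bounds(1)[OF k[OF that(1,3)] k[OF that(2,3)]] by force
  qed
  have eq: "m = m'" if m: "m \<in> ?B" "m' \<in> ?B" and 0: "(\<Sum>v\<in>V. s m m' v) = 0" for m m'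
  proof -
    have "s m m' v = 0" if "v \<in> V" for v
      using 0 that s_nonneg[OF m] by (simp add: sum_nonneg_eq_0_iff[OF fin])
    then have ptw: "m v x = m' v x" if "v \<in> V" "x \<in> ?S v" for v x
      using up[OF m that] that by (intro tv_dist_zeroD[OF k[OF m(1) that] k[OF m(2) that]]) simp
    show ?thesis
    proof (rule PiE_ext[OF m[unfolded bayes_nets_def]])
      fix v assume v: "v \<in> V"
      show "m v = m' v"
        by (rule extensionalityI[where A="?S v"]) (use m v ptw in \<open>auto simp: bayes_nets_def\<close>)
    qed
  qed
  show ?thesis
  proof
    fix m m'
    show "0 \<le> tv_dist_nets V E X m m'"
      using s_nonneg d by (cases "m \<in> ?B \<and> m' \<in> ?B") (auto intro: sum_nonneg simp: tv_dist_nets_def)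
    show "tv_dist_nets V E X m m' = tv_dist_nets V E X m' m"
    proof (cases "m \<in> ?B \<and> m' \<in> ?B")
      case True
      then have "s m m' v = s m' m v" if "v \<in> V" for v
        unfolding s_def using that k[of m V E X v] k[of m' V E X v]
        by (intro SUP_cong refl tv_dist_commute) auto
      then show ?thesis using True by (simp add: d)
    qed (auto simp: tv_dist_nets_def)
  next
    fix m m' assume m: "m \<in> ?B" "m' \<in> ?B"
    have "tv_dist P P = 0" for P :: "'a measure"
      unfolding tv_dist_def using sets.empty_sets[of P] by (auto intro: cSUP_const)
    then have "s m m v = 0" for v
      unfolding s_def using S_ne by simp
    then have "tv_dist_nets V E X m m = 0" using d[OF m(1) m(1)] by simp
    then show "(tv_dist_nets V E X m m' = 0) = (m = m')"
      using eq[OF m] d[OF m] by auto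
  next
    fix m m' m'' assume m: "m \<in> ?B" "m' \<in> ?B" "m'' \<in> ?B"
    have "s m m'' v \<le> s m m' v + s m' m'' v" if v: "v \<in> V" for v
      unfolding s_def[of m m'']
    proof (rule cSUP_least[OF S_ne])
      fix x assume x: "x \<in> ?S v"
      from tv_dist_triangle[OF k[OF m(1) v x] k[OF m(2) v x] k[OF m(3) v x]]
        up[OF m(1,2) v x] up[OF m(2,3) v x]
      show "tv_dist (m v x) (m'' v x) \<le> s m m' v + s m' m'' v" by linarith
    qed
    then show "tv_dist_nets V E X m m'' \<le> tv_dist_nets V E X m m' + tv_dist_nets V E X m' m''"
      using m by (simp add: d sum.distrib[symmetric] sum_mono)
  qed
qed

end

theory Submission
  imports Defs
begin

text \<open>By soundness of d-separation (\<open>kernel_product_markov\<close>) the distribution of every network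
has all independences that the graph demands. A network is therefore faithful iff, for each of the
finitely many triples \<open>(A, B, C)\<close> that are not d-separated, its distribution violates
\<open>X\<^sub>A \<bottom> X\<^sub>B | X\<^sub>C\<close>. A finite intersection of open dense sets is open and dense, so one triple may
be treated at a time.

The violating networks form an open set because the distribution map does not increase total variation
distances (\<open>kernel_product_tv_le\<close>), and because independence is a closed condition: if \<open>Q\<close> satisfies
it and \<open>P\<close> is within \<open>d\<close> of \<open>Q\<close>, then \<open>P\<close> satisfies each of the defining integral equations up to
\<open>4 d\<close> (\<open>cond_indep_defect_le\<close>).

They are dense for two reasons. First, at least one violating network exists
(\<open>d_connected_witness\<close>). Second, when one kernel moves along a segment, the distribution
\<open>P\<^sub>t = (1 - t) P\<^sub>0 + t P\<^sub>1\<close> is affine in the parameter. Take densities with respect to \<open>P\<^bsub>1/2\<^esub>\<close> on the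
sigma-algebra of \<open>X\<^sub>C\<close>: independence under \<open>P\<^sub>t\<close> says that, for almost every value of \<open>X\<^sub>C\<close>, a polynomial
of degree two in \<open>t\<close> vanishes. Three parameters with independence thus force independence at \<open>t = 1\<close>
(\<open>cond_indep_mixture_extrapolate\<close>). If a whole ball around a network consisted of networks with the
independence, one could exchange its kernels one after the other for those of the violating network,
and each exchange would keep the independence: a contradiction.

Soundness is the argument of Verma and Pearl: conditional independence of coordinates is a
semigraphoid, a product of kernels satisfies the local Markov property along the order in which it is
built (\<open>kernel_product_local_markov\<close>), and d-separation follows from these two facts by adding one
sink after the other (\<open>d_separation_sound\<close>).

For the violating network choose an active path with as few colliders as possible. Then each collider
has a directed path into \<open>C\<close> that never returns to the active path
(\<open>active_path_with_clean_tails\<close>). Give every vertex two values, on and off. The non-colliders of the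
path pass \<open>on\<close> from the first vertex \<open>a\<close> to the last vertex \<open>b\<close>; a collider is switched on when the message
breaks there, and its tail carries that alarm into \<open>C\<close>. On the event that all of \<open>C\<close> is off, \<open>a\<close> on
and \<open>b\<close> off is then impossible, although each of the two has positive probability.\<close>

section \<open>Open walks and d-separation\<close>

text \<open>The condition that d-connection puts on an interior vertex of a walk, given its two neighbours.
Unlike the index-based definition it makes sense for walks that repeat vertices, and it is checked on
consecutive triples, so that it is compatible with appending walks.\<close>

definition open_at :: "('v \<times> 'v) set \<Rightarrow> 'v set \<Rightarrow> 'v \<Rightarrow> 'v \<Rightarrow> 'v \<Rightarrow> bool" where
  "open_at E C x y z \<longleftrightarrow>
     (if (x, y) \<in> E \<and> (z, y) \<in> E then y \<in> ancestors E C else y \<notin> C)"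

fun open_walk :: "('v \<times> 'v) set \<Rightarrow> 'v set \<Rightarrow> 'v list \<Rightarrow> bool" where
  "open_walk E C [] \<longleftrightarrow> False"
| "open_walk E C [x] \<longleftrightarrow> True"
| "open_walk E C [x, y] \<longleftrightarrow> (x, y) \<in> E \<or> (y, x) \<in> E"
| "open_walk E C (x # y # z # r) \<longleftrightarrow>
     ((x, y) \<in> E \<or> (y, x) \<in> E) \<and> open_at E C x y z \<and> open_walk E C (y # z # r)"

fun colliders :: "('v \<times> 'v) set \<Rightarrow> 'v list \<Rightarrow> 'v set" where
  "colliders E (x # y # z # r) =
     (if (x, y) \<in> E \<and> (z, y) \<in> E then {y} else {}) \<union> colliders E (y # z # r)"
| "colliders E p = {}"

definition active :: "('v \<times> 'v) set \<Rightarrow> 'v set \<Rightarrow> 'v list \<Rightarrow> bool" where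
  "active E C p \<longleftrightarrow> open_walk E C p \<and> hd p \<notin> C \<and> last p \<notin> C"

lemma open_walk_Cons:
  "open_walk E C (x # r) \<longleftrightarrow> r = [] \<or>
     ((x, hd r) \<in> E \<or> (hd r, x) \<in> E) \<and> open_walk E C r \<and> (tl r \<noteq> [] \<longrightarrow> open_at E C x (hd r) (hd (tl r)))"
  by (cases r; cases "tl r") auto

lemma colliders_Cons:
  "colliders E (x # r) = colliders E r \<union>
     (if r \<noteq> [] \<and> tl r \<noteq> [] \<and> (x, hd r) \<in> E \<and> (hd (tl r), hd r) \<in> E then {hd r} else {})"
  by (cases r; cases "tl r") auto

text \<open>Walks are cut and glued at a vertex; only the triple around that vertex has to be examined.\<close>

lemma open_walk_append:
  "open_walk E C (xs @ y # zs) \<longleftrightarrow> open_walk E C (xs @ [y]) \<and> open_walk E C (y # zs) \<and>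
     (xs \<noteq> [] \<and> zs \<noteq> [] \<longrightarrow> open_at E C (last xs) y (hd zs))"
proof (induction xs)
  case (Cons x xs)
  show ?case
  proof (cases xs)
    case Nil
    then show ?thesis by (cases zs) auto
  next
    case (Cons x' xs')
    then show ?thesis using Cons.IH
      by (simp add: open_walk_Cons[of E C x] open_walk_Cons[of E C x "x' # xs' @ [y]"] neq_Nil_conv)
        (cases xs'; auto)
  qed
qed auto

lemma colliders_append:
  "colliders E (xs @ y # zs) = colliders E (xs @ [y]) \<union> colliders E (y # zs) \<union>
     (if xs \<noteq> [] \<and> zs \<noteq> [] \<and> (last xs, y) \<in> E \<and> (hd zs, y) \<in> E then {y} else {})"
proof (induction xs)
  case (Cons x xs)
  show ?case
  proof (cases xs)
    case Nil
    then show ?thesis by (cases zs) auto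
  next
    case (Cons x' xs')
    then show ?thesis using Cons.IH
      by (cases xs') auto
  qed
qed auto

lemma open_at_commute: "open_at E C x y z = open_at E C z y x"
  by (auto simp: open_at_def)

lemma open_walk_rev: "open_walk E C (rev p) = open_walk E C p"
proof (induction p rule: open_walk.induct)
  case (4 E C x y z r)
  have "open_walk E C (rev (x # y # z # r)) = open_walk E C ((rev r @ [z]) @ y # [x])" by simp
  also have "\<dots> \<longleftrightarrow> open_walk E C (x # y # z # r)"
    by (subst open_walk_append[of E C "rev r @ [z]" y "[x]"])
      (use 4 in \<open>auto simp: open_at_commute\<close>)
  finally show ?case .
qed auto

lemma colliders_rev: "colliders E (rev p) = colliders E p"
proof (induction E p rule: colliders.induct)
  case (1 E x y z r)
  have "colliders E (rev (x # y # z # r)) = colliders E ((rev r @ [z]) @ y # [x])" by simp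
  also have "\<dots> = colliders E (x # y # z # r)"
    by (subst colliders_append[of E "rev r @ [z]" y "[x]"]) (use 1 in auto)
  finally show ?case .
qed auto

lemma active_rev: "active E C (rev p) = active E C p"
  by (cases "p = []") (auto simp: active_def open_walk_rev hd_rev last_rev)

lemma colliders_subset: "colliders E p \<subseteq> set p"
  by (induction E p rule: colliders.induct) auto

lemma colliders_ancestors: "open_walk E C p \<Longrightarrow> colliders E p \<subseteq> ancestors E C"
  by (induction E C p rule: open_walk.induct) (auto simp: open_at_def split: if_splits)

text \<open>Once a walk follows an arrow, the only way to turn against the arrows is a collider.\<close>

lemma collider_free_descent:
  assumes "open_walk E C (z # r)" "r \<noteq> []" "(z, hd r) \<in> E" "colliders E (z # r) = {}"
  shows "(z, last r) \<in> E\<^sup>+"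
  using assms
proof (induction r arbitrary: z)
  case (Cons y r)
  show ?case
  proof (cases r)
    case (Cons y' r')
    then have "(y', y) \<notin> E" using Cons.prems by auto
    then have "(y, hd r) \<in> E" using Cons Cons.prems by (auto simp: open_walk_Cons[of E C y])
    then have "(y, last r) \<in> E\<^sup>+"
      using Cons Cons.prems by (intro Cons.IH) auto
    then show ?thesis using Cons Cons.prems by (auto intro: trancl_into_trancl2)
  qed (use Cons.prems in auto)
qed simp

lemma ancestors_self: "C \<subseteq> ancestors E C"
  by (auto simp: ancestors_def)

lemma ancestors_rtrancl: "(x, y) \<in> E\<^sup>* \<Longrightarrow> y \<in> ancestors E C \<Longrightarrow> x \<in> ancestors E C"
  unfolding ancestors_def by (blast intro: rtrancl_trans)

text \<open>Companion of \<open>collider_free_descent\<close>: the walk leaves \<open>z\<close> along an arrow and follows arrows until it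
meets its first collider, which has a descendant in \<open>C\<close>.\<close>

lemma colliders_reachable:
  assumes "open_walk E C (z # r)" "r \<noteq> []" "(z, hd r) \<in> E" "colliders E (z # r) \<noteq> {}"
  shows "z \<in> ancestors E C"
  using assms
proof (induction r arbitrary: z)
  case (Cons y r)
  show ?case
  proof (cases r)
    case (Cons y' r')
    have "y \<in> ancestors E C"
    proof (cases "(y', y) \<in> E")
      case True
      then show ?thesis using Cons Cons.prems by (auto simp: open_at_def)
    next
      case False
      then show ?thesis using Cons Cons.prems by (intro Cons.IH) (auto simp: open_walk_Cons[of E C y])
    qed
    then show ?thesis using Cons.prems(3) by (auto intro: ancestors_rtrancl)
  qed (use Cons.prems in auto)
qed simp

text \<open>Suppose that cutting out the loop makes \<open>z\<close> a collider that it was not before. Then the loop leaves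
\<open>z\<close> along an arrow. It contains a collider below \<open>z\<close>, because otherwise it would be a directed cycle,
and so \<open>z\<close> is an ancestor of \<open>C\<close>.\<close>

lemma active_shortcut:
  assumes "acyclic E" "active E C (xs @ z # ys @ z # zs)"
  shows "active E C (xs @ z # zs)"
proof -
  have o: "open_walk E C (xs @ z # ys @ z # zs)" using assms by (simp add: active_def)
  from o have 1: "open_walk E C (xs @ [z])" "open_walk E C ((z # ys) @ z # zs)"
    "xs \<noteq> [] \<Longrightarrow> open_at E C (last xs) z (hd (ys @ z # zs))"
    using open_walk_append[of E C xs z "ys @ z # zs"] by auto
  from 1(2) have 2: "open_walk E C (z # ys @ [z])" "open_walk E C (z # zs)"
    "zs \<noteq> [] \<Longrightarrow> open_at E C (last (z # ys)) z (hd zs)"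
    using open_walk_append[of E C "z # ys" z zs] by auto
  have "open_at E C (last xs) z (hd zs)" if "xs \<noteq> []" "zs \<noteq> []"
  proof (cases "(last xs, z) \<in> E \<and> (hd zs, z) \<in> E")
    case True
    have "z \<in> ancestors E C"
    proof (cases "(hd (ys @ [z]), z) \<in> E")
      case True': True
      then show ?thesis using 1(3) True that by (cases ys) (auto simp: open_at_def)
    next
      case False
      then have e: "(z, hd (ys @ [z])) \<in> E" using 2(1) by (cases ys) (auto simp: open_walk_Cons[of E C z])
      show ?thesis
      proof (rule ccontr)
        assume "z \<notin> ancestors E C"
        then have "colliders E (z # ys @ [z]) = {}"
          using colliders_reachable[OF 2(1) _ e] by auto
        from collider_free_descent[OF 2(1) _ e this] \<open>acyclic E\<close> show False by (auto simp: acyclic_def)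
      qed
    qed
    then show ?thesis using True by (simp add: open_at_def)
  next
    case False
    then have "z \<notin> C"
      using 1(3) 2(3) that by (cases ys rule: rev_cases) (auto simp: open_at_def split: if_splits)
    then show ?thesis using False by (auto simp: open_at_def)
  qed
  then have "open_walk E C (xs @ z # zs)"
    using 1 2 open_walk_append[of E C xs z zs] by auto
  moreover have "hd (xs @ z # zs) = hd (xs @ z # ys @ z # zs)" 
    "last (xs @ z # zs) = last (xs @ z # ys @ z # zs)"
    by (cases xs; simp)+
  ultimately show ?thesis using assms(2) unfolding active_def by metis
qed

lemma active_walk_to_path:
  assumes "acyclic E" "active E C p"
  shows "\<exists>q. distinct q \<and> active E C q \<and> hd q = hd p \<and> last q = last p \<and> set q \<subseteq> set p"
  using assms(2)
proof (induction p rule: length_induct)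
  case (1 p)
  show ?case
  proof (cases "distinct p")
    case False
    then obtain xs z ys zs where p: "p = xs @ [z] @ ys @ [z] @ zs"
      using not_distinct_decomp by blast
    have "active E C (xs @ z # zs)"
      using active_shortcut[OF assms(1)] 1(2) p by auto
    moreover have "length (xs @ z # zs) < length p" by (simp add: p)
    ultimately obtain q where "distinct q" "active E C q" "hd q = hd (xs @ z # zs)"
       "last q = last (xs @ z # zs)" "set q \<subseteq> set (xs @ z # zs)"
      using 1(1) by blast
    moreover have "hd (xs @ z # zs) = hd p" "last (xs @ z # zs) = last p" 
      "set (xs @ z # zs) \<subseteq> set p"
      unfolding p by (cases xs; auto)+
    ultimately show ?thesis by auto
  qed (use 1 in auto)
qed

lemma open_walk_nth:
  "open_walk E C p \<longleftrightarrow> p \<noteq> [] \<and>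
     (\<forall>i. Suc i < length p \<longrightarrow> (p ! i, p ! Suc i) \<in> E \<or> (p ! Suc i, p ! i) \<in> E) \<and>
     (\<forall>i. Suc (Suc i) < length p \<longrightarrow> open_at E C (p ! i) (p ! Suc i) (p ! Suc (Suc i)))"
proof (induction E C p rule: open_walk.induct)
  case (4 E C x y z r)
  have all: "(\<forall>i. Q i) \<longleftrightarrow> Q 0 \<and> (\<forall>i. Q (Suc i))" for Q
    by (metis not0_implies_Suc)
  show ?case
    unfolding open_walk.simps 4
    by (subst (3) all, subst (4) all) auto
qed (auto simp: less_Suc_eq)

lemma active_path_iff:
  "is_path W E p \<and> \<not> blocked E C p \<longleftrightarrow> distinct p \<and> set p \<subseteq> W \<and> active E C p"
proof -
  have "blocked E C p \<longleftrightarrow> \<not> (hd p \<notin> C \<and> last p \<notin> C \<and>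
     (\<forall>i. Suc (Suc i) < length p \<longrightarrow> open_at E C (p ! i) (p ! Suc i) (p ! Suc (Suc i))))"
    if "p \<noteq> []"
  proof -
    have "(\<exists>i<length p. Q i) \<longleftrightarrow> Q 0 \<or> Q (length p - 1) \<or> (\<exists>i. Suc (Suc i) < length p \<and> Q (Suc i))"
      (is "?l \<longleftrightarrow> ?r") for Q
    proof
      assume ?l
      then obtain i where i: "i < length p" "Q i" by auto
      show ?r
      proof (cases i)
        case (Suc j)
        then show ?thesis using i by (cases "Suc (Suc j) < length p") (auto simp: not_less le_Suc_eq)
      qed (use i in auto)
    next
      assume ?r
      then show ?l using that
        by (metis Suc_lessD diff_less length_greater_0_conv less_one)
    qed
    note this[of "\<lambda>i. (collider_at E p i \<and> p ! i \<notin> ancestors E C) \<or> (\<not> collider_at E p i \<and> p ! i \<in> C)"]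
    then show ?thesis using that
      unfolding blocked_def
      by (auto simp: collider_at_def open_at_def hd_conv_nth last_conv_nth)
  qed
  then show ?thesis
    unfolding is_path_def active_def open_walk_nth by auto
qed

text \<open>Walks may replace paths in the definition of d-separation. They can be concatenated freely, which is
what the induction over sinks needs.\<close>

lemma d_separated_iff:
  assumes "acyclic E"
  shows "d_separated W E A B C \<longleftrightarrow>
     (\<forall>p. set p \<subseteq> W \<and> active E C p \<and> hd p \<in> A \<longrightarrow> last p \<notin> B)"
proof
  assume d: "d_separated W E A B C"
  show "\<forall>p. set p \<subseteq> W \<and> active E C p \<and> hd p \<in> A \<longrightarrow> last p \<notin> B"
  proof (intro allI impI)
    fix p assume p: "set p \<subseteq> W \<and> active E C p \<and> hd p \<in> A"
    then obtain q where "distinct q" "active E C q" "hd q = hd p" "last q = last p" "set q \<subseteq> set p"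
      using active_walk_to_path[OF assms] by blast
    then show "last p \<notin> B"
      using d p active_path_iff[of W E q C] unfolding d_separated_def by auto
  qed
next
  assume "\<forall>p. set p \<subseteq> W \<and> active E C p \<and> hd p \<in> A \<longrightarrow> last p \<notin> B"
  then show "d_separated W E A B C"
    unfolding d_separated_def using active_path_iff[of W E _ C] by metis
qed

lemma d_separated_commute:
  assumes "acyclic E" "d_separated W E A B C"
  shows "d_separated W E B A C"
  unfolding d_separated_iff[OF assms(1)]
proof (intro allI impI notI)
  fix p assume p: "set p \<subseteq> W \<and> active E C p \<and> hd p \<in> B" "last p \<in> A"
  then have "p \<noteq> []" by (auto simp: active_def)
  then have "set (rev p) \<subseteq> W" "active E C (rev p)" "hd (rev p) \<in> A" "last (rev p) \<in> B"
    using p by (auto simp: active_rev hd_rev last_rev)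
  then show False using assms unfolding d_separated_iff[OF assms(1)] by blast
qed

section \<open>Soundness of d-separation in semigraphoids\<close>

lemma active_singleton: "active E C [x] \<longleftrightarrow> x \<notin> C"
  by (simp add: active_def)

lemma active_ConsI:
  assumes "active E C p" "(hd p, v) \<in> E" "(v, hd p) \<notin> E" "v \<notin> C"
  shows "active E C (v # p)"
  using assms unfolding active_def by (subst open_walk_Cons) (auto simp: open_at_def)

lemma open_walk_insert: "open_walk E C p \<Longrightarrow> v \<notin> set p \<Longrightarrow> open_walk E (insert v C) p"
  by (induction E C p rule: open_walk.induct) (auto simp: open_at_def ancestors_def split: if_splits)

text \<open>Conditioning on a common child \<open>v\<close> opens the collider at \<open>v\<close>.\<close>

lemma active_through_sink:
  assumes "active E C p" "active E C q" "(last p, v) \<in> E" "(hd q, v) \<in> E"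
    and "(v, last p) \<notin> E" "(v, hd q) \<notin> E" "v \<notin> set p" "v \<notin> set q"
  shows "active E (insert v C) (p @ v # q)"
proof -
  have ne: "p \<noteq> []" "q \<noteq> []" using assms by (auto simp: active_def)
  have o: "open_walk E (insert v C) p" "open_walk E (insert v C) q"
    using assms by (auto simp: active_def intro: open_walk_insert)
  have h: "hd p \<notin> insert v C" "last q \<notin> insert v C" "last p \<notin> insert v C" "hd q \<notin> insert v C"
    using assms ne by (auto simp: active_def)
  have q: "open_walk E (insert v C) (v # q)"
    using o h assms ne by (subst open_walk_Cons) (auto simp: open_at_def)
  have "open_walk E (insert v C) (v # rev p)"
    using o h assms ne by (subst open_walk_Cons) (auto simp: open_at_def open_walk_rev hd_rev)
  then have p: "open_walk E (insert v C) (p @ [v])"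
    using open_walk_rev[of E "insert v C" "p @ [v]"] by simp
  have "open_at E (insert v C) (last p) v (hd q)"
    using assms ancestors_self[of "insert v C" E] by (auto simp: open_at_def)
  then have "open_walk E (insert v C) (p @ v # q)"
    by (subst open_walk_append) (use p q in auto)
  then show ?thesis using h ne by (auto simp: active_def)
qed

text \<open>The axioms are stated for sets that may overlap, with redundancy \<open>CI A C C\<close> to handle the overlap.\<close>

locale semigraphoid =
  fixes CI :: "'v set \<Rightarrow> 'v set \<Rightarrow> 'v set \<Rightarrow> bool" and U :: "'v set"
  assumes symmetry: "\<lbrakk>A \<subseteq> U; B \<subseteq> U; C \<subseteq> U; CI A B C\<rbrakk> \<Longrightarrow> CI B A C"
    and decomposition: "\<lbrakk>A \<subseteq> U; B \<subseteq> U; C \<subseteq> U; CI A B C; B' \<subseteq> B\<rbrakk> \<Longrightarrow> CI A B' C"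
    and weak_union: "\<lbrakk>A \<subseteq> U; B \<subseteq> U; C \<subseteq> U; D \<subseteq> U; CI A (B \<union> D) C\<rbrakk> \<Longrightarrow> CI A B (C \<union> D)"
    and contraction: "\<lbrakk>A \<subseteq> U; B \<subseteq> U; C \<subseteq> U; D \<subseteq> U; CI A B C; CI A D (B \<union> C)\<rbrakk> \<Longrightarrow> CI A (B \<union> D) C"
    and redundancy: "\<lbrakk>A \<subseteq> U; C \<subseteq> U\<rbrakk> \<Longrightarrow> CI A C C"
begin

lemma decomposition_left: "\<lbrakk>A \<subseteq> U; B \<subseteq> U; C \<subseteq> U; CI A B C; A' \<subseteq> A\<rbrakk> \<Longrightarrow> CI A' B C"
  by (meson symmetry decomposition order_trans)

text \<open>Coordinates that are conditioned on can be added to either side for free. This removes all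
disjointness assumptions from the arguments below.\<close>

lemma add_given:
  assumes "A \<subseteq> U" "B \<subseteq> U" "C \<subseteq> U" "CI A B C"
  shows "CI (A \<union> C) (B \<union> C) C"
proof -
  have *: "CI A' (B' \<union> C) C" if "A' \<subseteq> U" "B' \<subseteq> U" "CI A' B' C" for A' B'
  proof -
    have "CI A' (B' \<union> C) (B' \<union> C)" using that assms redundancy[of A' "B' \<union> C"] by auto
    then have "CI A' C (B' \<union> C)" using that assms decomposition[of A' "B' \<union> C" "B' \<union> C" C] by auto
    then show ?thesis using contraction[of A' B' C C] that assms by auto
  qed
  have "CI (B \<union> C) A C" using *[OF assms(1,2,4)] assms symmetry[of A "B \<union> C" C] by auto
  from *[OF _ assms(1) this] assms show ?thesis using symmetry[of "B \<union> C" "A \<union> C" C] by auto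
qed

text \<open>A vertex \<open>v\<close> that depends on the rest only through parents inside \<open>A \<union> C\<close> carries no information about
\<open>B\<close> beyond \<open>A \<union> C\<close>.\<close>

lemma add_descendant:
  assumes "A \<subseteq> U" "B \<subseteq> U" "C \<subseteq> U" "P \<subseteq> A \<union> C" "v \<in> U" "CI A B C" "CI {v} (A \<union> B \<union> C) P"
  shows "CI (insert v A) B C"
proof -
  have P: "P \<subseteq> U" using assms by auto
  have "CI {v} (B \<union> (A \<union> C)) P" using assms(7) by (simp add: Un_ac)
  then have "CI {v} B (P \<union> (A \<union> C))" using weak_union[of "{v}" B P "A \<union> C"] assms P by auto
  moreover have "P \<union> (A \<union> C) = A \<union> C" using assms by auto
  ultimately have "CI B {v} (A \<union> C)" using symmetry[of "{v}" B "A \<union> C"] assms by auto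
  moreover have "CI B A C" using symmetry[of A B C] assms by auto
  ultimately have "CI B (A \<union> {v}) C" using contraction[of B A C "{v}"] assms by auto
  then show ?thesis using symmetry[of B "A \<union> {v}" C] assms by auto
qed

end

text \<open>The list \<open>vs\<close> enumerates the vertices with parents to the right of their children, and the hypothesis is
the local Markov property along it. The induction adds the sink \<open>v\<close>. If \<open>v\<close> belongs to \<open>A\<close>, active walks
from its parents extend to active walks from \<open>v\<close>, hence the parents outside \<open>C\<close> are separated from
\<open>B\<close> too and \<open>v\<close> joins by \<open>add_descendant\<close>. If \<open>v\<close> belongs to \<open>C\<close>, it must not be possible to reach
both \<open>A\<close> and \<open>B\<close> from its parents, since the two walks could be joined at \<open>v\<close>; so the parents are
separated from \<open>A\<close> or from \<open>B\<close>, \<open>v\<close> joins the opposite side, and weak union moves it into the condition.\<close>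

theorem (in semigraphoid) d_separation_sound:
  assumes "acyclic E"
    and "\<And>us v ws. vs = us @ v # ws \<Longrightarrow> pa E v \<subseteq> set ws \<and> CI {v} (set ws) (pa E v)"
    and "distinct vs" "set vs \<subseteq> U"
    and "A \<subseteq> set vs" "B \<subseteq> set vs" "C \<subseteq> set vs" "d_separated (set vs) E A B C"
  shows "CI A B C"
  using assms(2-)
proof (induction vs arbitrary: A B C)
  case Nil
  then show ?case using redundancy[of "{}" "{}"] by auto
next
  case (Cons v W)
  note dsep = d_separated_iff[OF assms(1)]
  let ?W = "set W"
  have local: "pa E v \<subseteq> ?W" "CI {v} ?W (pa E v)" using Cons.prems(1)[of "[]" v W] by auto
  have IH: "CI A' B' C'" if "A' \<subseteq> ?W" "B' \<subseteq> ?W" "C' \<subseteq> ?W" "d_separated ?W E A' B' C'" for A' B' C'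
    using Cons.prems(1)[of "v # _"] that Cons.prems(2,3) by (intro Cons.IH) auto
  have v: "v \<notin> ?W" "v \<in> U" "?W \<subseteq> U" using Cons.prems by auto
  have U: "A \<subseteq> U" "B \<subseteq> U" "C \<subseteq> U" using Cons.prems by auto
  have out: "(v, w) \<notin> E" if "w \<in> ?W" for w
  proof
    assume "(v, w) \<in> E"
    obtain us ws where "W = us @ w # ws" using split_list[OF \<open>w \<in> ?W\<close>] by blast
    then have "pa E w \<subseteq> ?W" using Cons.prems(1)[of "v # us" w ws] by auto
    then show False using \<open>(v, w) \<in> E\<close> v by (auto simp: pa_def)
  qed
  have loop: "(v, v) \<notin> E" using local v by (auto simp: pa_def)
  have enlarge: "d_separated ?W E (A' \<union> (pa E v - C')) B' C'" 
    if d: "d_separated ?W E A' B' C'" and n: "\<And>p. set p \<subseteq> ?W \<Longrightarrow> active E C' p \<Longrightarrow> hd p \<in> pa E v \<Longrightarrow> last p \<notin> B'" 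
    for A' B' C'
    using d n unfolding dsep by auto
  have absorb: "CI (insert v A') B' C'"
    if sub: "A' \<subseteq> ?W" "B' \<subseteq> ?W" "C' \<subseteq> ?W" and "d_separated ?W E (A' \<union> (pa E v - C')) B' C'" for A' B' C'
  proof -
    let ?A = "A' \<union> (pa E v - C')"
    have "CI ?A B' C'" using that local by (intro IH) auto
    moreover have "CI {v} (?A \<union> B' \<union> C') (pa E v)"
      using local sub v by (intro decomposition[OF _ _ _ local(2)]) auto
    ultimately have "CI (insert v ?A) B' C'"
      using sub local v by (intro add_descendant[of ?A B' C' "pa E v"]) auto
    then show ?thesis
      using sub local v by (intro decomposition_left[of "insert v ?A" B' C' "insert v A'"]) auto
  qed
  have one_side: "CI A' B' C'"
    if sub: "A' \<subseteq> insert v ?W" "B' \<subseteq> ?W" "C' \<subseteq> ?W" and "d_separated (insert v ?W) E A' B' C'" for A' B' C'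
  proof (cases "v \<in> A'")
    case True
    have "CI (insert v (A' - {v})) B' C'"
    proof (intro absorb enlarge)
      show "d_separated ?W E (A' - {v}) B' C'" using that unfolding dsep by auto
      fix p assume p: "set p \<subseteq> ?W" "active E C' p" "hd p \<in> pa E v"
      then have "p \<noteq> []" by (auto simp: active_def)
      then have "hd p \<in> ?W" using p by auto
      then have "active E C' (v # p)" using p v sub out[of "hd p"]
        by (intro active_ConsI) (auto simp: pa_def)
      with \<open>p \<noteq> []\<close> show "last p \<notin> B'"
        using that(4) True p unfolding dsep by (auto dest!: spec[of _ "v # p"])
    qed (use sub in auto)
    then show ?thesis using True by (simp add: insert_absorb)
  next
    case False
    then show ?thesis using that unfolding dsep by (intro IH) (auto simp: dsep)
  qed
  show ?case
  proof (cases "v \<in> C")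
    case False
    then have C: "C \<subseteq> ?W" using Cons.prems by auto
    show ?thesis
    proof (cases "v \<in> B")
      case True
      have "v \<notin> A"
        using Cons.prems(7) True False unfolding dsep by (auto dest!: spec[of _ "[v]"] simp: active_singleton)
      then have "CI B A C"
        using Cons.prems C d_separated_commute[OF assms(1) Cons.prems(7)] by (intro one_side) auto
      then show ?thesis using symmetry[of B A C] U by auto
    next
      case False
      then have "B \<subseteq> ?W" using Cons.prems(5) by auto
      then show ?thesis using Cons.prems C by (intro one_side) auto
    qed
  next
    case True
    define C' where "C' = C - {v}"
    have C: "C = insert v C'" "C' \<subseteq> ?W" "v \<notin> C'" using True Cons.prems by (auto simp: C'_def)
    have transfer: "active E C p" if "set p \<subseteq> ?W" "active E C' p" for p
    proof -
      have "p \<noteq> []" using that by (auto simp: active_def)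
      then have "hd p \<in> ?W" "last p \<in> ?W" "v \<notin> set p" using that v by auto
      then show ?thesis using that v open_walk_insert[of E C' p v] by (auto simp: active_def C(1))
    qed
    have *: "CI A' B' C"
      if sub: "A' \<subseteq> insert v ?W" "B' \<subseteq> insert v ?W" and d: "d_separated (insert v ?W) E A' B' C"
        and n: "\<And>p. set p \<subseteq> ?W \<Longrightarrow> active E C' p \<Longrightarrow> hd p \<in> pa E v \<Longrightarrow> last p \<notin> B'" for A' B'
    proof -
      have "d_separated ?W E (A' - {v}) (B' - {v}) C'"
        using d transfer unfolding dsep by (meson DiffD1 subset_insertI subset_trans)
      then have "CI (insert v (A' - {v})) (B' - {v}) C'"
        using sub C n by (intro absorb enlarge) auto
      then have "CI (B' - {v}) (insert v (A' - {v})) C'"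
        using sub C v by (intro symmetry[of "insert v (A' - {v})"]) auto
      then have "CI (B' - {v}) (A' - {v}) (C' \<union> {v})"
        using sub C v by (intro weak_union) auto
      then have "CI (B' - {v}) (A' - {v}) C" using C by simp
      then have "CI (B' - {v} \<union> C) (A' - {v} \<union> C) C"
        using sub C v by (intro add_given) auto
      then have "CI (B' - {v} \<union> C) A' C"
        using sub C v by (intro decomposition[of "B' - {v} \<union> C" "A' - {v} \<union> C" C A']) auto
      then have "CI B' A' C"
        using sub C v by (intro decomposition_left[of "B' - {v} \<union> C" A' C B']) auto
      then show ?thesis using sub C v symmetry[of B' A' C] by auto
    qed
    show ?thesis
    proof (cases "\<exists>q. set q \<subseteq> ?W \<and> active E C' q \<and> hd q \<in> pa E v \<and> last q \<in> B")
      case False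
      then show ?thesis using Cons.prems by (intro *) auto
    next
      case True
      then obtain q where q: "set q \<subseteq> ?W" "active E C' q" "hd q \<in> pa E v" "last q \<in> B" by auto
      have "CI B A C"
      proof (rule *)
        fix p assume p: "set p \<subseteq> ?W" "active E C' p" "hd p \<in> pa E v"
        show "last p \<notin> A"
        proof
          assume A: "last p \<in> A"
          have ne: "p \<noteq> []" "q \<noteq> []" using p q by (auto simp: active_def)
          then have "hd p \<in> ?W" "hd q \<in> ?W" using p q by auto
          then have "active E C (rev p @ v # q)"
            unfolding C(1) using p q v ne out[of "hd p"] out[of "hd q"] 
            by (intro active_through_sink) (auto simp: active_rev last_rev pa_def)
          then show False using Cons.prems(7) A p q ne unfolding dsep
            by (auto dest!: spec[of _ "rev p @ v # q"] simp: hd_append hd_rev)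
        qed
      qed (use Cons.prems d_separated_commute[OF assms(1) Cons.prems(7)] in auto)
      then show ?thesis using symmetry[of B A C] U by auto
    qed
  qed
qed

section \<open>Active paths whose colliders have clean tails\<close>

lemma colliders_Cons_subset: "colliders E (x # r) \<subseteq> set r"
  using colliders_subset[of E r] by (auto simp: colliders_Cons split: if_splits)

lemma colliders_snoc_subset: "colliders E (xs @ [y]) \<subseteq> set xs"
  using colliders_Cons_subset[of E y "rev xs"] colliders_rev[of E "xs @ [y]"] by simp

abbreviation directed :: "('v \<times> 'v) set \<Rightarrow> 'v list \<Rightarrow> bool" where
  "directed E \<equiv> successively (\<lambda>x y. (x, y) \<in> E)"

lemma directed_trancl: "directed E (x # r) \<Longrightarrow> y \<in> set r \<Longrightarrow> (x, y) \<in> E\<^sup>+"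
  by (induction r arbitrary: x) (auto simp: successively_Cons intro: trancl_into_trancl2)

lemma directed_distinct: "acyclic E \<Longrightarrow> directed E r \<Longrightarrow> distinct r"
proof (induction r)
  case (Cons x r)
  then show ?case using directed_trancl[of E x r x] by (auto simp: acyclic_def successively_Cons)
qed simp

lemma acyclic_asym: "acyclic E \<Longrightarrow> (x, y) \<in> E \<Longrightarrow> (y, x) \<notin> E"
  unfolding acyclic_def by (meson trancl.simps)

lemma directed_colliders: "acyclic E \<Longrightarrow> directed E r \<Longrightarrow> colliders E r = {}"
  by (induction E r rule: colliders.induct) (auto dest: acyclic_asym)

lemma directed_open_walk:
  assumes "acyclic E"
  shows "directed E (x # ts @ [y]) \<Longrightarrow> set ts \<inter> C = {} \<Longrightarrow> open_walk E C (x # ts @ [y])"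
proof (induction ts arbitrary: x)
  case (Cons t ts)
  have "open_walk E C (t # ts @ [y])" using Cons by auto
  moreover have "(hd (ts @ [y]), t) \<notin> E"
    using Cons.prems(1) acyclic_asym[OF assms] by (auto simp: successively_Cons)
  ultimately show ?case using Cons.prems by (subst open_walk_Cons) (auto simp: open_at_def)
qed auto

text \<open>If the directed path from a collider \<open>v\<close> towards \<open>C\<close> returns to the active path at \<open>w\<close>, on the detour
along it \<open>v\<close> is no longer a collider. The detour may create a new collider at \<open>w\<close>, but in that case it saves a second old
one, so the number of colliders always drops.\<close>

lemma reroute:
  assumes ac: "acyclic E" and p: "p = xs @ v # ys @ w # zs" "distinct p" "active E C p"
    and v: "v \<in> colliders E p" "v \<notin> C"
    and t: "directed E (v # ts @ [w])" "set ts \<inter> (set p \<union> C) = {}" "w \<in> ancestors E C"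
  shows "distinct (xs @ v # ts @ w # zs)" "active E C (xs @ v # ts @ w # zs)"
    "card (colliders E (xs @ v # ts @ w # zs)) < card (colliders E p)"
proof -
  let ?q = "xs @ v # ts @ w # zs"
  have d: "directed E ((v # ts) @ [w])" using t by simp
  show "distinct ?q"
    using p(1,2) t(2) directed_distinct[OF ac t(1)] by auto
  have vw: "(v, w) \<in> E\<^sup>+" using directed_trancl[OF t(1)] by auto
  have first: "(v, hd (ts @ [w])) \<in> E" "(last (v # ts), w) \<in> E"
    using t(1) d by (cases ts; auto simp: successively_append_iff successively_Cons)+
  have first': "(hd (ts @ w # zs), v) \<notin> E"
    using first(1) acyclic_asym[OF ac] by (cases ts) auto
  have o: "open_walk E C (xs @ v # ys @ w # zs)" using p by (simp add: active_def)
  then have o1: "open_walk E C (xs @ [v])" "open_walk E C ((v # ys) @ w # zs)"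
    using open_walk_append[of E C xs v "ys @ w # zs"] by auto
  then have o2: "open_walk E C ((v # ys) @ [w])" "open_walk E C (w # zs)"
    "zs \<noteq> [] \<Longrightarrow> open_at E C (last (v # ys)) w (hd zs)"
    using open_walk_append[of E C "v # ys" w zs] by blast+
  have "open_walk E C ((v # ts) @ w # zs)"
    using directed_open_walk[OF ac t(1), of C] t(2,3) o2 first
    by (subst open_walk_append) (auto simp: open_at_def split: if_splits)
  then have "open_walk E C ?q"
    using o1 v(2) first' by (subst open_walk_append) (auto simp: open_at_def)
  moreover have "hd ?q = hd p" "last ?q = last p" by (cases xs; simp add: p(1))+
  ultimately show "active E C ?q" using p(3) by (simp add: active_def)

  have cq: "colliders E ?q = colliders E (xs @ [v]) \<union> colliders E (w # zs) \<union>
      (if zs \<noteq> [] \<and> (hd zs, w) \<in> E then {w} else {})"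
    using colliders_append[of E xs v "ts @ w # zs"] colliders_append[of E "v # ts" w zs]
      directed_colliders[OF ac t(1)] first first' by auto
  have cp: "colliders E p = colliders E (xs @ [v]) \<union> colliders E (v # ys @ [w]) \<union> colliders E (w # zs) \<union>
      (if xs \<noteq> [] \<and> (last xs, v) \<in> E \<and> (hd (ys @ w # zs), v) \<in> E then {v} else {}) \<union>
      (if zs \<noteq> [] \<and> (last (v # ys), w) \<in> E \<and> (hd zs, w) \<in> E then {w} else {})"
    using colliders_append[of E xs v "ys @ w # zs"] colliders_append[of E "v # ys" w zs] p(1) by auto
  have s: "colliders E (xs @ [v]) \<subseteq> set xs" "colliders E (w # zs) \<subseteq> set zs"
    "colliders E (v # ys @ [w]) \<subseteq> set ys"
    using colliders_Cons_subset[of E w zs] colliders_snoc_subset[of E xs v]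
      colliders_Cons_subset[of E v "ys @ [w]"] colliders_snoc_subset[of E "v # ys" w] p(1,2)
    by auto
  have vq: "v \<notin> colliders E ?q" using s p(1,2) unfolding cq by auto
  have fin: "finite (colliders E p)" by (rule finite_subset[OF colliders_subset]) simp
  show "card (colliders E ?q) < card (colliders E p)"
  proof (cases "w \<in> colliders E p \<or> w \<notin> colliders E ?q")
    case True
    then have "colliders E ?q \<subseteq> colliders E p - {v}"
      using vq unfolding cq cp by auto
    then have "colliders E ?q \<subset> colliders E p" using v by auto
    then show ?thesis by (rule psubset_card_mono[OF fin])
  next
    case False
    \<comment> \<open>The old path leaves \<open>w\<close> towards \<open>v\<close> along an arrow, but \<open>v\<close> is an ancestor of \<open>w\<close>. So it meets
      a collider \<open>z\<close> strictly between the two, and the detour avoids \<open>z\<close> as well.\<close>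
    then have w: "zs \<noteq> []" "(hd zs, w) \<in> E" "w \<notin> colliders E p"
      using s p(1,2) unfolding cq by (auto split: if_splits)
    then have "(last (v # ys), w) \<notin> E" unfolding cp by auto
    moreover have r: "open_walk E C (w # rev ys @ [v])"
      using o2(1) open_walk_rev[of E C "(v # ys) @ [w]"] by simp
    ultimately have e: "(w, hd (rev ys @ [v])) \<in> E"
      by (subst (asm) open_walk_Cons) (cases ys rule: rev_cases; auto)
    have "colliders E (w # rev ys @ [v]) \<noteq> {}"
    proof
      assume "colliders E (w # rev ys @ [v]) = {}"
      from collider_free_descent[OF r _ e this] vw have "(v, v) \<in> E\<^sup>+" by auto
      then show False using ac by (auto simp: acyclic_def)
    qed
    then obtain z where z: "z \<in> colliders E (v # ys @ [w])"
      using colliders_rev[of E "v # ys @ [w]"] by auto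
    have "z \<notin> colliders E ?q" "z \<noteq> v" "z \<noteq> w" using s p(1,2) z unfolding cq by auto
    moreover have "colliders E ?q \<subseteq> insert w (colliders E p)" unfolding cq cp by auto
    ultimately have "colliders E ?q \<subseteq> insert w (colliders E p - {v, z})" using vq by blast
    then have "card (colliders E ?q) \<le> card (insert w (colliders E p - {v, z}))"
      using fin by (intro card_mono) auto
    also have "\<dots> \<le> Suc (card (colliders E p - {v, z}))" by (rule card_insert_le_m1) auto
    also have "card (colliders E p - {v, z}) = card (colliders E p) - 2"
      using v z cp \<open>z \<noteq> v\<close> by (subst card_Diff_subset) auto
    also have "card {v, z} \<le> card (colliders E p)"
      using v z cp fin by (intro card_mono) auto
    then have "Suc (card (colliders E p) - 2) < card (colliders E p)" using \<open>z \<noteq> v\<close> by auto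
    finally show ?thesis .
  qed
qed

text \<open>A directed path from \<open>v\<close> into \<open>C\<close> either avoids \<open>S\<close> after its start, or it has a first vertex \<open>w\<close> in
\<open>S\<close>. In the second case the vertices before \<open>w\<close> can be kept out of \<open>C\<close>.\<close>

lemma clean_descent_or_hit:
  assumes "(v, c) \<in> E\<^sup>*" "c \<in> C" "v \<notin> C"
  shows "v \<in> ancestors (E \<inter> (UNIV \<times> - S)) C \<or>
    (\<exists>ts w. directed E (v # ts @ [w]) \<and> w \<in> S \<and> set ts \<inter> (S \<union> C) = {} \<and> w \<in> ancestors E C)"
  using assms(1,3)
proof (induction rule: converse_rtrancl_induct)
  case base
  then show ?case using assms by auto
next
  case (step v y)
  have y: "y \<in> ancestors E C" using step(2) assms(2) by (auto simp: ancestors_def)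
  let ?E = "E \<inter> (UNIV \<times> - S)"
  show ?case
  proof (cases "y \<in> S")
    case True
    then show ?thesis using step y by (intro disjI2 exI[of _ "[]"] exI[of _ y]) auto
  next
    case False
    then have e: "(v, y) \<in> ?E" using step by auto
    have up: "v \<in> ancestors ?E C" if "y \<in> ancestors ?E C"
      using that e by (rule_tac ancestors_rtrancl[of v y]) auto
    show ?thesis
    proof (cases "y \<in> C")
      case True
      then show ?thesis using up ancestors_self[of C ?E] by auto
    next
      case False
      from step.IH[OF False] show ?thesis
      proof
        assume "\<exists>ts w. directed E (y # ts @ [w]) \<and> w \<in> S \<and> set ts \<inter> (S \<union> C) = {} \<and> w \<in> ancestors E C"
        then obtain ts w where "directed E (y # ts @ [w])" "w \<in> S" "set ts \<inter> (S \<union> C) = {}" "w \<in> ancestors E C"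
          by auto
        then show ?thesis using \<open>y \<notin> S\<close> \<open>y \<notin> C\<close> step
          by (intro disjI2 exI[of _ "y # ts"] exI[of _ w]) auto
      qed (use up in auto)
    qed
  qed
qed

text \<open>Rerouting terminates because it decreases the number of colliders. A walk that meets \<open>w\<close> before \<open>v\<close>
is rerouted after reversal.\<close>

lemma active_path_with_clean_tails:
  assumes ac: "acyclic E" and "active E C p" "distinct p"
  shows "\<exists>q. distinct q \<and> active E C q \<and> hd q = hd p \<and> last q = last p \<and>
    colliders E q \<subseteq> ancestors (E \<inter> (UNIV \<times> - set q)) C"
  using assms(2,3)
proof (induction "card (colliders E p)" arbitrary: p rule: less_induct)
  case less
  show ?case
  proof (cases "colliders E p \<subseteq> ancestors (E \<inter> (UNIV \<times> - set p)) C")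
    case False
    then obtain v where v: "v \<in> colliders E p" "v \<notin> ancestors (E \<inter> (UNIV \<times> - set p)) C" by auto
    have vC: "v \<notin> C" using v ancestors_self[of C] by blast
    have "v \<in> ancestors E C" using v less.prems colliders_ancestors by (auto simp: active_def)
    then obtain c where c: "(v, c) \<in> E\<^sup>*" "c \<in> C" by (auto simp: ancestors_def)
    from clean_descent_or_hit[OF c vC, of "set p"] v obtain ts w where t: "directed E (v # ts @ [w])" "w \<in> set p"
        "set ts \<inter> (set p \<union> C) = {}" "w \<in> ancestors E C"
      by blast
    have "w \<noteq> v" using directed_distinct[OF ac t(1)] by auto
    have vp: "v \<in> set p" using v(1) colliders_subset[of E p] by blast
    have shorter: "\<exists>q. distinct q \<and> active E C q \<and> hd q = hd p' \<and> last q = last p' \<and> 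
        card (colliders E q) < card (colliders E p')"
      if p': "p' = xs @ v # ys @ w # zs" "distinct p'" "active E C p'" "v \<in> colliders E p'" "set p' = set p"
      for p' xs ys zs
    proof -
      let ?q = "xs @ v # ts @ w # zs"
      have "distinct ?q" "active E C ?q" "card (colliders E ?q) < card (colliders E p')"
        using reroute[OF ac p'(1-4) vC t(1)] t(3,4) p'(5) by auto
      moreover have "hd ?q = hd p'" "last ?q = last p'" by (cases xs; simp add: p')+
      ultimately show ?thesis by blast
    qed
    have ne: "p \<noteq> []" using less.prems by (auto simp: active_def)
    obtain q where q: "distinct q" "active E C q" "hd q = hd p" "last q = last p" 
        "card (colliders E q) < card (colliders E p)"
    proof -
      from split_list[OF vp] obtain xs ys where p: "p = xs @ v # ys" by auto
      consider "w \<in> set xs" | "w \<in> set ys" using p t(2) \<open>w \<noteq> v\<close> by auto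
      then show ?thesis
      proof cases
        case 2
        then obtain ys1 ys2 where "ys = ys1 @ w # ys2" by (auto dest: split_list)
        then show ?thesis using shorter[of p xs ys1 ys2] p less.prems v(1) that by auto
      next
        case 1
        then obtain xs1 xs2 where "xs = xs1 @ w # xs2" by (auto dest: split_list)
        then have "rev p = rev ys @ v # rev xs2 @ w # rev xs1" using p by simp
        from shorter[OF this] obtain q where "distinct q" "active E C q" "hd q = hd (rev p)" "last q = last (rev p)" 
          "card (colliders E q) < card (colliders E (rev p))"
          using less.prems v(1) by (auto simp: active_rev colliders_rev)
        moreover from this have "q \<noteq> []" by (auto simp: active_def)
        ultimately show ?thesis using ne
          by (intro that[of "rev q"]) (auto simp: active_rev colliders_rev hd_rev last_rev)
      qed
    qed
    from less.hyps[OF q(5,2,1)] q(3,4) show ?thesis by auto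
  qed (use less.prems in blast)
qed

lemma active_subset:
  assumes "E \<subseteq> V \<times> V" "active E C p" "hd p \<in> V"
  shows "set p \<subseteq> V"
proof -
  have "set p \<subseteq> V" if "open_walk E C p" "hd p \<in> V" for p
    using that assms(1) by (induction E C p rule: open_walk.induct) auto
  then show ?thesis using assms by (auto simp: active_def)
qed

section \<open>The Borel sets of a finite product of separable metric spaces\<close>

lemma separable_metric_countable_base:
  assumes "separable_space (mtopology_of m)"
  shows "second_countable (mtopology_of m)"
proof -
  interpret Metric_space "mspace m" "mdist m" by (rule Metric_space_mspace_mdist)
  have mt: "mtopology_of m = mtopology" by (simp add: mtopology_of_def)
  obtain D where D: "countable D" "D \<subseteq> mspace m" "mtopology closure_of D = mspace m"
    using assms unfolding separable_space_def mt by auto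
  let ?B = "(\<lambda>(d, n). mball d (1 / real (Suc n))) ` (D \<times> UNIV)"
  show ?thesis
    unfolding second_countable_def mt
  proof (intro exI[of _ ?B] conjI allI impI ballI)
    show "countable ?B" using D by auto
    show "openin mtopology W" if "W \<in> ?B" for W using that by auto
    fix U x assume U: "openin mtopology U \<and> x \<in> U"
    then obtain r where r: "0 < r" "mball x r \<subseteq> U" by (auto simp: openin_mtopology)
    have x: "x \<in> mspace m" using U openin_subset by fastforce
    obtain n where n: "1 / real (Suc n) < r / 2"
      using nat_approx_posE[of "r / 2"] r by auto
    have "x \<in> mtopology closure_of D" using x D(3) by simp
    then have "\<forall>r>0. \<exists>y\<in>D. y \<in> mball x r" unfolding metric_closure_of by blast
    moreover have "0 < 1 / real (Suc n)" by simp
    ultimately obtain d where d: "d \<in> D" "d \<in> mball x (1 / real (Suc n))" by blast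
    show "\<exists>W\<in>?B. x \<in> W \<and> W \<subseteq> U"
    proof (intro bexI conjI)
      show "mball d (1 / real (Suc n)) \<in> ?B" using d by auto
      show "x \<in> mball d (1 / real (Suc n))" using d by (auto simp: commute)
      show "mball d (1 / real (Suc n)) \<subseteq> U"
      proof
        fix y assume y: "y \<in> mball d (1 / real (Suc n))"
        then have "mdist m x y \<le> mdist m x d + mdist m d y"
          using d x by (intro triangle) auto
        then show "y \<in> U" using y d n r x by (intro subsetD[OF r(2)]) auto
      qed
    qed
  qed
qed

lemma space_borel_at: "space (borel_at X v) = mspace (X v)"
  unfolding borel_at_def borel_of_def by (subst space_measure_of) (use openin_subset in force)+

lemma sets_borel_of: "sets (borel_of T) = sigma_sets (topspace T) {U. openin T U}"
  unfolding borel_of_def by (intro sets_measure_of) (auto dest: openin_subset)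

lemma open_in_borel_at: "openin (mtopology_of (X v)) U \<Longrightarrow> U \<in> sets (borel_at X v)"
  by (auto simp: borel_at_def sets_borel_of)

lemma measurable_prod_component:
  assumes "v \<in> A"
  shows "(\<lambda>x. x v) \<in> measurable (prod_borel X A) (borel_at X v)"
  unfolding borel_at_def borel_of_def
proof (rule measurable_measure_of)
  show "{U. openin (mtopology_of (X v)) U} \<subseteq> Pow (topspace (mtopology_of (X v)))"
    using openin_subset by blast
  show "(\<lambda>x. x v) \<in> space (prod_borel X A) \<rightarrow> topspace (mtopology_of (X v))"
    using assms by (auto simp: space_prod_borel)
  fix U assume "U \<in> {U. openin (mtopology_of (X v)) U}"
  then have "openin (product_topology (\<lambda>v. mtopology_of (X v)) A)
      {x \<in> topspace (product_topology (\<lambda>v. mtopology_of (X v)) A). x v \<in> U}"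
    using continuous_map_product_projection[OF assms] 
    by (intro openin_continuous_map_preimage) auto
  moreover have "(\<lambda>x. x v) -` U \<inter> space (prod_borel X A) = 
      {x \<in> topspace (product_topology (\<lambda>v. mtopology_of (X v)) A). x v \<in> U}"
    by (auto simp: space_prod_borel)
  ultimately show "(\<lambda>x. x v) -` U \<inter> space (prod_borel X A) \<in> sets (prod_borel X A)"
    unfolding prod_borel_def sets_borel_of by auto
qed

definition boxes :: "('v \<Rightarrow> 'a metric) \<Rightarrow> 'v set \<Rightarrow> ('v \<Rightarrow> 'a) set set" where
  "boxes X A = {Pi\<^sub>E A S | S. \<forall>v\<in>A. S v \<in> sets (borel_at X v)}"

lemma boxes_in_prod_borel:
  assumes "finite A"
  shows "boxes X A \<subseteq> sets (prod_borel X A)"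
proof
  fix W assume "W \<in> boxes X A"
  then obtain S where S: "W = Pi\<^sub>E A S" "\<And>v. v \<in> A \<Longrightarrow> S v \<in> sets (borel_at X v)"
    by (auto simp: boxes_def)
  have "W = {x \<in> space (prod_borel X A). \<forall>v\<in>A. x v \<in> S v}"
    using sets.sets_into_space[OF S(2)] by (fastforce simp: S(1) space_prod_borel space_borel_at PiE_iff)
  also have "\<dots> \<in> sets (prod_borel X A)"
    using S(2) assms by (intro sets.sets_Collect_finite_All measurable_sets_Collect[OF measurable_prod_component]) auto
  finally show "W \<in> sets (prod_borel X A)" .
qed

text \<open>An open set of the product is a union of boxes with basic open sides. Separability makes the base of
each factor countable, so countably many boxes suffice. Without it, the Borel sets of the product could
be more than the product of the Borel sets, and updating a coordinate need not be measurable.\<close>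

lemma prod_borel_eq_sigma_boxes:
  assumes fin: "finite A" and sep: "\<And>v. v \<in> A \<Longrightarrow> separable_space (mtopology_of (X v))"
  shows "sets (prod_borel X A) = sigma_sets (\<Pi>\<^sub>E v\<in>A. mspace (X v)) (boxes X A)"
proof
  let ?T = "product_topology (\<lambda>v. mtopology_of (X v)) A"
  let ?Om = "\<Pi>\<^sub>E v\<in>A. mspace (X v)"
  have "\<forall>v\<in>A. \<exists>\<B>. countable \<B> \<and> (\<forall>U\<in>\<B>. openin (mtopology_of (X v)) U) \<and>
      (\<forall>U x. openin (mtopology_of (X v)) U \<and> x \<in> U \<longrightarrow> (\<exists>W\<in>\<B>. x \<in> W \<and> W \<subseteq> U))"
    using separable_metric_countable_base[OF sep] unfolding second_countable_def by blast
  from bchoice[OF this] obtain \<B> where B: "\<forall>v\<in>A. countable (\<B> v) \<and> (\<forall>U\<in>\<B> v. openin (mtopology_of (X v)) U) \<and>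
      (\<forall>U x. openin (mtopology_of (X v)) U \<and> x \<in> U \<longrightarrow> (\<exists>W\<in>\<B> v. x \<in> W \<and> W \<subseteq> U))" ..
  have \<B>: "countable (\<B> v)" "U \<in> \<B> v \<Longrightarrow> openin (mtopology_of (X v)) U"
    "openin (mtopology_of (X v)) U \<Longrightarrow> x \<in> U \<Longrightarrow> \<exists>W\<in>\<B> v. x \<in> W \<and> W \<subseteq> U" if "v \<in> A" for v U x
    using bspec[OF B that] by simp_all
  let ?C = "Pi\<^sub>E A ` Pi\<^sub>E A \<B>"
  have C: "countable ?C" "?C \<subseteq> boxes X A"
  proof -
    show "countable ?C" using \<B>(1) fin by (intro countable_image countable_PiE) auto
    show "?C \<subseteq> boxes X A"
    proof
      fix W assume "W \<in> ?C"
      then obtain K where K: "W = Pi\<^sub>E A K" "K \<in> Pi\<^sub>E A \<B>" by blast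
      have "\<forall>v\<in>A. K v \<in> sets (borel_at X v)"
      proof
        fix v assume "v \<in> A"
        then show "K v \<in> sets (borel_at X v)"
          using K(2) by (intro open_in_borel_at \<B>(2)[of v]) auto
      qed
      then show "W \<in> boxes X A" unfolding boxes_def K(1) by blast
    qed
  qed
  have "W \<in> sigma_sets ?Om (boxes X A)" if W: "openin ?T W" for W
  proof -
    have "W = \<Union>{K \<in> ?C. K \<subseteq> W}"
    proof (intro set_eqI iffI)
      fix x assume x: "x \<in> W"
      have "\<exists>U. finite {i \<in> A. U i \<noteq> topspace (mtopology_of (X i))} \<and>
          (\<forall>i\<in>A. openin (mtopology_of (X i)) (U i)) \<and> x \<in> Pi\<^sub>E A U \<and> Pi\<^sub>E A U \<subseteq> W"
        using W x unfolding openin_product_topology_alt by simp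
      then obtain U where U: "\<forall>v\<in>A. openin (mtopology_of (X v)) (U v)" "x \<in> Pi\<^sub>E A U" "Pi\<^sub>E A U \<subseteq> W"
        by (elim exE conjE)
      have "\<forall>v\<in>A. \<exists>K. K \<in> \<B> v \<and> x v \<in> K \<and> K \<subseteq> U v"
      proof
        fix v assume v: "v \<in> A"
        then have "openin (mtopology_of (X v)) (U v)" "x v \<in> U v" using U by (auto simp: PiE_iff)
        from \<B>(3)[OF v this] show "\<exists>K. K \<in> \<B> v \<and> x v \<in> K \<and> K \<subseteq> U v" by blast
      qed
      from bchoice[OF this] obtain K where K: "\<forall>v\<in>A. K v \<in> \<B> v \<and> x v \<in> K v \<and> K v \<subseteq> U v" ..
      let ?K = "restrict K A"
      have "x \<in> Pi\<^sub>E A ?K" "Pi\<^sub>E A ?K \<subseteq> Pi\<^sub>E A U" "?K \<in> Pi\<^sub>E A \<B>"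
        using K U(2) by (auto simp: PiE_iff subset_iff)
      then have "Pi\<^sub>E A ?K \<in> {K \<in> ?C. K \<subseteq> W}" using U(3) by (intro CollectI conjI imageI) (auto dest: subset_trans)
      with \<open>x \<in> Pi\<^sub>E A ?K\<close> show "x \<in> \<Union>{K \<in> ?C. K \<subseteq> W}" by (rule UnionI[rotated])
    qed auto
    moreover have "countable {K \<in> ?C. K \<subseteq> W}" using C(1) by (rule countable_subset[rotated]) auto
    then have "\<Union>{K \<in> ?C. K \<subseteq> W} \<in> sigma_sets ?Om (boxes X A)"
    proof (rule sigma_sets_UNION)
      show "K \<in> sigma_sets ?Om (boxes X A)" if "K \<in> {K \<in> ?C. K \<subseteq> W}" for K
        by (rule sigma_sets.Basic) (use that C(2) in blast)
    qed
    ultimately show ?thesis by simp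
  qed
  then have "sigma_sets ?Om (Collect (openin ?T)) \<subseteq> sigma_sets ?Om (boxes X A)"
    by (intro sigma_sets_mono) auto
  then show "sets (prod_borel X A) \<subseteq> sigma_sets ?Om (boxes X A)"
    unfolding prod_borel_def sets_borel_of by simp
  show "sigma_sets ?Om (boxes X A) \<subseteq> sets (prod_borel X A)"
    using sets.sigma_sets_subset[OF boxes_in_prod_borel[OF fin, of X]] by (simp add: space_prod_borel)
qed

lemma measurable_prod_borelI:
  assumes "finite A" "\<And>v. v \<in> A \<Longrightarrow> separable_space (mtopology_of (X v))"
    and ext: "\<And>w. w \<in> space M \<Longrightarrow> f w \<in> extensional A"
    and comp: "\<And>v. v \<in> A \<Longrightarrow> (\<lambda>w. f w v) \<in> measurable M (borel_at X v)"
  shows "f \<in> measurable M (prod_borel X A)"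
proof (rule measurable_sigma_sets[OF prod_borel_eq_sigma_boxes[OF assms(1,2)]])
  have b: "boxes X A \<subseteq> Pow (space (prod_borel X A))"
    using boxes_in_prod_borel[OF assms(1)] sets.space_closed by blast
  then show "boxes X A \<subseteq> Pow (\<Pi>\<^sub>E v\<in>A. mspace (X v))" by (simp add: space_prod_borel)
  show "f \<in> space M \<rightarrow> (\<Pi>\<^sub>E v\<in>A. mspace (X v))"
    using ext measurable_space[OF comp] by (auto simp: PiE_iff space_borel_at)
  fix W assume "W \<in> boxes X A"
  then obtain S where S: "W = Pi\<^sub>E A S" "\<And>v. v \<in> A \<Longrightarrow> S v \<in> sets (borel_at X v)"
    by (auto simp: boxes_def)
  have "f -` W \<inter> space M = {w \<in> space M. \<forall>v\<in>A. f w v \<in> S v}"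
    using ext by (auto simp: S(1) PiE_iff)
  also have "\<dots> \<in> sets M"
    using S(2) assms(1) by (intro sets.sets_Collect_finite_All measurable_sets_Collect[OF comp]) auto
  finally show "f -` W \<inter> space M \<in> sets M" .
qed

section \<open>Conditional probabilities given a sub-sigma-algebra\<close>

context prob_space begin

lemma set_integral_real_cond_exp_indicator:
  assumes F: "subalgebra M F" and S: "S \<in> events" and U: "U \<in> sets F"
  shows "(\<integral>x\<in>U. real_cond_exp M F (indicator S) x \<partial>M) = prob (S \<inter> U)"
proof -
  interpret finite_measure_subalgebra M F by unfold_locales (rule F)
  have "U \<in> events" using F U by (auto simp: subalgebra_def)
  then show ?thesis
    using real_cond_exp_intA[OF _ U, of "indicator S"] S
    by (simp add: set_lebesgue_integral_def indicator_inter_arith[symmetric] Int_commute emeasure_eq_measure)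
qed

lemma integrable_cond_exp_indicator:
  assumes "subalgebra M F" "S \<in> events"
  shows "integrable M (real_cond_exp M F (indicator S))"
proof -
  interpret finite_measure_subalgebra M F by unfold_locales (rule assms)
  show ?thesis using real_cond_exp_int(1)[of "indicator S"] assms by (simp add: emeasure_eq_measure)
qed

lemma integrable_indicator_mult_cond_exp:
  assumes "subalgebra M F" "S \<in> events" "W \<in> events"
  shows "integrable M (\<lambda>x. indicator W x * real_cond_exp M F (indicator S) x)"
  using integrable_mult_indicator[OF assms(3) integrable_cond_exp_indicator[OF assms(1,2)]] by simp

text \<open>A form of conditional independence that involves only one conditional probability and that is linear
in it: on the event \<open>T\<close>, the probability of \<open>S\<close> given \<open>F\<close> is also its probability given \<open>F\<close> and \<open>T\<close>.\<close>

lemma cond_exp_prod_iff: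
  assumes F: "subalgebra M F" and S: "S \<in> events" and T: "T \<in> events"
  shows "(AE x in M. real_cond_exp M F (indicator (S \<inter> T)) x =
            real_cond_exp M F (indicator S) x * real_cond_exp M F (indicator T) x) \<longleftrightarrow>
    (\<forall>U\<in>sets F. prob (S \<inter> (T \<inter> U)) = (\<integral>x\<in>T \<inter> U. real_cond_exp M F (indicator S) x \<partial>M))"
    (is "?L \<longleftrightarrow> ?R")
proof -
  interpret finite_measure_subalgebra M F by unfold_locales (rule F)
  note [measurable] = S T
  let ?s = "real_cond_exp M F (indicator S)" and ?t = "real_cond_exp M F (indicator T)"
  have *: "(\<integral>x\<in>U. ?s x * ?t x \<partial>M) = (\<integral>x\<in>T \<inter> U. ?s x \<partial>M)" "integrable M (\<lambda>x. ?s x * ?t x)" if U: "U \<in> sets F" for U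
  proof -
    have [measurable]: "U \<in> events" using F U by (auto simp: subalgebra_def)
    note [measurable] = U
    have i: "integrable M (\<lambda>x. (indicator U x * ?s x) * indicator T x)"
      using integrable_indicator_mult_cond_exp[OF F S, of "T \<inter> U"]
      by (simp add: indicator_inter_arith ac_simps)
    have "(\<integral>x. (indicator U x * ?s x) * ?t x \<partial>M) = (\<integral>x. (indicator U x * ?s x) * indicator T x \<partial>M)"
      by (rule real_cond_exp_intg(2)[OF i]) measurable
    then show "(\<integral>x\<in>U. ?s x * ?t x \<partial>M) = (\<integral>x\<in>T \<inter> U. ?s x \<partial>M)"
      by (simp add: set_lebesgue_integral_def indicator_inter_arith ac_simps)
    have "integrable M (\<lambda>x. ?s x * indicator T x)"
      using integrable_indicator_mult_cond_exp[OF F S, of "T"] by (simp add: ac_simps)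
    then show "integrable M (\<lambda>x. ?s x * ?t x)" by (rule real_cond_exp_intg(1)) measurable
  qed
  have st: "S \<inter> T \<in> events" by simp
  show ?thesis
  proof
    assume L: ?L
    show ?R
    proof
      fix U assume U: "U \<in> sets F"
      then have [measurable]: "U \<in> events" using F by (auto simp: subalgebra_def)
      have "prob (S \<inter> (T \<inter> U)) = (\<integral>x\<in>U. real_cond_exp M F (indicator (S \<inter> T)) x \<partial>M)"
        using set_integral_real_cond_exp_indicator[OF F st U] by (simp add: Int_assoc)
      also have "\<dots> = (\<integral>x\<in>U. ?s x * ?t x \<partial>M)"
        unfolding set_lebesgue_integral_def using L by (intro integral_cong_AE) auto
      finally show "prob (S \<inter> (T \<inter> U)) = (\<integral>x\<in>T \<inter> U. ?s x \<partial>M)" using *[OF U] by simp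
    qed
  next
    assume R: ?R
    show ?L
    proof (rule real_cond_exp_charact)
      fix U assume U: "U \<in> sets F"
      then have [measurable]: "U \<in> events" using F by (auto simp: subalgebra_def)
      have "(\<integral>x\<in>U. indicator (S \<inter> T) x \<partial>M) = prob (S \<inter> (T \<inter> U))"
        by (simp add: set_lebesgue_integral_def indicator_inter_arith[symmetric] Int_ac)
      then show "(\<integral>x\<in>U. indicator (S \<inter> T) x \<partial>M) = (\<integral>x\<in>U. ?s x * ?t x \<partial>M)"
        using R U *[OF U] by simp
    qed (use *(2)[OF sets.empty_sets] in \<open>auto simp: emeasure_eq_measure\<close>)
  qed
qed

lemma cond_exp_indicator_unique:
  assumes F: "subalgebra M F" and S: "S \<in> events"
    and f: "f \<in> borel_measurable F" "integrable M f"
    and eq: "\<And>U. U \<in> sets F \<Longrightarrow> prob (S \<inter> U) = (\<integral>x\<in>U. f x \<partial>M)"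
  shows "AE x in M. real_cond_exp M F (indicator S) x = f x"
proof -
  interpret finite_measure_subalgebra M F by unfold_locales (rule F)
  show ?thesis
  proof (rule real_cond_exp_charact)
    fix U assume U: "U \<in> sets F"
    then have "U \<in> events" using F by (auto simp: subalgebra_def)
    then have "(\<integral>x\<in>U. indicator S x \<partial>M) = prob (S \<inter> U)"
      using S by (simp add: set_lebesgue_integral_def indicator_inter_arith[symmetric] Int_ac)
    then show "(\<integral>x\<in>U. indicator S x \<partial>M) = (\<integral>x\<in>U. f x \<partial>M)" using eq[OF U] by simp
  qed (use S f in \<open>auto simp: emeasure_eq_measure\<close>)
qed

text \<open>Both sides are finite signed measures in \<open>W\<close>, so a Dynkin argument extends the identity from a generator.\<close>

lemma prob_eq_set_integral_extend:
  assumes S: "S \<in> events" and f: "integrable M f"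
    and G: "Int_stable G" "G \<subseteq> events" "space M \<in> G"
    and eq: "\<And>W. W \<in> G \<Longrightarrow> prob (S \<inter> W) = (\<integral>x\<in>W. f x \<partial>M)"
    and W: "W \<in> sigma_sets (space M) G"
  shows "prob (S \<inter> W) = (\<integral>x\<in>W. f x \<partial>M)"
proof -
  have ev: "A \<in> events" if "A \<in> sigma_sets (space M) G" for A
    using that G(2) sets.sigma_sets_subset by blast
  have Gp: "G \<subseteq> Pow (space M)" using G(2) sets.space_closed by blast
  have si: "set_integrable M A f" if "A \<in> events" for A
    unfolding set_integrable_def using integrable_mult_indicator[OF that f] by simp
  show ?thesis
    using G(1) Gp W
  proof (induction rule: sigma_sets_induct_disjoint)
    case (compl A)
    then have A: "A \<in> events" using ev by auto
    have "prob (S \<inter> (space M - A)) = prob (S \<inter> space M) - prob (S \<inter> A)"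
    proof -
      have "S \<inter> (space M - A) = S - S \<inter> A" "S \<inter> space M = S" using sets.sets_into_space[OF S] by auto
      then show ?thesis using finite_measure_Diff[of S "S \<inter> A"] S A by simp
    qed
    also have "\<dots> = (\<integral>x\<in>space M. f x \<partial>M) - (\<integral>x\<in>A. f x \<partial>M)"
      using compl eq[OF G(3)] by simp
    also have "\<dots> = (\<integral>x\<in>space M - A. f x \<partial>M)"
    proof -
      have "(space M - A) \<inter> A = {}" "(space M - A) \<union> A = space M" using sets.sets_into_space[OF A] by auto
      then show ?thesis using A set_integral_Un[of "space M - A" A M f] si by auto
    qed
    finally show ?case by simp
  next
    case (union A)
    then have A: "range A \<subseteq> events" using ev by auto
    have "prob (S \<inter> (\<Union>i. A i)) = prob (\<Union>i. S \<inter> A i)" by simp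
    also have "(\<lambda>i. prob (S \<inter> A i)) sums prob (\<Union>i. S \<inter> A i)"
      using A S union(1) by (intro finite_measure_UNION) (auto simp: disjoint_family_on_def)
    then have "prob (\<Union>i. S \<inter> A i) = (\<Sum>i. prob (S \<inter> A i))" by (simp add: sums_iff)
    also have "\<dots> = (\<Sum>i. \<integral>x\<in>A i. f x \<partial>M)"
    proof -
      have "prob (S \<inter> A i) = (\<integral>x\<in>A i. f x \<partial>M)" for i using union(2,3) by blast
      then show ?thesis by simp
    qed
    also have "\<dots> = (\<integral>x\<in>(\<Union>i. A i). f x \<partial>M)"
      using A union(1) by (intro lebesgue_integral_countable_add[symmetric] si) (auto simp: disjoint_family_on_def)
    finally show ?case .
  qed (auto simp: eq set_lebesgue_integral_def)
qed

end

section \<open>Conditional independence of coordinates is a semigraphoid\<close>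

locale separable_product =
  fixes X :: "'v \<Rightarrow> 'a metric" and V :: "'v set"
  assumes finV: "finite V" and sep: "\<And>v. v \<in> V \<Longrightarrow> separable_space (mtopology_of (X v))"
begin

abbreviation Om :: "('v \<Rightarrow> 'a) set" where "Om \<equiv> \<Pi>\<^sub>E v\<in>V. mspace (X v)"

text \<open>The events that depend only on the coordinates in \<open>A\<close>, as a sigma-algebra on the full product.\<close>

definition cyl :: "'v set \<Rightarrow> ('v \<Rightarrow> 'a) measure" where
  "cyl A = vimage_algebra Om (\<lambda>x. restrict x A) (prod_borel X A)"

lemma space_cyl [simp]: "space (cyl A) = Om"
  by (simp add: cyl_def)

lemma measurable_into_prod:
  assumes "A \<subseteq> V" "\<And>w. w \<in> space M \<Longrightarrow> f w \<in> extensional A"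
    and "\<And>v. v \<in> A \<Longrightarrow> (\<lambda>w. f w v) \<in> measurable M (borel_at X v)"
  shows "f \<in> measurable M (prod_borel X A)"
  using assms finite_subset[OF _ finV] sep by (intro measurable_prod_borelI) auto

lemma measurable_restrict_prod:
  assumes "A \<subseteq> B" "B \<subseteq> V"
  shows "(\<lambda>x. restrict x A) \<in> measurable (prod_borel X B) (prod_borel X A)"
proof (rule measurable_into_prod)
  fix v assume "v \<in> A"
  then show "(\<lambda>x. restrict x A v) \<in> measurable (prod_borel X B) (borel_at X v)"
    using assms measurable_prod_component[of v B X] by auto
qed (use assms in auto)

lemma restrict_Om: "A \<subseteq> V \<Longrightarrow> x \<in> Om \<Longrightarrow> restrict x A \<in> space (prod_borel X A)"
  by (auto simp: space_prod_borel)

lemma sets_cyl: "A \<subseteq> V \<Longrightarrow> sets (cyl A) = {(\<lambda>x. restrict x A) -` S \<inter> Om | S. S \<in> sets (prod_borel X A)}"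
  unfolding cyl_def by (intro sets_vimage_algebra2) (auto simp: space_prod_borel)

lemma cyl_mono:
  assumes "A \<subseteq> B" "B \<subseteq> V"
  shows "sets (cyl A) \<subseteq> sets (cyl B)"
proof
  fix W assume "W \<in> sets (cyl A)"
  then obtain S where S: "S \<in> sets (prod_borel X A)" "W = (\<lambda>x. restrict x A) -` S \<inter> Om"
    using sets_cyl[of A] assms by auto
  let ?S = "(\<lambda>x. restrict x A) -` S \<inter> space (prod_borel X B)"
  have "?S \<in> sets (prod_borel X B)"
    by (rule measurable_sets[OF measurable_restrict_prod[OF assms] S(1)])
  moreover have "W = (\<lambda>x. restrict x B) -` ?S \<inter> Om"
    using assms restrict_Om[OF assms(2)] unfolding S(2) by (auto simp: Int_absorb1)
  ultimately show "W \<in> sets (cyl B)" unfolding sets_cyl[OF assms(2)] by blast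
qed

lemma cyl_V: "sets (cyl V) = sets (prod_borel X V)"
proof -
  have *: "(\<lambda>x. restrict x V) -` S \<inter> Om = S" if "S \<in> sets (prod_borel X V)" for S
  proof -
    have "S \<subseteq> Om" using sets.sets_into_space[OF that] by (simp add: space_prod_borel)
    moreover have "restrict x V = x" if "x \<in> Om" for x
      using that by (auto simp: PiE_iff intro: extensional_restrict)
    ultimately show ?thesis by auto
  qed
  show ?thesis
    unfolding sets_cyl[OF order_refl]
  proof (intro set_eqI iffI)
    fix W assume W: "W \<in> sets (prod_borel X V)"
    show "W \<in> {(\<lambda>x. restrict x V) -` S \<inter> Om | S. S \<in> sets (prod_borel X V)}"
      by (intro CollectI exI[of _ W]) (simp add: * W)
  qed (auto simp: *)
qed

lemma measurable_cyl_component: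
  assumes "v \<in> A" "A \<subseteq> V"
  shows "(\<lambda>x. x v) \<in> measurable (cyl A) (borel_at X v)"
proof -
  have "(\<lambda>x. restrict x A) \<in> measurable (cyl A) (prod_borel X A)"
    unfolding cyl_def using restrict_Om[OF assms(2)] by (intro measurable_vimage_algebra1) auto
  from measurable_compose[OF this measurable_prod_component[OF assms(1)]]
  show ?thesis using assms(1) by simp
qed

lemma cyl_Un_generated:
  assumes "B \<subseteq> V" "C \<subseteq> V"
  shows "sets (cyl (B \<union> C)) \<subseteq> sigma_sets Om {T \<inter> U | T U. T \<in> sets (cyl B) \<and> U \<in> sets (cyl C)}"
proof -
  let ?G = "{T \<inter> U | T U. T \<in> sets (cyl B) \<and> U \<in> sets (cyl C)}"
  have G: "?G \<subseteq> Pow Om" using sets.sets_into_space[of _ "cyl B"] by auto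
  have BG: "sets (cyl B) \<subseteq> ?G" "sets (cyl C) \<subseteq> ?G"
  proof -
    have "W \<inter> Om = W" "Om \<inter> W = W" if "W \<in> sets (cyl A)" for W A
      using sets.sets_into_space[OF that] by auto
    moreover have "Om \<in> sets (cyl A)" for A using sets.top[of "cyl A"] by simp
    ultimately show "sets (cyl B) \<subseteq> ?G" "sets (cyl C) \<subseteq> ?G"
      by (intro subsetI CollectI, metis)+
  qed
  have "(\<lambda>x. restrict x (B \<union> C)) \<in> measurable (sigma Om ?G) (prod_borel X (B \<union> C))"
  proof (rule measurable_into_prod)
    fix v assume v: "v \<in> B \<union> C"
    have "(\<lambda>x. x v) \<in> measurable (sigma Om ?G) (borel_at X v)"
    proof (rule measurableI)
      show "x v \<in> space (borel_at X v)" if "x \<in> space (sigma Om ?G)" for x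
        using that G v assms by (auto simp: space_borel_at)
      fix S assume S: "S \<in> sets (borel_at X v)"
      have "(\<lambda>x. x v) -` S \<inter> Om \<in> sets (cyl B) \<union> sets (cyl C)"
        using v measurable_sets[OF measurable_cyl_component[OF _ assms(1)] S]
          measurable_sets[OF measurable_cyl_component[OF _ assms(2)] S] by auto
      then show "(\<lambda>x. x v) -` S \<inter> space (sigma Om ?G) \<in> sets (sigma Om ?G)"
        using G BG by auto
    qed
    then show "(\<lambda>x. restrict x (B \<union> C) v) \<in> measurable (sigma Om ?G) (borel_at X v)"
      using v by simp
  qed (use assms in auto)
  note m = this
  have "(\<lambda>x. restrict x (B \<union> C)) -` S \<inter> Om \<in> sigma_sets Om ?G" if "S \<in> sets (prod_borel X (B \<union> C))" for S
    using measurable_sets[OF m that] unfolding sets_measure_of[OF G] space_measure_of[OF G] .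
  then show ?thesis using sets_cyl[of "B \<union> C"] assms by auto
qed

definition dists :: "('v \<Rightarrow> 'a) measure set" where
  "dists = space (prob_algebra (prod_borel X V))"

lemma dists_prob_space: "P \<in> dists \<Longrightarrow> prob_space P"
  by (simp add: dists_def space_prob_algebra)

lemma dists_sets: "P \<in> dists \<Longrightarrow> sets P = sets (prod_borel X V)"
  by (simp add: dists_def space_prob_algebra)

lemma dists_space: "P \<in> dists \<Longrightarrow> space P = Om"
  using sets_eq_imp_space_eq[OF dists_sets] by (simp add: space_prod_borel)

lemma dists_subalgebra: "P \<in> dists \<Longrightarrow> A \<subseteq> V \<Longrightarrow> subalgebra P (cyl A)"
  using cyl_mono[of A V] by (simp add: subalgebra_def dists_space dists_sets cyl_V)

lemma dists_events: "P \<in> dists \<Longrightarrow> A \<subseteq> V \<Longrightarrow> W \<in> sets (cyl A) \<Longrightarrow> W \<in> sets P"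
  using cyl_mono[of A V] by (auto simp: dists_sets cyl_V)

abbreviation given :: "('v \<Rightarrow> 'a) measure \<Rightarrow> 'v set \<Rightarrow> ('v \<Rightarrow> 'a) set \<Rightarrow> ('v \<Rightarrow> 'a) \<Rightarrow> real" where
  "given P C S \<equiv> real_cond_exp P (cyl C) (indicator S)"

lemma cond_indep_iff_AE:
  assumes "P \<in> dists" "A \<subseteq> V" "B \<subseteq> V"
  shows "cond_indep X P A B C \<longleftrightarrow> (\<forall>S\<in>sets (cyl A). \<forall>T\<in>sets (cyl B).
     AE x in P. given P C (S \<inter> T) x = given P C S x * given P C T x)"
proof -
  have "sets (cyl D) = proj_event P D ` sets (prod_borel X D)" if "D \<subseteq> V" for D
    unfolding sets_cyl[OF that] proj_event_def dists_space[OF assms(1)] by auto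
  then show ?thesis
    unfolding cond_indep_def cond_prob_given_def dists_space[OF assms(1)] cyl_def[symmetric] 
    using assms by simp
qed

lemma cond_indep_iff:
  assumes P: "P \<in> dists" and ABC: "A \<subseteq> V" "B \<subseteq> V" "C \<subseteq> V"
  shows "cond_indep X P A B C \<longleftrightarrow> (\<forall>S\<in>sets (cyl A). \<forall>T\<in>sets (cyl B). \<forall>U\<in>sets (cyl C).
     measure P (S \<inter> (T \<inter> U)) = (\<integral>x\<in>T \<inter> U. given P C S x \<partial>P))"
proof -
  interpret prob_space P by (rule dists_prob_space[OF P])
  have "D \<in> sets P" if "D \<in> sets (cyl A')" "A' \<subseteq> V" for D A'
    using that dists_events[OF P] by blast
  then show ?thesis
    unfolding cond_indep_iff_AE[OF assms(1-3)]
    using ABC by (intro ball_cong refl cond_exp_prod_iff[OF dists_subalgebra[OF P ABC(3)]]) simp_all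
qed

text \<open>The form used for the semigraphoid axioms: the conditional probability of \<open>S\<close> given the coordinates in
\<open>B \<union> C\<close> depends on those in \<open>C\<close> only.\<close>

lemma cond_indep_iff_Un:
  assumes P: "P \<in> dists" and ABC: "A \<subseteq> V" "B \<subseteq> V" "C \<subseteq> V"
  shows "cond_indep X P A B C \<longleftrightarrow> (\<forall>S\<in>sets (cyl A). \<forall>W\<in>sets (cyl (B \<union> C)).
     measure P (S \<inter> W) = (\<integral>x\<in>W. given P C S x \<partial>P))"
proof -
  interpret prob_space P by (rule dists_prob_space[OF P])
  have ev: "D \<in> sets P" if "D \<in> sets (cyl A')" "A' \<subseteq> V" for D A'
    using that dists_events[OF P] by blast
  show ?thesis unfolding cond_indep_iff[OF assms]
  proof (rule ball_cong[OF refl], intro iffI ballI)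
    fix S T U assume "\<forall>W\<in>sets (cyl (B \<union> C)). prob (S \<inter> W) = (\<integral>x\<in>W. given P C S x \<partial>P)"
      "T \<in> sets (cyl B)" "U \<in> sets (cyl C)"
    then show "prob (S \<inter> (T \<inter> U)) = (\<integral>x\<in>T \<inter> U. given P C S x \<partial>P)"
      using cyl_mono[of B "B \<union> C"] cyl_mono[of C "B \<union> C"] ABC by (auto intro!: sets.Int)
  next
    fix S W assume S: "S \<in> sets (cyl A)" and W: "W \<in> sets (cyl (B \<union> C))"
      and *: "\<forall>T\<in>sets (cyl B). \<forall>U\<in>sets (cyl C). prob (S \<inter> (T \<inter> U)) = (\<integral>x\<in>T \<inter> U. given P C S x \<partial>P)"
    let ?G = "{T \<inter> U | T U. T \<in> sets (cyl B) \<and> U \<in> sets (cyl C)}"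
    show "prob (S \<inter> W) = (\<integral>x\<in>W. given P C S x \<partial>P)"
    proof (rule prob_eq_set_integral_extend[where G="?G"])
      show "Int_stable ?G"
      proof (rule Int_stableI)
        fix a b assume "a \<in> ?G" "b \<in> ?G"
        then obtain T U T' U' where "a = T \<inter> U" "b = T' \<inter> U'" 
          "T \<in> sets (cyl B)" "U \<in> sets (cyl C)" "T' \<in> sets (cyl B)" "U' \<in> sets (cyl C)" by auto
        then show "a \<inter> b \<in> ?G" 
          by (intro CollectI exI[of _ "T \<inter> T'"] exI[of _ "U \<inter> U'"]) auto
      qed
      show "?G \<subseteq> events" using ev ABC by auto
      show "space P \<in> ?G"
        using sets.top[of "cyl B"] sets.top[of "cyl C"] unfolding dists_space[OF P]
        by (intro CollectI exI[of _ Om]) auto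
      show "W \<in> sigma_sets (space P) ?G"
        using W cyl_Un_generated[OF ABC(2,3)] unfolding dists_space[OF P] by blast
      show "integrable P (given P C S)"
        by (rule integrable_cond_exp_indicator[OF dists_subalgebra[OF P ABC(3)] ev[OF S ABC(1)]])
    qed (use * ev S ABC in auto)
  qed
qed

lemma given_unique:
  assumes P: "P \<in> dists" and AC: "A \<subseteq> V" "C \<subseteq> D" "D \<subseteq> V" and S: "S \<in> sets (cyl A)"
    and eq: "\<And>W. W \<in> sets (cyl D) \<Longrightarrow> measure P (S \<inter> W) = (\<integral>x\<in>W. given P C S x \<partial>P)"
    and W: "W \<in> sets P"
  shows "(\<integral>x\<in>W. given P D S x \<partial>P) = (\<integral>x\<in>W. given P C S x \<partial>P)"
proof -
  interpret prob_space P by (rule dists_prob_space[OF P])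
  have C: "C \<subseteq> V" using AC by auto
  have S': "S \<in> sets P" using S dists_events[OF P AC(1)] by blast
  have "AE x in P. given P D S x = given P C S x"
  proof (rule cond_exp_indicator_unique[OF dists_subalgebra[OF P AC(3)] S' _ _ eq])
    have "subalgebra (cyl D) (cyl C)" using cyl_mono[OF AC(2,3)] by (simp add: subalgebra_def)
    then show "given P C S \<in> borel_measurable (cyl D)" 
      by (rule measurable_from_subalg) (rule borel_measurable_cond_exp)
    show "integrable P (given P C S)"
      by (rule integrable_cond_exp_indicator[OF dists_subalgebra[OF P C] S'])
  qed
  then show ?thesis
    unfolding set_lebesgue_integral_def using W by (intro integral_cong_AE) auto
qed

text \<open>Symmetry is visible in the product form of conditional independence. All other axioms are immediate
from \<open>cond_indep_iff_Un\<close>, combined with uniqueness of conditional probabilities for weak union and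
contraction.\<close>

lemma semigraphoid_cond_indep:
  assumes P: "P \<in> dists"
  shows "semigraphoid (cond_indep X P) V"
proof
  interpret prob_space P by (rule dists_prob_space[OF P])
  fix A B C D assume V: "A \<subseteq> V" "B \<subseteq> V" "C \<subseteq> V" "D \<subseteq> V"
  have ev: "W \<in> sets P" if "W \<in> sets (cyl A')" "A' \<subseteq> V" for W A'
    using that dists_events[OF P] by blast
  {
    assume "cond_indep X P A B C"
    then have "\<forall>T\<in>sets (cyl B). \<forall>S\<in>sets (cyl A). AE x in P. given P C (S \<inter> T) x = given P C S x * given P C T x"
      unfolding cond_indep_iff_AE[OF P V(1,2)] by blast
    then show "cond_indep X P B A C"
      unfolding cond_indep_iff_AE[OF P V(2,1)]
      by (simp only: Int_commute mult.commute)
  }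
  {
    fix B' assume "cond_indep X P A B C" "B' \<subseteq> B"
    moreover from this have "B' \<subseteq> V" "sets (cyl B') \<subseteq> sets (cyl B)" using V cyl_mono[of B' B] by auto
    ultimately show "cond_indep X P A B' C"
      using cond_indep_iff_AE[OF P V(1)] V by (meson subsetD)
  }
  {
    assume "cond_indep X P A (B \<union> D) C"
    then have *: "prob (S \<inter> W) = (\<integral>x\<in>W. given P C S x \<partial>P)" if "S \<in> sets (cyl A)" "W \<in> sets (cyl (B \<union> D \<union> C))" for S W
      using that V by (subst (asm) cond_indep_iff_Un[OF P]) auto
    have "B \<union> D \<union> C = B \<union> (C \<union> D)" by auto
    note * = *[unfolded this]
    show "cond_indep X P A B (C \<union> D)"
    proof (subst cond_indep_iff_Un[OF P], safe)
      fix S W assume S: "S \<in> sets (cyl A)" and W: "W \<in> sets (cyl (B \<union> (C \<union> D)))"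
      show "prob (S \<inter> W) = (\<integral>x\<in>W. given P (C \<union> D) S x \<partial>P)"
        unfolding *[OF S W] 
        using V S W cyl_mono[of "C \<union> D" "B \<union> (C \<union> D)"] 
        by (intro given_unique[OF P, of A, symmetric] *) (auto intro: ev)
    qed (use V in auto)
  }
  {
    assume 1: "cond_indep X P A B C" and 2: "cond_indep X P A D (B \<union> C)"
    show "cond_indep X P A (B \<union> D) C"
    proof (subst cond_indep_iff_Un[OF P], safe)
      fix S W assume S: "S \<in> sets (cyl A)" and "W \<in> sets (cyl ((B \<union> D) \<union> C))"
      moreover have "(B \<union> D) \<union> C = D \<union> (B \<union> C)" by auto
      ultimately have W: "W \<in> sets (cyl (D \<union> (B \<union> C)))" by simp
      have "prob (S \<inter> W) = (\<integral>x\<in>W. given P (B \<union> C) S x \<partial>P)"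
        using 2 V S W by (subst (asm) cond_indep_iff_Un[OF P]) auto
      also have "\<dots> = (\<integral>x\<in>W. given P C S x \<partial>P)"
      proof (rule given_unique[OF P, of A])
        show "prob (S \<inter> W) = (\<integral>x\<in>W. given P C S x \<partial>P)" if "W \<in> sets (cyl (B \<union> C))" for W
          using 1 V S that by (subst (asm) cond_indep_iff_Un[OF P]) auto
        show "W \<in> sets P" using V by (intro ev[OF W]) auto
      qed (use V S in auto)
      finally show "prob (S \<inter> W) = (\<integral>x\<in>W. given P C S x \<partial>P)" .
    qed (use V in auto)
  }
  show "cond_indep X P A C C"
  proof (subst cond_indep_iff_Un[OF P], safe)
    fix S W assume S: "S \<in> sets (cyl A)" "W \<in> sets (cyl (C \<union> C))"
    then show "prob (S \<inter> W) = (\<integral>x\<in>W. given P C S x \<partial>P)"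
      using set_integral_real_cond_exp_indicator[OF dists_subalgebra[OF P V(3)] ev[OF S(1) V(1)]] by simp
  qed (use V in auto)
qed

end

section \<open>Products of kernels are Markov\<close>

lemma bind_in_prob_algebra:
  assumes "P \<in> space (prob_algebra M)" "K \<in> measurable M (prob_algebra N)"
  shows "P \<bind> K \<in> space (prob_algebra N)"
proof -
  have "(\<lambda>_::unit. P \<bind> K) \<in> measurable (count_space UNIV) (prob_algebra N)"
    using assms by (intro measurable_bind_prob_space[where N=M]) auto
  from measurable_space[OF this] show ?thesis by simp
qed

lemma prob_algebraD:
  assumes "P \<in> space (prob_algebra M)"
  shows "prob_space P" "sets P = sets M" "space P = space M" "space M \<noteq> {}"
proof -
  show P: "prob_space P" "sets P = sets M" using assms by (auto simp: space_prob_algebra)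
  show s: "space P = space M" by (rule sets_eq_imp_space_eq[OF P(2)])
  show "space M \<noteq> {}" using prob_space.not_empty[OF P(1)] s by simp
qed

lemma kernel_measurable:
  assumes "P \<in> space (prob_algebra M)" "K \<in> measurable M (prob_algebra N)"
  shows "K \<in> measurable P (subprob_algebra N)"
  using measurable_prob_algebraD[OF assms(2)] measurable_cong_sets[OF prob_algebraD(2)[OF assms(1)] refl] by blast

lemma measure_bind_prob:
  assumes "P \<in> space (prob_algebra M)" "K \<in> measurable M (prob_algebra N)" "S \<in> sets N"
  shows "measure (P \<bind> K) S = (\<integral>x. measure (K x) S \<partial>P)"
proof -
  interpret prob_space P by (rule prob_algebraD[OF assms(1)])
  show ?thesis by (rule measure_bind[OF kernel_measurable[OF assms(1,2)] assms(3)])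
qed

text \<open>Reversed topological orderings, in the form that matches the recursion of \<open>kernel_product\<close>.\<close>

fun build_order :: "('v \<times> 'v) set \<Rightarrow> 'v list \<Rightarrow> bool" where
  "build_order E [] \<longleftrightarrow> True"
| "build_order E (v # vs) \<longleftrightarrow> v \<notin> set vs \<and> pa E v \<subseteq> set vs \<and> build_order E vs"

lemma build_order_append: "build_order E (us @ vs) \<Longrightarrow> build_order E vs"
  by (induction us) auto

lemma build_order_distinct: "build_order E vs \<Longrightarrow> distinct vs"
  by (induction vs) auto

context separable_product
begin

definition kernels :: "('v \<times> 'v) set \<Rightarrow> ('v \<Rightarrow> ('v \<Rightarrow> 'a) \<Rightarrow> 'a measure) set" where
  "kernels E = {m. \<forall>v\<in>V. m v \<in> measurable (prod_borel X (pa E v)) (prob_algebra (borel_at X v))}"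

definition extend_kernel ::
    "('v \<times> 'v) set \<Rightarrow> ('v \<Rightarrow> ('v \<Rightarrow> 'a) \<Rightarrow> 'a measure) \<Rightarrow> 'v \<Rightarrow> 'v set \<Rightarrow> ('v \<Rightarrow> 'a) \<Rightarrow> ('v \<Rightarrow> 'a) measure" where
  "extend_kernel E m v W x = distr (m v (restrict x (pa E v))) (prod_borel X (insert v W)) (\<lambda>y. x(v := y))"

lemma measurable_kernel_restrict:
  assumes "m \<in> kernels E" "v \<in> V" "pa E v \<subseteq> W" "W \<subseteq> V"
  shows "(\<lambda>x. m v (restrict x (pa E v))) \<in> measurable (prod_borel X W) (prob_algebra (borel_at X v))"
proof -
  have "m v \<in> measurable (prod_borel X (pa E v)) (prob_algebra (borel_at X v))"
    using assms by (auto simp: kernels_def)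
  from measurable_compose[OF measurable_restrict_prod[OF assms(3,4)] this] show ?thesis .
qed

lemma measurable_upd:
  assumes "insert v W \<subseteq> V"
  shows "(\<lambda>(x, y). x(v := y)) \<in> measurable (prod_borel X W \<Otimes>\<^sub>M borel_at X v) (prod_borel X (insert v W))"
proof (rule measurable_into_prod)
  fix w assume "w \<in> insert v W"
  then consider "w = v" | "w \<noteq> v" "w \<in> W" by auto
  then show "(\<lambda>p. (case p of (x, y) \<Rightarrow> x(v := y)) w) \<in> measurable (prod_borel X W \<Otimes>\<^sub>M borel_at X v) (borel_at X w)"
  proof cases
    case 1
    then show ?thesis by (simp add: case_prod_unfold)
  next
    case 2
    then show ?thesis
      using measurable_compose[OF measurable_fst measurable_prod_component[OF 2(2)]]
      by (simp add: case_prod_unfold)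
  qed
qed (use assms in \<open>auto simp: space_pair_measure space_prod_borel PiE_iff extensional_def\<close>)

lemma measurable_extend_kernel:
  assumes "m \<in> kernels E" "insert v W \<subseteq> V" "pa E v \<subseteq> W"
  shows "extend_kernel E m v W \<in> measurable (prod_borel X W) (prob_algebra (prod_borel X (insert v W)))"
  unfolding extend_kernel_def[abs_def]
  using assms by (intro measurable_distr_prob_space2[OF measurable_kernel_restrict measurable_upd]) auto

lemma kernel_product_Cons:
  "kernel_product E X m (v # vs) = kernel_product E X m vs \<bind> extend_kernel E m v (set vs)"
  by (simp add: extend_kernel_def[abs_def])

lemma kernel_product_prob:
  assumes "m \<in> kernels E" "build_order E vs" "set vs \<subseteq> V"
  shows "kernel_product E X m vs \<in> space (prob_algebra (prod_borel X (set vs)))"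
  using assms(2,3)
proof (induction vs)
  case Nil
  show ?case by (auto simp: space_prob_algebra space_prod_borel intro!: prob_space_return)
next
  case (Cons v vs)
  then show ?case unfolding kernel_product_Cons list.set
    using assms(1) by (intro bind_in_prob_algebra[OF Cons.IH measurable_extend_kernel]) auto
qed

lemma measurable_upd_section:
  assumes "insert v W \<subseteq> V" "x \<in> space (prod_borel X W)"
  shows "(\<lambda>y. x(v := y)) \<in> measurable (borel_at X v) (prod_borel X (insert v W))"
  using measurable_compose[OF measurable_Pair1'[OF assms(2)] measurable_upd[OF assms(1)]] by simp

lemma section_in_sets:
  assumes "insert v W \<subseteq> V" "x \<in> space (prod_borel X W)" "S \<in> sets (prod_borel X (insert v W))"
  shows "{y \<in> mspace (X v). x(v := y) \<in> S} \<in> sets (borel_at X v)"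
  using measurable_sets[OF measurable_upd_section[OF assms(1,2)] assms(3)]
  by (simp add: vimage_def Int_def conj_commute space_borel_at)

lemma measure_extend_kernel:
  assumes "m \<in> kernels E" "insert v W \<subseteq> V" "pa E v \<subseteq> W" "x \<in> space (prod_borel X W)" 
    and S: "S \<in> sets (prod_borel X (insert v W))"
  shows "measure (extend_kernel E m v W x) S = measure (m v (restrict x (pa E v))) {y \<in> mspace (X v). x(v := y) \<in> S}"
proof -
  have k: "m v (restrict x (pa E v)) \<in> space (prob_algebra (borel_at X v))"
    using measurable_space[OF measurable_kernel_restrict assms(4), of m E v] assms by auto
  have "(\<lambda>y. x(v := y)) \<in> measurable (m v (restrict x (pa E v))) (prod_borel X (insert v W))"
    using measurable_upd_section[OF assms(2,4)] measurable_cong_sets[OF prob_algebraD(2)[OF k] refl] by blast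
  from measure_distr[OF this S] show ?thesis
    unfolding extend_kernel_def prob_algebraD(3)[OF k] space_borel_at 
    by (simp add: vimage_def Int_def conj_commute)
qed

lemma measure_kernel_product_Cons:
  assumes m: "m \<in> kernels E" and o: "build_order E (v # vs)" and V: "set (v # vs) \<subseteq> V"
    and S: "S \<in> sets (prod_borel X (insert v (set vs)))"
  shows "measure (kernel_product E X m (v # vs)) S =
    (\<integral>x. measure (m v (restrict x (pa E v))) {y \<in> mspace (X v). x(v := y) \<in> S} \<partial>kernel_product E X m vs)"
proof -
  have P: "kernel_product E X m vs \<in> space (prob_algebra (prod_borel X (set vs)))"
    using kernel_product_prob[OF m] o V by auto
  have "measure (kernel_product E X m (v # vs)) S = (\<integral>x. measure (extend_kernel E m v (set vs) x) S \<partial>kernel_product E X m vs)"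
    unfolding kernel_product_Cons using o V m by (intro measure_bind_prob[OF P measurable_extend_kernel S]) auto
  also have "\<dots> = (\<integral>x. measure (m v (restrict x (pa E v))) {y \<in> mspace (X v). x(v := y) \<in> S} \<partial>kernel_product E X m vs)"
    using m o V S prob_algebraD(3)[OF P] by (intro Bochner_Integration.integral_cong refl measure_extend_kernel) auto
  finally show ?thesis .
qed

lemma kernel_product_marginal:
  assumes m: "m \<in> kernels E" and "build_order E (us @ vs)" and "set (us @ vs) \<subseteq> V"
  shows "distr (kernel_product E X m (us @ vs)) (prod_borel X (set vs)) (\<lambda>x. restrict x (set vs)) = kernel_product E X m vs"
  using assms(2,3)
proof (induction us)
  case Nil
  let ?P = "kernel_product E X m vs"
  have P: "?P \<in> space (prob_algebra (prod_borel X (set vs)))"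
    using kernel_product_prob[OF m] Nil by auto
  have "distr ?P (prod_borel X (set vs)) (\<lambda>x. restrict x (set vs)) = distr ?P ?P (\<lambda>x. x)"
    using prob_algebraD[OF P] by (intro distr_cong) (auto simp: space_prod_borel PiE_iff intro: extensional_restrict)
  then show ?case by (simp only: append_Nil distr_id)
next
  case (Cons u us)
  let ?W = "set (us @ vs)" and ?N = "prod_borel X (set vs)" and ?r = "\<lambda>x. restrict x (set vs)"
  let ?P = "kernel_product E X m (us @ vs)"
  have u: "u \<notin> ?W" "pa E u \<subseteq> ?W" "build_order E (us @ vs)" "insert u ?W \<subseteq> V" using Cons.prems by auto
  have P: "?P \<in> space (prob_algebra (prod_borel X ?W))"
    using kernel_product_prob[OF m u(3)] u(4) by simp
  have r: "?r \<in> measurable (prod_borel X (insert u ?W)) ?N" "?r \<in> measurable (prod_borel X ?W) ?N"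
    using u(4) by (intro measurable_restrict_prod; auto)+
  have rP: "?r \<in> measurable ?P ?N" using r(2) measurable_cong_sets[OF prob_algebraD(2)[OF P] refl] by blast
  have "distr (kernel_product E X m ((u # us) @ vs)) ?N ?r = distr (?P \<bind> extend_kernel E m u ?W) ?N ?r"
    by (simp only: append_Cons kernel_product_Cons)
  also have "\<dots> = ?P \<bind> (\<lambda>x. distr (extend_kernel E m u ?W x) ?N ?r)"
    using prob_algebraD[OF P] r(1) m u
    by (intro distr_bind[OF kernel_measurable[OF P measurable_extend_kernel]]) auto
  also have "\<dots> = ?P \<bind> (\<lambda>x. return ?N (?r x))"
  proof (rule bind_cong[OF refl])
    fix x assume "x \<in> space ?P"
    then have x: "x \<in> space (prod_borel X ?W)" using prob_algebraD[OF P] by auto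
    have k: "m u (restrict x (pa E u)) \<in> space (prob_algebra (borel_at X u))"
      using measurable_space[OF measurable_kernel_restrict x, of m E u] m u by auto
    interpret k: prob_space "m u (restrict x (pa E u))" by (rule prob_algebraD[OF k])
    have up: "(\<lambda>y. x(u := y)) \<in> measurable (m u (restrict x (pa E u))) (prod_borel X (insert u ?W))"
      using measurable_upd_section[OF u(4) x] measurable_cong_sets[OF prob_algebraD(2)[OF k] refl] by blast
    have "distr (extend_kernel E m u ?W x) ?N ?r = distr (m u (restrict x (pa E u))) ?N (\<lambda>y. ?r x)"
      unfolding extend_kernel_def using u(1)
      by (subst distr_distr[OF r(1) up]) (auto simp: comp_def restrict_def fun_eq_iff intro!: distr_cong)
    also have "\<dots> = return ?N (?r x)"
      using measurable_space[OF r(2) x] by (rule k.distr_const)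
    finally show "distr (extend_kernel E m u ?W x) ?N ?r = return ?N (?r x)" .
  qed
  also have "\<dots> = distr ?P ?N ?r"
    using prob_space.not_empty[OF prob_algebraD(1)[OF P]] rP by (rule bind_return_distr')
  also have "\<dots> = kernel_product E X m vs" by (rule Cons.IH[OF u(3)]) (use u(4) in simp)
  finally show ?case .
qed

lemma kernel_product_dists:
  assumes "m \<in> kernels E" "build_order E vs" "set vs = V"
  shows "kernel_product E X m vs \<in> dists"
  using kernel_product_prob[OF assms(1,2)] assms(3) by (simp add: dists_def)

text \<open>The local Markov property before it is phrased with conditional probabilities. Marginals of the product
do not depend on the vertices sampled later, so the claim reduces to the step in which \<open>v\<close> is sampled.\<close>

lemma kernel_product_disintegration:
  assumes m: "m \<in> kernels E" and o: "build_order E (us @ v # ws)" and V: "set (us @ v # ws) = V"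
    and S: "S \<in> sets (borel_at X v)" and U: "U \<in> sets (cyl (set ws))"
  defines "P \<equiv> kernel_product E X m (us @ v # ws)"
  shows "measure P ({x \<in> Om. x v \<in> S} \<inter> U) = (\<integral>x\<in>U. measure (m v (restrict x (pa E v))) S \<partial>P)"
proof -
  let ?W = "set ws" and ?W' = "insert v (set ws)" and ?k = "\<lambda>x. measure (m v (restrict x (pa E v))) S"
  have P: "P \<in> dists" unfolding P_def by (rule kernel_product_dists[OF m o V])
  have sub: "?W \<subseteq> V" "?W' \<subseteq> V" "v \<in> V" using V by auto
  have o': "build_order E (v # ws)" using build_order_append[OF o] .
  then have v: "v \<notin> ?W" "pa E v \<subseteq> ?W" by auto
  obtain U0 where U0: "U0 \<in> sets (prod_borel X ?W)" "U = (\<lambda>x. restrict x ?W) -` U0 \<inter> Om"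
    using U sets_cyl[OF sub(1)] by auto
  let ?Q = "kernel_product E X m ws"
  have Q: "?Q \<in> space (prob_algebra (prod_borel X ?W))"
    using kernel_product_prob[OF m] o' sub by auto
  let ?R = "((\<lambda>z. z v) -` S \<inter> space (prod_borel X ?W')) \<inter> ((\<lambda>x. restrict x ?W) -` U0 \<inter> space (prod_borel X ?W'))"
  have R: "?R \<in> sets (prod_borel X ?W')"
    using sub by (intro sets.Int measurable_sets[OF measurable_prod_component S]
      measurable_sets[OF measurable_restrict_prod U0(1)]) auto
  have mP: "(\<lambda>x. restrict x D) \<in> measurable P (prod_borel X D)" if "D \<subseteq> V" for D
    using measurable_restrict_prod[OF that order_refl] measurable_cong_sets[OF dists_sets[OF P] refl] by blast
  have marg: "distr P (prod_borel X ?W') (\<lambda>x. restrict x ?W') = kernel_product E X m (v # ws)"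
      "distr P (prod_borel X ?W) (\<lambda>x. restrict x ?W) = ?Q"
  proof -
    have "set (us @ v # ws) \<subseteq> V" using V by simp
    then show "distr P (prod_borel X ?W') (\<lambda>x. restrict x ?W') = kernel_product E X m (v # ws)"
      "distr P (prod_borel X ?W) (\<lambda>x. restrict x ?W) = ?Q"
      using kernel_product_marginal[OF m o] kernel_product_marginal[OF m, of "us @ [v]" ws] o
      unfolding P_def by (simp_all only: append_assoc append_Cons append_Nil list.set)
  qed
  have "{x \<in> Om. x v \<in> S} \<inter> U = (\<lambda>x. restrict x ?W') -` ?R \<inter> space P"
  proof -
    have "?W' \<inter> ?W = ?W" by auto
    then show ?thesis
      using restrict_Om[OF sub(2)] by (auto simp: U0(2) dists_space[OF P])
  qed
  then have "measure P ({x \<in> Om. x v \<in> S} \<inter> U) = measure (kernel_product E X m (v # ws)) ?R"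
    using measure_distr[OF mP[OF sub(2)] R] by (simp add: marg(1))
  also have "\<dots> = (\<integral>x. measure (m v (restrict x (pa E v))) {y \<in> mspace (X v). x(v := y) \<in> ?R} \<partial>?Q)"
    by (rule measure_kernel_product_Cons[OF m o' _ R]) (use sub in auto)
  also have "\<dots> = (\<integral>x. indicator U0 x * ?k x \<partial>?Q)"
  proof (intro Bochner_Integration.integral_cong refl)
    fix x assume "x \<in> space ?Q"
    then have x: "x \<in> (\<Pi>\<^sub>E v\<in>?W. mspace (X v))" using prob_algebraD(3)[OF Q] by (auto simp: space_prod_borel)
    have "restrict (x(v := y)) ?W = x" for y
      using x v by (auto simp: restrict_def fun_eq_iff PiE_iff extensional_def)
    moreover have "x(v := y) \<in> (\<Pi>\<^sub>E v\<in>?W'. mspace (X v))" if "y \<in> mspace (X v)" for y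
      using x that by (auto simp: PiE_iff extensional_def)
    moreover have "S \<subseteq> mspace (X v)" using sets.sets_into_space[OF S] by (simp add: space_borel_at)
    ultimately have "{y \<in> mspace (X v). x(v := y) \<in> ?R} = (if x \<in> U0 then S else {})"
      by (auto simp: space_prod_borel)
    then show "measure (m v (restrict x (pa E v))) {y \<in> mspace (X v). x(v := y) \<in> ?R} = indicator U0 x * ?k x" by simp
  qed
  also have "\<dots> = (\<integral>x. indicator U0 (restrict x ?W) * ?k (restrict x ?W) \<partial>P)"
  proof -
    have k: "?k \<in> borel_measurable (prod_borel X ?W)"
      using measurable_compose[OF measurable_prob_algebraD[OF measurable_kernel_restrict[OF m sub(3) v(2) sub(1)]]
        measurable_measure_subprob_algebra[OF S]] .
    show ?thesis
      unfolding marg(2)[symmetric] using U0(1) k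
      by (intro integral_distr[OF mP[OF sub(1)]] borel_measurable_times) auto
  qed
  also have "\<dots> = (\<integral>x\<in>U. ?k x \<partial>P)"
    unfolding set_lebesgue_integral_def using v
    by (intro Bochner_Integration.integral_cong refl)
      (auto simp: U0(2) indicator_def dists_space[OF P] Int_absorb1)
  finally show ?thesis .
qed

text \<open>The kernel itself is a version of the conditional distribution of \<open>X\<^sub>v\<close> given all earlier coordinates,
and it depends on the parents only.\<close>

theorem kernel_product_local_markov:
  assumes m: "m \<in> kernels E" and o: "build_order E (us @ v # ws)" and V: "set (us @ v # ws) = V"
  shows "cond_indep X (kernel_product E X m (us @ v # ws)) {v} (set ws) (pa E v)"
proof -
  let ?W = "set ws" and ?pa = "pa E v"
  let ?P = "kernel_product E X m (us @ v # ws)"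
  have P: "?P \<in> dists" by (rule kernel_product_dists[OF m o V])
  interpret P: prob_space ?P by (rule dists_prob_space[OF P])
  have o': "build_order E (v # ws)" using build_order_append[OF o] .
  then have v: "v \<in> V" "?W \<subseteq> V" "?pa \<subseteq> ?W" "?pa \<subseteq> V" using V by auto
  show ?thesis
  proof (subst cond_indep_iff_Un[OF P], safe)
    fix S0 U assume S0: "S0 \<in> sets (cyl {v})" and "U \<in> sets (cyl (?W \<union> ?pa))"
    then have U: "U \<in> sets (cyl ?W)" using v by (simp add: Un_absorb2)
    obtain S1 where S1: "S1 \<in> sets (prod_borel X {v})" "S0 = (\<lambda>x. restrict x {v}) -` S1 \<inter> Om"
      using S0 sets_cyl[of "{v}"] v by auto
    let ?h = "\<lambda>y. restrict (\<lambda>_. y) {v}"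
    have h: "?h \<in> measurable (borel_at X v) (prod_borel X {v})"
      using v by (intro measurable_into_prod) auto
    define S where "S = ?h -` S1 \<inter> space (borel_at X v)"
    have S: "S \<in> sets (borel_at X v)" unfolding S_def by (rule measurable_sets[OF h S1(1)])
    have "restrict x {v} = ?h (x v)" for x :: "'v \<Rightarrow> 'a" by (auto simp: restrict_def)
    then have S0_eq: "S0 = {x \<in> Om. x v \<in> S}"
      using v(1) by (auto simp: S1(2) S_def space_borel_at)
    let ?k = "\<lambda>x. measure (m v (restrict x ?pa)) S"
    have dis: "measure ?P (S0 \<inter> U') = (\<integral>x\<in>U'. ?k x \<partial>?P)" if "U' \<in> sets (cyl ?W)" for U'
      unfolding S0_eq by (rule kernel_product_disintegration[OF m o V S that])
    have S0P: "S0 \<in> P.events" using dists_events[OF P _ S0] v by auto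
    have "(\<lambda>x. restrict x ?pa) \<in> measurable (cyl ?pa) (prod_borel X ?pa)"
      unfolding cyl_def using restrict_Om[OF v(4)] by (intro measurable_vimage_algebra1) auto
    moreover have "m v \<in> measurable (prod_borel X ?pa) (prob_algebra (borel_at X v))"
      using m v by (auto simp: kernels_def)
    ultimately have kC: "?k \<in> borel_measurable (cyl ?pa)"
      using measurable_compose[OF measurable_compose measurable_measure_subprob_algebra[OF S]] measurable_prob_algebraD
      by blast
    have kP: "integrable ?P ?k"
    proof (rule P.integrable_const_bound[where B=1])
      show "?k \<in> borel_measurable ?P"
        by (rule measurable_from_subalg[OF dists_subalgebra[OF P v(4)] kC])
      show "AE x in ?P. norm (?k x) \<le> 1"
      proof (rule AE_I2)
        fix x assume "x \<in> space ?P"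
        then have "restrict x ?pa \<in> space (prod_borel X ?pa)" using restrict_Om[OF v(4)] dists_space[OF P] by auto
        then have "m v (restrict x ?pa) \<in> space (prob_algebra (borel_at X v))"
          using m v by (auto simp: kernels_def dest: measurable_space)
        then interpret k: prob_space "m v (restrict x ?pa)" by (rule prob_algebraD)
        show "norm (?k x) \<le> 1" by simp
      qed
    qed
    have "AE x in ?P. given ?P ?pa S0 x = ?k x"
      using cyl_mono[OF v(3,2)]
      by (intro P.cond_exp_indicator_unique[OF dists_subalgebra[OF P v(4)] S0P kC kP] dis) auto
    moreover have "U \<in> P.events" using dists_events[OF P v(2) U] .
    ultimately have "(\<integral>x\<in>U. given ?P ?pa S0 x \<partial>?P) = (\<integral>x\<in>U. ?k x \<partial>?P)"
      unfolding set_lebesgue_integral_def using kP by (intro integral_cong_AE) auto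
    then show "measure ?P (S0 \<inter> U) = (\<integral>x\<in>U. given ?P ?pa S0 x \<partial>?P)" using dis[OF U] by simp
  qed (use v in auto)
qed

theorem kernel_product_markov:
  assumes ac: "acyclic E" and m: "m \<in> kernels E" and o: "build_order E vs" and V: "set vs = V"
  shows "kernel_product E X m vs \<in> markov_dists V E X"
proof -
  let ?P = "kernel_product E X m vs"
  have P: "?P \<in> dists" by (rule kernel_product_dists[OF m o V])
  interpret semigraphoid "cond_indep X ?P" V by (rule semigraphoid_cond_indep[OF P])
  have "cond_indep X ?P A B C" if "A \<subseteq> V" "B \<subseteq> V" "C \<subseteq> V" "d_separated V E A B C" for A B C
  proof (rule d_separation_sound[OF ac, of vs])
    fix us v ws assume vs: "vs = us @ v # ws"
    then have "pa E v \<subseteq> set ws" using build_order_append[of E us "v # ws"] o by auto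
    then show "pa E v \<subseteq> set ws \<and> cond_indep X ?P {v} (set ws) (pa E v)"
      using kernel_product_local_markov[OF m, of us v ws] o V vs by auto
  qed (use that V build_order_distinct[OF o] in auto)
  then show ?thesis using P by (simp add: markov_dists_def dists_def)
qed

end

section \<open>Mixtures and densities\<close>

text \<open>The convex combination \<open>(1 - t) P + t Q\<close>. Written as a bind it inherits measurability in parameters and
commutes with kernels by the monad laws.\<close>

definition mixture :: "real \<Rightarrow> 'a measure \<Rightarrow> 'a measure \<Rightarrow> 'a measure" where
  "mixture t P Q = measure_pmf (bernoulli_pmf t) \<bind> (\<lambda>b. if b then Q else P)"

lemma bernoulli_in_prob_algebra: "measure_pmf p \<in> space (prob_algebra (count_space UNIV))"
  by (simp add: space_prob_algebra measure_pmf.prob_space_axioms)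

lemma mixture_kernel:
  assumes "P \<in> space (prob_algebra M)" "Q \<in> space (prob_algebra M)"
  shows "(\<lambda>b. if b then Q else P) \<in> measurable (count_space UNIV) (prob_algebra M)"
  using assms by auto

lemma mixture_in_prob_algebra:
  assumes "P \<in> space (prob_algebra M)" "Q \<in> space (prob_algebra M)"
  shows "mixture t P Q \<in> space (prob_algebra M)"
  unfolding mixture_def by (rule bind_in_prob_algebra[OF bernoulli_in_prob_algebra mixture_kernel[OF assms]])

lemma measure_mixture:
  assumes "P \<in> space (prob_algebra M)" "Q \<in> space (prob_algebra M)" "S \<in> sets M" "0 \<le> t" "t \<le> 1"
  shows "measure (mixture t P Q) S = (1 - t) * measure P S + t * measure Q S"
  unfolding mixture_def
  using measure_bind_prob[OF bernoulli_in_prob_algebra mixture_kernel[OF assms(1,2)] assms(3), of "bernoulli_pmf t"] assms(4,5)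
  by simp

lemma measurable_mixture:
  assumes "p \<in> measurable N (prob_algebra M)" "q \<in> measurable N (prob_algebra M)"
  shows "(\<lambda>x. mixture t (p x) (q x)) \<in> measurable N (prob_algebra M)"
  unfolding mixture_def
proof (rule measurable_bind_prob_space2)
  show "(\<lambda>_. measure_pmf (bernoulli_pmf t)) \<in> measurable N (prob_algebra (count_space UNIV))"
    by (intro measurable_const bernoulli_in_prob_algebra)
  have "(\<lambda>z. if snd z then q (fst z) else p (fst z)) \<in> measurable (N \<Otimes>\<^sub>M count_space UNIV) (prob_algebra M)"
    using measurable_compose[OF measurable_fst assms(1)] measurable_compose[OF measurable_fst assms(2)]
    by (intro measurable_If) auto
  then show "(\<lambda>(x, b). if b then q x else p x) \<in> measurable (N \<Otimes>\<^sub>M count_space UNIV) (prob_algebra M)"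
    by (simp add: case_prod_unfold)
qed

lemma measure_bind_mixture:
  assumes P: "P \<in> space (prob_algebra M)" and Q: "Q \<in> space (prob_algebra M)"
    and K: "K \<in> measurable M (prob_algebra N)" and S: "S \<in> sets N" and t: "0 \<le> t" "t \<le> 1"
  shows "measure (mixture t P Q \<bind> K) S = (1 - t) * measure (P \<bind> K) S + t * measure (Q \<bind> K) S"
proof -
  have "mixture t P Q \<bind> K = measure_pmf (bernoulli_pmf t) \<bind> (\<lambda>b. (if b then Q else P) \<bind> K)"
    unfolding mixture_def
    by (rule bind_assoc[OF kernel_measurable[OF bernoulli_in_prob_algebra mixture_kernel[OF P Q]] measurable_prob_algebraD[OF K]])
  also have "\<dots> = mixture t (P \<bind> K) (Q \<bind> K)"
    unfolding mixture_def by (intro bind_cong refl) simp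
  finally show ?thesis
    using measure_mixture[OF bind_in_prob_algebra[OF P K] bind_in_prob_algebra[OF Q K] S t] by simp
qed

lemma prob_algebra_eqI:
  assumes "P \<in> space (prob_algebra M)" "Q \<in> space (prob_algebra M)"
    and "\<And>S. S \<in> sets M \<Longrightarrow> measure P S = measure Q S"
  shows "P = Q"
proof -
  interpret P: prob_space P by (rule prob_algebraD[OF assms(1)])
  interpret Q: prob_space Q by (rule prob_algebraD[OF assms(2)])
  show ?thesis
    using assms(3) prob_algebraD(2)[OF assms(1)] prob_algebraD(2)[OF assms(2)]
    by (intro measure_eqI) (simp_all add: P.emeasure_eq_measure Q.emeasure_eq_measure)
qed

lemma tv_dist_mixture:
  assumes "P \<in> space (prob_algebra M)" "Q \<in> space (prob_algebra M)" "0 \<le> t" "t \<le> 1"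
  shows "tv_dist (mixture t P Q) P \<le> t"
proof (rule tv_dist_least[OF mixture_in_prob_algebra[OF assms(1,2)]])
  fix S assume S: "S \<in> sets M"
  have "measure (mixture t P Q) S - measure P S = t * (measure Q S - measure P S)"
    unfolding measure_mixture[OF assms(1,2) S assms(3,4)] by (simp add: algebra_simps)
  then show "\<bar>measure (mixture t P Q) S - measure P S\<bar> \<le> t"
    using tv_bdd[OF assms(2,1), of S] assms(3) by (simp add: abs_mult mult_left_le)
qed

definition has_density :: "'a measure \<Rightarrow> 'a measure \<Rightarrow> ('a \<Rightarrow> real) \<Rightarrow> bool" where
  "has_density P L D \<longleftrightarrow> D \<in> borel_measurable L \<and> integrable L D \<and> (\<forall>x. 0 \<le> D x) \<and> P = density L D"

lemma has_densityI:
  assumes "finite_measure P" "sets P = sets L" "D \<in> borel_measurable L" "integrable L D" "\<And>x. 0 \<le> D x"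
    and "\<And>S. S \<in> sets L \<Longrightarrow> measure P S = (\<integral>x. D x * indicator S x \<partial>L)"
  shows "has_density P L D"
  unfolding has_density_def
proof (intro conjI allI measure_eqI)
  interpret finite_measure P by fact
  fix S assume "S \<in> sets P"
  then have S: "S \<in> sets L" using assms by simp
  have "emeasure (density L D) S = (\<integral>\<^sup>+x. ennreal (D x * indicator S x) \<partial>L)"
    using assms S by (subst emeasure_density) (auto intro!: nn_integral_cong simp: indicator_def)
  also have "\<dots> = ennreal (\<integral>x. D x * indicator S x \<partial>L)"
    using assms(5) integrable_mult_indicator[OF S assms(4)]
    by (intro nn_integral_eq_integral) (auto simp: mult.commute)
  finally show "emeasure P S = emeasure (density L D) S"
    by (simp add: emeasure_eq_measure assms(6)[OF S])
qed (use assms in auto)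

lemma has_density_integral:
  assumes "has_density P L D" "f \<in> borel_measurable L"
  shows "(\<integral>x. f x \<partial>P) = (\<integral>x. D x * f x \<partial>L)"
  using assms integral_density[of f L D] by (auto simp: has_density_def)

lemma has_density_integrable:
  assumes "has_density P L D" "f \<in> borel_measurable L"
  shows "integrable P f \<longleftrightarrow> integrable L (\<lambda>x. D x * f x)"
  using assms integrable_density[of f L D] by (auto simp: has_density_def)

lemma has_density_measure:
  assumes "has_density P L D" "S \<in> sets L"
  shows "measure P S = (\<integral>x. D x * indicator S x \<partial>L)"
proof -
  have s: "sets P = sets L" "space P = space L" using assms by (auto simp: has_density_def)
  have "measure P S = (\<integral>x. indicator S x \<partial>P)"
    using assms(2) sets.sets_into_space[OF assms(2)] by (simp add: s Int_absorb2)
  then show ?thesis using has_density_integral[OF assms(1), of "indicator S"] assms(2) by simp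
qed

text \<open>The midpoint dominates both end points, so it is a reference measure for the whole segment.\<close>

lemma mixture_half_density:
  assumes P: "P \<in> space (prob_algebra M)" and Q: "Q \<in> space (prob_algebra M)"
    and R: "R \<in> {P, Q}"
  shows "\<exists>D. has_density R (mixture (1/2) P Q) D"
proof -
  let ?L = "mixture (1/2) P Q"
  have L: "?L \<in> space (prob_algebra M)" by (rule mixture_in_prob_algebra[OF P Q])
  have R': "R \<in> space (prob_algebra M)" using P Q R by auto
  interpret L: prob_space ?L by (rule prob_algebraD[OF L])
  interpret R: prob_space R by (rule prob_algebraD[OF R'])
  have s: "sets R = sets ?L" using prob_algebraD(2)[OF L] prob_algebraD(2)[OF R'] by simp
  have ac: "absolutely_continuous ?L R"
    unfolding absolutely_continuous_def
  proof
    fix S assume S: "S \<in> null_sets ?L"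
    then have SM: "S \<in> sets M" using prob_algebraD(2)[OF L] by auto
    have "measure ?L S = 0" using S by (auto simp: null_sets_def measure_def)
    then have "measure P S + measure Q S = 0"
      using measure_mixture[OF P Q SM, of "1/2"] by simp
    then have "measure R S = 0"
      using R measure_nonneg[of P S] measure_nonneg[of Q S] by (auto simp: add_nonneg_eq_0_iff)
    then show "S \<in> null_sets R" using SM prob_algebraD(2)[OF R'] by (auto simp: null_sets_def R.emeasure_eq_measure)
  qed
  obtain D where D: "D \<in> borel_measurable ?L" "AE x in ?L. RN_deriv ?L R x = ennreal (D x)" "\<And>x. 0 \<le> D x"
    using L.real_RN_deriv[OF R.finite_measure_axioms ac s] by metis
  have dens: "R = density ?L D"
    using L.density_RN_deriv[OF ac s] density_cong[OF _ _ D(2)] D(1) by simp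
  have "(\<integral>\<^sup>+x. ennreal (D x) \<partial>?L) = emeasure (density ?L D) (space ?L)"
    using D(1) by (subst emeasure_density) (auto intro!: nn_integral_cong)
  also have "\<dots> = 1" using dens R.emeasure_space_1 sets_eq_imp_space_eq[OF s] by simp
  finally have "integrable ?L D" using D by (intro integrableI_nonneg) auto
  then show ?thesis using D dens by (auto simp: has_density_def)
qed

section \<open>Conditional dependence is robust in total variation\<close>

text \<open>The difference of the integrals increases when \<open>f\<close> is replaced by the indicator of the event where
the density of \<open>P\<close> exceeds that of \<open>Q\<close>.\<close>

lemma integral_diff_le_tv_dist:
  fixes f :: "'a \<Rightarrow> real"
  assumes P: "P \<in> space (prob_algebra M)" and Q: "Q \<in> space (prob_algebra M)"
    and f: "f \<in> borel_measurable M" and f01: "\<And>x. x \<in> space M \<Longrightarrow> 0 \<le> f x \<and> f x \<le> 1"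
  shows "(\<integral>x. f x \<partial>P) - (\<integral>x. f x \<partial>Q) \<le> tv_dist P Q"
proof -
  let ?L = "mixture (1/2) P Q"
  have L: "?L \<in> space (prob_algebra M)" by (rule mixture_in_prob_algebra[OF P Q])
  obtain D0 D1 where D0: "has_density P ?L D0" and D1: "has_density Q ?L D1"
    using mixture_half_density[OF P Q] by blast
  then have [measurable]: "D0 \<in> borel_measurable ?L" "D1 \<in> borel_measurable ?L"
    and Di: "integrable ?L D0" "integrable ?L D1" by (auto simp: has_density_def)
  note [measurable_cong] = prob_algebraD(2)[OF L]
  have fL: "f \<in> borel_measurable ?L" using f by measurable
  have int: "integrable ?L (\<lambda>x. D x * f x)" if "integrable ?L D" for D :: "_ \<Rightarrow> real"
    using that f01 fL by (intro Bochner_Integration.integrable_bound[OF that])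
      (auto simp: prob_algebraD(3)[OF L] abs_mult mult_left_le intro!: AE_I2)
  let ?S = "{x \<in> space ?L. D1 x < D0 x}"
  have S: "?S \<in> sets ?L" by measurable
  have ind: "integrable ?L (\<lambda>x. D x * indicator ?S x)" if "integrable ?L D" for D :: "_ \<Rightarrow> real"
    using integrable_mult_indicator[OF S that] by (simp add: mult.commute)
  have "(\<integral>x. f x \<partial>P) - (\<integral>x. f x \<partial>Q) = (\<integral>x. D0 x * f x - D1 x * f x \<partial>?L)"
    using int Di by (simp add: has_density_integral[OF D0 fL] has_density_integral[OF D1 fL])
  also have "\<dots> \<le> (\<integral>x. D0 x * indicator ?S x - D1 x * indicator ?S x \<partial>?L)"
  proof (rule integral_mono)
    fix x assume x: "x \<in> space ?L"
    then have "0 \<le> f x" "f x \<le> 1" using f01 by (auto simp: prob_algebraD(3)[OF L])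
    then have "(D0 x - D1 x) * f x \<le> (D0 x - D1 x) * indicator ?S x"
      using x by (auto simp: indicator_def mult_left_le mult_nonpos_nonneg)
    then show "D0 x * f x - D1 x * f x \<le> D0 x * indicator ?S x - D1 x * indicator ?S x"
      by (simp only: left_diff_distrib)
  qed (use int ind Di in auto)
  also have "\<dots> = measure P ?S - measure Q ?S"
    using ind Di by (simp add: has_density_measure[OF D0 S] has_density_measure[OF D1 S])
  also have "\<dots> \<le> tv_dist P Q"
    using tv_dist_upper[OF P Q, of ?S] S prob_algebraD(2)[OF L] by (auto simp: abs_le_iff)
  finally show ?thesis .
qed

lemma tv_dist_integral:
  fixes f :: "'a \<Rightarrow> real"
  assumes "P \<in> space (prob_algebra M)" "Q \<in> space (prob_algebra M)"
    and "f \<in> borel_measurable M" "\<And>x. x \<in> space M \<Longrightarrow> 0 \<le> f x \<and> f x \<le> 1"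
  shows "\<bar>(\<integral>x. f x \<partial>P) - (\<integral>x. f x \<partial>Q)\<bar> \<le> tv_dist P Q"
  using integral_diff_le_tv_dist[OF assms] integral_diff_le_tv_dist[OF assms(2,1,3,4)]
    tv_dist_commute[OF assms(1,2)] by linarith

text \<open>Conditional probabilities lie in the unit interval only almost everywhere, and the exceptional set
depends on the measure. Clamping gives versions that can be integrated against two measures at once.\<close>

definition clamp01 :: "real \<Rightarrow> real" where
  "clamp01 t = max 0 (min 1 t)"

lemma clamp01_bounds: "0 \<le> clamp01 t" "clamp01 t \<le> 1"
  by (auto simp: clamp01_def)

lemma clamp01_measurable [measurable]: "f \<in> borel_measurable M \<Longrightarrow> (\<lambda>x. clamp01 (f x)) \<in> borel_measurable M"
  unfolding clamp01_def by (intro borel_measurable_max borel_measurable_min borel_measurable_const)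

context prob_space begin

lemma clamp01_cond_exp:
  assumes F: "subalgebra M F" and S: "S \<in> events"
  shows "AE x in M. clamp01 (real_cond_exp M F (indicator S) x) = real_cond_exp M F (indicator S) x"
proof -
  interpret finite_measure_subalgebra M F by unfold_locales (rule F)
  have i: "integrable M (indicator S :: _ \<Rightarrow> real)" using S by (simp add: emeasure_eq_measure)
  have "AE x in M. 0 \<le> real_cond_exp M F (indicator S) x"
    using S by (intro real_cond_exp_pos) auto
  moreover have "AE x in M. real_cond_exp M F (indicator S) x \<le> 1"
    by (intro real_cond_exp_le_c i AE_I2) (auto simp: indicator_def)
  ultimately show ?thesis by eventually_elim (auto simp: clamp01_def)
qed

lemma integral_mult_cond_prob:
  assumes F: "subalgebra M F" and S: "S \<in> events"
    and h: "integrable M h" "h \<in> borel_measurable F"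
  shows "(\<integral>x. h x * clamp01 (real_cond_exp M F (indicator S) x) \<partial>M) = (\<integral>x. h x * indicator S x \<partial>M)"
    "(\<integral>x. h x * real_cond_exp M F (indicator S) x \<partial>M) = (\<integral>x. h x * indicator S x \<partial>M)"
proof -
  interpret finite_measure_subalgebra M F by unfold_locales (rule F)
  have [measurable]: "h \<in> borel_measurable M" using h by auto
  show 2: "(\<integral>x. h x * real_cond_exp M F (indicator S) x \<partial>M) = (\<integral>x. h x * indicator S x \<partial>M)"
    using integrable_mult_indicator[OF S h(1)] S h(2)
    by (intro real_cond_exp_intg(2)) (auto simp: mult.commute)
  show "(\<integral>x. h x * clamp01 (real_cond_exp M F (indicator S) x) \<partial>M) = (\<integral>x. h x * indicator S x \<partial>M)"
    unfolding 2[symmetric] using clamp01_cond_exp[OF F S] by (intro integral_cong_AE) auto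
qed

end

context separable_product
begin

text \<open>Let \<open>f\<close> and \<open>g\<close> be clamped versions of \<open>Q(S | C)\<close> and \<open>P(T | C)\<close>. Under \<open>Q\<close> the identity holds with
\<open>f\<close>, and both sides change by at most the total variation distance on passing from \<open>Q\<close> to \<open>P\<close>. It remains
to compare \<open>f\<close> with \<open>P(S | C)\<close> under \<open>P\<close>. Since \<open>1\<^sub>T\<close> may be replaced by \<open>g\<close>, this is a comparison
of \<open>f\<close> with \<open>1\<^sub>S\<close> against functions of \<open>X\<^sub>C\<close>, which is exact under \<open>Q\<close>. Two further changes of measure make
four in total.\<close>

lemma cond_indep_defect_le:
  assumes P: "P \<in> dists" and Q: "Q \<in> dists" and V: "A \<subseteq> V" "B \<subseteq> V" "C \<subseteq> V"
    and ci: "cond_indep X Q A B C"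
    and S: "S \<in> sets (cyl A)" and T: "T \<in> sets (cyl B)" and U: "U \<in> sets (cyl C)"
  shows "\<bar>measure P (S \<inter> (T \<inter> U)) - (\<integral>x\<in>T \<inter> U. given P C S x \<partial>P)\<bar> \<le> 4 * tv_dist P Q"
proof -
  interpret P: prob_space P by (rule dists_prob_space[OF P])
  interpret Q: prob_space Q by (rule dists_prob_space[OF Q])
  note PF = dists_subalgebra[OF P V(3)] and QF = dists_subalgebra[OF Q V(3)]
  let ?M = "prod_borel X V"
  have P': "P \<in> space (prob_algebra ?M)" and Q': "Q \<in> space (prob_algebra ?M)"
    using P Q by (auto simp: dists_def)
  have [measurable_cong]: "sets P = sets ?M" "sets Q = sets ?M" by (simp_all add: dists_sets P Q)
  have sub: "subalgebra ?M (cyl C)" using PF by (simp add: subalgebra_def space_prod_borel dists_space[OF P] dists_sets[OF P])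
  have ev: "S \<in> sets ?M" "T \<in> sets ?M" "U \<in> sets ?M"
    using dists_events[OF P V(1) S] dists_events[OF P V(2) T] dists_events[OF P V(3) U] by (auto simp: dists_sets[OF P])
  note [measurable] = ev U
  let ?f = "\<lambda>x. clamp01 (given Q C S x)" and ?g = "\<lambda>x. clamp01 (given P C T x)"
  have fC: "?f \<in> borel_measurable (cyl C)" and gC: "?g \<in> borel_measurable (cyl C)" by measurable
  then have [measurable]: "?f \<in> borel_measurable ?M" "?g \<in> borel_measurable ?M"
    using measurable_from_subalg[OF sub] by blast+
  have tv: "\<bar>(\<integral>x. h x \<partial>P) - (\<integral>x. h x \<partial>Q)\<bar> \<le> tv_dist P Q"
    if "h \<in> borel_measurable ?M" "\<And>x. 0 \<le> h x" "\<And>x. h x \<le> 1" for h :: "_ \<Rightarrow> real"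
    using that by (intro tv_dist_integral[OF P' Q']) auto
  have int: "integrable P h" "integrable Q h"
    if "h \<in> borel_measurable ?M" "\<And>x. 0 \<le> h x" "\<And>x. h x \<le> 1" for h :: "_ \<Rightarrow> real"
  proof -
    have "h \<in> borel_measurable P" "h \<in> borel_measurable Q" using that(1) by measurable
    then show "integrable P h" "integrable Q h"
      using that(2,3) by (auto intro!: P.integrable_const_bound[where B=1] Q.integrable_const_bound[where B=1])
  qed
  let ?I = "\<lambda>W x. indicator W x :: real"
  note b = clamp01_bounds mult_le_one mult_nonneg_nonneg
  have 1: "\<bar>measure P (S \<inter> (T \<inter> U)) - measure Q (S \<inter> (T \<inter> U))\<bar> \<le> tv_dist P Q"
    by (rule tv_dist_upper[OF P' Q']) measurable
  have 2: "measure Q (S \<inter> (T \<inter> U)) = (\<integral>x. ?I U x * ?f x * ?I T x \<partial>Q)"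
  proof -
    have "measure Q (S \<inter> (T \<inter> U)) = (\<integral>x\<in>T \<inter> U. given Q C S x \<partial>Q)"
      using ci S T U unfolding cond_indep_iff[OF Q V] by blast
    also have "\<dots> = (\<integral>x. ?I U x * ?f x * ?I T x \<partial>Q)"
      unfolding set_lebesgue_integral_def using Q.clamp01_cond_exp[OF QF, of S] ev
      by (intro integral_cong_AE) (auto simp: dists_sets[OF Q] indicator_inter_arith elim!: eventually_mono)
    finally show ?thesis .
  qed
  have 3: "\<bar>(\<integral>x. ?I U x * ?f x * ?I T x \<partial>P) - (\<integral>x. ?I U x * ?f x * ?I T x \<partial>Q)\<bar> \<le> tv_dist P Q"
    by (rule tv) (auto intro!: b)
  have 4: "(\<integral>x. ?I U x * ?f x * ?I T x \<partial>P) = (\<integral>x. ?I U x * ?f x * ?g x \<partial>P)"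
    using fC by (intro P.integral_mult_cond_prob(1)[OF PF, symmetric] int) (auto intro!: b simp: dists_sets[OF P] ev)
  have 5: "(\<integral>x\<in>T \<inter> U. given P C S x \<partial>P) = (\<integral>x. ?I U x * ?g x * ?I S x \<partial>P)"
  proof -
    have i: "integrable P (\<lambda>x. ?I U x * given P C S x)"
      using ev by (intro P.integrable_indicator_mult_cond_exp[OF PF]) (auto simp: dists_sets[OF P])
    have "(\<integral>x\<in>T \<inter> U. given P C S x \<partial>P) = (\<integral>x. ?I U x * given P C S x * ?I T x \<partial>P)"
      unfolding set_lebesgue_integral_def by (simp add: indicator_inter_arith mult_ac)
    also have "\<dots> = (\<integral>x. ?I U x * given P C S x * ?g x \<partial>P)"
      using ev by (intro P.integral_mult_cond_prob(1)[OF PF, symmetric] i) (auto simp: dists_sets[OF P])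
    also have "\<dots> = (\<integral>x. ?I U x * ?g x * given P C S x \<partial>P)" by (simp add: mult_ac)
    also have "\<dots> = (\<integral>x. ?I U x * ?g x * ?I S x \<partial>P)"
      using gC by (intro P.integral_mult_cond_prob(2)[OF PF] int) (auto intro!: b simp: dists_sets[OF P] ev)
    finally show ?thesis .
  qed
  have 6: "(\<integral>x. ?I U x * ?g x * ?f x \<partial>Q) = (\<integral>x. ?I U x * ?g x * ?I S x \<partial>Q)"
    using gC by (intro Q.integral_mult_cond_prob(1)[OF QF] int) (auto intro!: b simp: dists_sets[OF Q] ev)
  have 7: "\<bar>(\<integral>x. ?I U x * ?g x * ?f x \<partial>P) - (\<integral>x. ?I U x * ?g x * ?f x \<partial>Q)\<bar> \<le> tv_dist P Q"
    by (rule tv) (auto intro!: b)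
  have 8: "\<bar>(\<integral>x. ?I U x * ?g x * ?I S x \<partial>P) - (\<integral>x. ?I U x * ?g x * ?I S x \<partial>Q)\<bar> \<le> tv_dist P Q"
    by (rule tv) (auto intro!: b)
  have "(\<integral>x. ?I U x * ?f x * ?g x \<partial>P) = (\<integral>x. ?I U x * ?g x * ?f x \<partial>P)" by (simp add: mult_ac)
  then show ?thesis using 1 2 3 4 5 6 7 8 by linarith
qed

lemma not_cond_indep_robust:
  assumes P: "P \<in> dists" and V: "A \<subseteq> V" "B \<subseteq> V" "C \<subseteq> V" and nci: "\<not> cond_indep X P A B C"
  shows "\<exists>r>0. \<forall>Q\<in>dists. tv_dist P Q < r \<longrightarrow> \<not> cond_indep X Q A B C"
proof -
  obtain S T U where STU: "S \<in> sets (cyl A)" "T \<in> sets (cyl B)" "U \<in> sets (cyl C)"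
    and ne: "measure P (S \<inter> (T \<inter> U)) \<noteq> (\<integral>x\<in>T \<inter> U. given P C S x \<partial>P)"
    using nci unfolding cond_indep_iff[OF P V] by blast
  let ?r = "\<bar>measure P (S \<inter> (T \<inter> U)) - (\<integral>x\<in>T \<inter> U. given P C S x \<partial>P)\<bar> / 4"
  show ?thesis
  proof (intro exI[of _ ?r] conjI ballI impI notI)
    fix Q assume "Q \<in> dists" "tv_dist P Q < ?r" "cond_indep X Q A B C"
    with cond_indep_defect_le[OF P this(1) V this(3) STU] show False by simp
  qed (use ne in simp)
qed

lemma bayes_nets_kernels: "m \<in> bayes_nets V E X \<Longrightarrow> m \<in> kernels E"
  by (auto simp: bayes_nets_def kernels_def)

text \<open>The error made by exchanging one kernel is at most the uniform distance of the two kernels, and kernels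
do not increase total variation distances.\<close>

lemma kernel_product_tv_le:
  assumes m: "m \<in> bayes_nets V E X" and m': "m' \<in> bayes_nets V E X"
    and "build_order E vs" "set vs \<subseteq> V"
  shows "tv_dist (kernel_product E X m vs) (kernel_product E X m' vs)
    \<le> (\<Sum>v\<in>set vs. SUP x\<in>space (prod_borel X (pa E v)). tv_dist (m v x) (m' v x))"
  using assms(3,4)
proof (induction vs)
  case Nil
  show ?case
    by (rule tv_dist_least[of _ "prod_borel X {}"])
      (auto simp: space_prob_algebra space_prod_borel intro!: prob_space_return)
next
  case (Cons v vs)
  let ?s = "\<lambda>v. SUP x\<in>space (prod_borel X (pa E v)). tv_dist (m v x) (m' v x)"
  let ?W = "set vs" let ?P = "kernel_product E X m vs" and ?Q = "kernel_product E X m' vs"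
  have k: "m \<in> kernels E" "m' \<in> kernels E" using m m' by (auto intro: bayes_nets_kernels)
  have v: "v \<notin> ?W" "pa E v \<subseteq> ?W" "build_order E vs" "insert v ?W \<subseteq> V" "v \<in> V" "?W \<subseteq> V" using Cons.prems by auto
  have P: "?P \<in> space (prob_algebra (prod_borel X ?W))" and Q: "?Q \<in> space (prob_algebra (prod_borel X ?W))"
    using kernel_product_prob[OF _ v(3,6)] k by auto
  have e: "extend_kernel E m v ?W \<in> measurable (prod_borel X ?W) (prob_algebra (prod_borel X (insert v ?W)))"
    "extend_kernel E m' v ?W \<in> measurable (prod_borel X ?W) (prob_algebra (prod_borel X (insert v ?W)))"
    using measurable_extend_kernel v k by auto
  have P': "kernel_product E X m (v # vs) \<in> space (prob_algebra (prod_borel X (insert v ?W)))"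
    using kernel_product_prob[OF k(1) Cons.prems] by simp
  have "tv_dist (kernel_product E X m (v # vs)) (kernel_product E X m' (v # vs)) \<le> tv_dist ?P ?Q + ?s v"
  proof (rule tv_dist_least[OF P'])
    fix S assume S: "S \<in> sets (prod_borel X (insert v ?W))"
    let ?k = "\<lambda>x. measure (extend_kernel E m v ?W x) S" and ?k' = "\<lambda>x. measure (extend_kernel E m' v ?W x) S"
    have km: "?k \<in> borel_measurable (prod_borel X ?W)" "?k' \<in> borel_measurable (prod_borel X ?W)"
      using measurable_compose[OF measurable_prob_algebraD[OF e(1)] measurable_measure_subprob_algebra[OF S]]
        measurable_compose[OF measurable_prob_algebraD[OF e(2)] measurable_measure_subprob_algebra[OF S]] by auto
    have k01: "?k x \<le> 1" "?k' x \<le> 1" if "x \<in> space (prod_borel X ?W)" for x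
      using prob_space.prob_le_1[OF prob_algebraD(1)[OF measurable_space[OF e(1) that]]]
        prob_space.prob_le_1[OF prob_algebraD(1)[OF measurable_space[OF e(2) that]]] by auto
    interpret Q: prob_space ?Q by (rule prob_algebraD[OF Q])
    have ki: "integrable ?Q ?k" "integrable ?Q ?k'"
      using km k01 measurable_cong_sets[OF prob_algebraD(2)[OF Q] refl, of borel]
      by (auto intro!: Q.integrable_const_bound[where B=1] AE_I2 simp: prob_algebraD(3)[OF Q])
    have diff: "\<bar>?k x - ?k' x\<bar> \<le> ?s v" if x: "x \<in> space (prod_borel X ?W)" for x
    proof -
      let ?S = "{y \<in> mspace (X v). x(v := y) \<in> S}"
      let ?x = "restrict x (pa E v)"
      have xpa: "?x \<in> space (prod_borel X (pa E v))"
        by (rule measurable_space[OF measurable_restrict_prod[OF v(2,6)] x])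
      have b: "m v ?x \<in> space (prob_algebra (borel_at X v))" "m' v ?x \<in> space (prob_algebra (borel_at X v))"
        using bayes_nets_kernel[OF m v(5) xpa] bayes_nets_kernel[OF m' v(5) xpa] .
      have "?S \<in> sets (borel_at X v)" by (rule section_in_sets[OF v(4) x S])
      then have "\<bar>measure (m v ?x) ?S - measure (m' v ?x) ?S\<bar> \<le> tv_dist (m v ?x) (m' v ?x)"
        by (rule tv_dist_upper[OF b])
      also have "\<dots> \<le> ?s v"
        using bayes_nets_kernel[OF m v(5)] bayes_nets_kernel[OF m' v(5)]
        by (intro cSUP_upper[OF xpa] bdd_aboveI2[where M=1] tv_dist_bounds(2)) auto
      finally show ?thesis
        using measure_extend_kernel[OF k(1) v(4,2) x S] measure_extend_kernel[OF k(2) v(4,2) x S] by simp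
    qed
    have "\<bar>(\<integral>x. ?k x \<partial>?Q) - (\<integral>x. ?k' x \<partial>?Q)\<bar> = \<bar>\<integral>x. ?k x - ?k' x \<partial>?Q\<bar>" using ki by simp
    also have "\<dots> \<le> (\<integral>x. \<bar>?k x - ?k' x\<bar> \<partial>?Q)" by (rule integral_abs_bound)
    also have "\<dots> \<le> (\<integral>x. ?s v \<partial>?Q)"
      using ki diff by (intro integral_mono_AE AE_I2) (auto simp: prob_algebraD(3)[OF Q])
    also have "\<dots> = ?s v" by (simp add: Q.prob_space)
    finally have 1: "\<bar>(\<integral>x. ?k x \<partial>?Q) - (\<integral>x. ?k' x \<partial>?Q)\<bar> \<le> ?s v" .
    have 2: "\<bar>(\<integral>x. ?k x \<partial>?P) - (\<integral>x. ?k x \<partial>?Q)\<bar> \<le> tv_dist ?P ?Q"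
      using k01 by (intro tv_dist_integral[OF P Q km(1)]) auto
    show "\<bar>measure (kernel_product E X m (v # vs)) S - measure (kernel_product E X m' (v # vs)) S\<bar> \<le> tv_dist ?P ?Q + ?s v"
      unfolding kernel_product_Cons measure_bind_prob[OF P e(1) S] measure_bind_prob[OF Q e(2) S] using 1 2 by linarith
  qed
  also have "\<dots> \<le> (\<Sum>v\<in>?W. ?s v) + ?s v" using Cons.IH v by simp
  finally show ?case using v(1) by (simp add: add.commute)
qed

end

section \<open>Extrapolation of conditional independence along a segment\<close>

text \<open>The Bayes formula for a change of the reference measure.\<close>

lemma cond_exp_change_of_measure:
  assumes L: "prob_space L" and P: "prob_space P" and F: "subalgebra L F" and D: "has_density P L D"
    and S: "S \<in> sets L"
  shows "AE x in L. real_cond_exp L F (\<lambda>x. D x * indicator S x) x =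
    real_cond_exp P F (indicator S) x * real_cond_exp L F D x"
proof -
  interpret L: prob_space L by fact
  interpret P: prob_space P by fact
  have s: "sets P = sets L" "space P = space L" using D by (auto simp: has_density_def)
  have FP: "subalgebra P F" using F s by (simp add: subalgebra_def)
  interpret LF: finite_measure_subalgebra L F by unfold_locales (rule F)
  have Dm [measurable]: "D \<in> borel_measurable L" and Di: "integrable L D" using D by (auto simp: has_density_def)
  note [measurable] = S
  let ?f = "real_cond_exp P F (indicator S)"
  have fL [measurable]: "?f \<in> borel_measurable L" by (rule measurable_from_subalg[OF F]) (rule borel_measurable_cond_exp)
  have S': "S \<in> P.events" using S s by simp
  have fD: "integrable L (\<lambda>x. ?f x * D x)"
    using P.integrable_cond_exp_indicator[OF FP S'] has_density_integrable[OF D fL] by (simp add: mult.commute)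
  show ?thesis
  proof (rule LF.real_cond_exp_charact)
    show "integrable L (\<lambda>x. D x * indicator S x)"
      using integrable_mult_indicator[OF S Di] by (simp add: mult.commute)
    show "integrable L (\<lambda>x. ?f x * real_cond_exp L F D x)"
      using fD by (rule LF.real_cond_exp_intg(1)) auto
    fix U assume U: "U \<in> sets F"
    then have [measurable]: "U \<in> sets L" using F by (auto simp: subalgebra_def)
    note [measurable] = U
    have i: "integrable L (\<lambda>x. (indicator U x * ?f x) * D x)"
      using integrable_mult_indicator[OF \<open>U \<in> sets L\<close> fD] by (simp add: mult_ac)
    have "(\<integral>x\<in>U. D x * indicator S x \<partial>L) = measure P (S \<inter> U)"
      using has_density_measure[OF D, of "S \<inter> U"]
      by (simp add: set_lebesgue_integral_def indicator_inter_arith mult_ac)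
    also have "\<dots> = (\<integral>x\<in>U. ?f x \<partial>P)"
      by (rule P.set_integral_real_cond_exp_indicator[OF FP S' U, symmetric])
    also have "\<dots> = (\<integral>x. D x * (indicator U x * ?f x) \<partial>L)"
      unfolding set_lebesgue_integral_def by (subst has_density_integral[OF D]) auto
    also have "\<dots> = (\<integral>x. (indicator U x * ?f x) * D x \<partial>L)" by (simp add: mult_ac)
    also have "\<dots> = (\<integral>x. (indicator U x * ?f x) * real_cond_exp L F D x \<partial>L)"
      by (rule LF.real_cond_exp_intg(2)[OF i, symmetric]) auto
    finally show "(\<integral>x\<in>U. D x * indicator S x \<partial>L) = (\<integral>x\<in>U. ?f x * real_cond_exp L F D x \<partial>L)"
      by (simp add: set_lebesgue_integral_def mult_ac)
  qed auto
qed

lemma AE_subalgebra_density_iff: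
  assumes L: "prob_space L" and F: "subalgebra L F" and D: "has_density P L D"
    and N: "N \<in> sets F"
  shows "(AE x in P. x \<notin> N) \<longleftrightarrow> (AE x in L. x \<in> N \<longrightarrow> real_cond_exp L F D x = 0)"
proof -
  interpret L: prob_space L by fact
  interpret LF: finite_measure_subalgebra L F by unfold_locales (rule F)
  have Dm [measurable]: "D \<in> borel_measurable L" and Di: "integrable L D" and D0: "\<And>x. 0 \<le> D x"
    and P: "P = density L D" using D by (auto simp: has_density_def)
  have NL [measurable]: "N \<in> sets L" using F N by (auto simp: subalgebra_def)
  let ?p = "real_cond_exp L F D"
  have p0: "AE x in L. 0 \<le> ?p x" by (rule LF.real_cond_exp_pos) (auto simp: D0)
  have p: "integrable L ?p" by (rule LF.real_cond_exp_int(1)[OF Di])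
  have eq: "(\<integral>x. D x * indicator N x \<partial>L) = (\<integral>x. ?p x * indicator N x \<partial>L)"
    using LF.real_cond_exp_intA[OF Di N] by (simp add: set_lebesgue_integral_def mult.commute)
  have "(AE x in P. x \<notin> N) \<longleftrightarrow> (AE x in L. 0 < ennreal (D x) \<longrightarrow> x \<notin> N)"
    unfolding P by (rule AE_density) simp
  also have "\<dots> \<longleftrightarrow> (AE x in L. D x * indicator N x = 0)"
    using D0 by (intro AE_cong) (auto simp: indicator_def order.order_iff_strict dest: less_imp_neq)
  also have "\<dots> \<longleftrightarrow> (\<integral>x. D x * indicator N x \<partial>L) = 0"
    using integrable_mult_indicator[OF NL Di] D0
    by (intro integral_nonneg_eq_0_iff_AE[symmetric]) (auto simp: mult.commute)
  also have "\<dots> \<longleftrightarrow> (AE x in L. ?p x * indicator N x = 0)"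
    unfolding eq using integrable_mult_indicator[OF NL p] p0
    by (intro integral_nonneg_eq_0_iff_AE) (auto simp: mult.commute elim!: eventually_mono)
  also have "\<dots> \<longleftrightarrow> (AE x in L. x \<in> N \<longrightarrow> ?p x = 0)"
    by (intro AE_cong) (auto simp: indicator_def)
  finally show ?thesis .
qed

text \<open>Independence under \<open>P\<close> as a polynomial identity between densities with respect to \<open>L\<close>. Cleared of the
denominator \<open>real_cond_exp L F D\<close>, it makes sense wherever \<open>L\<close> lives and is quadratic in \<open>D\<close>.\<close>

lemma cond_exp_prod_density_iff:
  assumes L: "prob_space L" and P: "prob_space P" and F: "subalgebra L F" and D: "has_density P L D"
    and S: "S \<in> sets L" and T: "T \<in> sets L"
  defines "p \<equiv> \<lambda>S. real_cond_exp L F (\<lambda>x. D x * indicator S x)"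
  shows "(AE x in P. real_cond_exp P F (indicator (S \<inter> T)) x =
       real_cond_exp P F (indicator S) x * real_cond_exp P F (indicator T) x) \<longleftrightarrow>
    (AE x in L. p (S \<inter> T) x * real_cond_exp L F D x = p S x * p T x)"
proof -
  let ?f = "\<lambda>S. real_cond_exp P F (indicator S)" and ?q = "real_cond_exp L F D"
  have sp: "space F = space L" "space P = space L" using F D by (auto simp: subalgebra_def has_density_def)
  let ?N = "{x \<in> space F. ?f (S \<inter> T) x \<noteq> ?f S x * ?f T x}"
  have N: "?N \<in> sets F" by measurable
  have "(AE x in P. ?f (S \<inter> T) x = ?f S x * ?f T x) \<longleftrightarrow> (AE x in P. x \<notin> ?N)"
    by (intro AE_cong) (auto simp: sp)
  also have "\<dots> \<longleftrightarrow> (AE x in L. x \<in> ?N \<longrightarrow> ?q x = 0)" by (rule AE_subalgebra_density_iff[OF L F D N])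
  also have "\<dots> \<longleftrightarrow> (AE x in L. p (S \<inter> T) x * ?q x = p S x * p T x)"
  proof -
    have "S \<inter> T \<in> sets L" using S T by auto
    note ae = cond_exp_change_of_measure[OF L P F D this] cond_exp_change_of_measure[OF L P F D S] 
      cond_exp_change_of_measure[OF L P F D T]
    have "AE x in L. (x \<in> ?N \<longrightarrow> ?q x = 0) \<longleftrightarrow> (p (S \<inter> T) x * ?q x = p S x * p T x)"
      using ae AE_space[of L] unfolding p_def
    proof eventually_elim
      case (elim x)
      have "(p (S \<inter> T) x * ?q x = p S x * p T x) \<longleftrightarrow> ?q x * ?q x * (?f (S \<inter> T) x - ?f S x * ?f T x) = 0"
        unfolding p_def elim by (simp add: algebra_simps)
      then show ?case using elim(4) unfolding p_def by (auto simp: sp)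
    qed
    then show ?thesis by (rule eventually_subst)
  qed
  finally show ?thesis .
qed

lemma quadratic_three_zeros:
  fixes a b c :: real
  assumes "a + b * r + c * r\<^sup>2 = 0" "a + b * s + c * s\<^sup>2 = 0" "a + b * t + c * t\<^sup>2 = 0"
    and "r \<noteq> s" "r \<noteq> t" "s \<noteq> t"
  shows "a + b + c = 0"
proof -
  have "(r - s) * (b + c * (r + s)) = 0" "(r - t) * (b + c * (r + t)) = 0"
    using assms(1-3) by (simp_all add: algebra_simps power2_eq_square)
  then have 1: "b + c * (r + s) = 0" "b + c * (r + t) = 0" using assms by auto
  then have "(b + c * (r + s)) - (b + c * (r + t)) = 0" by simp
  then have "c * (s - t) = 0" unfolding right_diff_distrib distrib_left by linarith
  then have "c = 0" using assms by simp
  then show ?thesis using 1 assms(1) by simp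
qed

text \<open>Both sides are quadratic in the parameter, and three parameters determine their difference.\<close>

lemma bilinear_extrapolate:
  fixes e f g h i j k l :: real
  assumes "r \<noteq> s" "r \<noteq> t" "s \<noteq> t"
    and "((1 - r) * e + r * f) * ((1 - r) * g + r * h) = ((1 - r) * i + r * j) * ((1 - r) * k + r * l)"
    and "((1 - s) * e + s * f) * ((1 - s) * g + s * h) = ((1 - s) * i + s * j) * ((1 - s) * k + s * l)"
    and "((1 - t) * e + t * f) * ((1 - t) * g + t * h) = ((1 - t) * i + t * j) * ((1 - t) * k + t * l)"
  shows "f * h = j * l"
proof -
  let ?a = "e * g - i * k" and ?b = "e * (h - g) + (f - e) * g - (i * (l - k) + (j - i) * k)"
    and ?c = "(f - e) * (h - g) - (j - i) * (l - k)"
  have q: "?a + ?b * u + ?c * u\<^sup>2 =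
      ((1 - u) * e + u * f) * ((1 - u) * g + u * h) - ((1 - u) * i + u * j) * ((1 - u) * k + u * l)" for u
    by algebra
  have "?a + ?b + ?c = 0"
    by (rule quadratic_three_zeros[OF _ _ _ assms(1-3)]) (simp_all only: q assms(4-6) diff_self)
  then show ?thesis by algebra
qed

context separable_product
begin

text \<open>The densities of \<open>mixture t P Q\<close> with respect to the midpoint are affine in \<open>t\<close>, and so are their
conditional expectations given \<open>X\<^sub>C\<close>. Hence \<open>cond_exp_prod_density_iff\<close> turns the hypotheses into
instances of \<open>bilinear_extrapolate\<close> at almost every point.\<close>

lemma cond_indep_mixture_extrapolate:
  assumes P: "P \<in> dists" and Q: "Q \<in> dists" and V: "A \<subseteq> V" "B \<subseteq> V" "C \<subseteq> V"
    and ts: "card ts = 3" "ts \<subseteq> {0..1}" and ci: "\<And>t. t \<in> ts \<Longrightarrow> cond_indep X (mixture t P Q) A B C"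
  shows "cond_indep X Q A B C"
  unfolding cond_indep_iff_AE[OF Q V(1,2)]
proof (intro ballI)
  fix S T assume ST: "S \<in> sets (cyl A)" "T \<in> sets (cyl B)"
  let ?M = "prod_borel X V"
  let ?L = "mixture (1/2) P Q"
  have P': "P \<in> space (prob_algebra ?M)" and Q': "Q \<in> space (prob_algebra ?M)"
    using P Q by (auto simp: dists_def)
  have mix: "mixture t P Q \<in> dists" for t
    using mixture_in_prob_algebra[OF P' Q'] by (simp add: dists_def)
  have Ls: "sets ?L = sets ?M" by (rule dists_sets[OF mix])
  note F = dists_subalgebra[OF mix V(3), of "1/2"]
  interpret L: prob_space ?L by (rule dists_prob_space[OF mix])
  interpret LF: finite_measure_subalgebra ?L "cyl C" by unfold_locales (rule F)
  obtain D0 D1 where D0: "has_density P ?L D0" and D1: "has_density Q ?L D1"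
    using mixture_half_density[OF P' Q'] by blast
  have D [measurable]: "D0 \<in> borel_measurable ?L" "D1 \<in> borel_measurable ?L" 
    and Di: "integrable ?L D0" "integrable ?L D1" and Dp: "\<And>x. 0 \<le> D0 x" "\<And>x. 0 \<le> D1 x"
    using D0 D1 by (auto simp: has_density_def)
  have ev: "S \<in> sets ?L" "T \<in> sets ?L"
    using dists_events[OF mix V(1) ST(1)] dists_events[OF mix V(2) ST(2)] by auto
  define D where "D t x = (1 - t) * D0 x + t * D1 x" for t x
  have DI: "integrable ?L (\<lambda>x. D0 x * indicator W x)" "integrable ?L (\<lambda>x. D1 x * indicator W x)"
    if "W \<in> sets ?L" for W
    using integrable_mult_indicator[OF that Di(1)] integrable_mult_indicator[OF that Di(2)] by (auto simp: mult.commute)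
  have dens: "has_density (mixture t P Q) ?L (D t)" if t: "0 \<le> t" "t \<le> 1" for t
  proof (rule has_densityI)
    show "finite_measure (mixture t P Q)" using dists_prob_space[OF mix] by (simp add: prob_space_def)
    fix W assume W: "W \<in> sets ?L"
    then have "measure (mixture t P Q) W = (1 - t) * measure P W + t * measure Q W"
      using measure_mixture[OF P' Q' _ t] by (simp add: Ls)
    also have "\<dots> = (\<integral>x. (1 - t) * (D0 x * indicator W x) + t * (D1 x * indicator W x) \<partial>?L)"
      using DI[OF W] by (simp add: has_density_measure[OF D0 W] has_density_measure[OF D1 W])
    finally show "measure (mixture t P Q) W = (\<integral>x. D t x * indicator W x \<partial>?L)"
      by (simp add: D_def algebra_simps)
  qed (use t Di Dp in \<open>auto simp: D_def[abs_def] dists_sets[OF mix]\<close>)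
  define a where "a W = real_cond_exp ?L (cyl C) (\<lambda>x. D0 x * indicator W x)" for W
  define b where "b W = real_cond_exp ?L (cyl C) (\<lambda>x. D1 x * indicator W x)" for W
  define p where "p t W = real_cond_exp ?L (cyl C) (\<lambda>x. D t x * indicator W x)" for t W
  let ?Om = "space ?L" and ?q = "\<lambda>t W x. (1 - t) * a W x + t * b W x"
  let ?ci = "\<lambda>R. AE x in R. given R C (S \<inter> T) x = given R C S x * given R C T x"
  have lin: "AE x in ?L. p t W x = ?q t W x" if W: "W \<in> sets ?L" for t W
  proof -
    have "AE x in ?L. real_cond_exp ?L (cyl C) (\<lambda>x. (1 - t) * (D0 x * indicator W x) + t * (D1 x * indicator W x)) x
       = real_cond_exp ?L (cyl C) (\<lambda>x. (1 - t) * (D0 x * indicator W x)) x + real_cond_exp ?L (cyl C) (\<lambda>x. t * (D1 x * indicator W x)) x"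
      using DI[OF W] by (intro LF.real_cond_exp_add) auto
    moreover have "AE x in ?L. real_cond_exp ?L (cyl C) (\<lambda>x. (1 - t) * (D0 x * indicator W x)) x = (1 - t) * a W x"
      unfolding a_def using DI[OF W] by (intro LF.real_cond_exp_cmult) auto
    moreover have "AE x in ?L. real_cond_exp ?L (cyl C) (\<lambda>x. t * (D1 x * indicator W x)) x = t * b W x"
      unfolding b_def using DI[OF W] by (intro LF.real_cond_exp_cmult) auto
    ultimately show ?thesis
      unfolding p_def D_def by eventually_elim (simp add: algebra_simps)
  qed
  have one: "AE x in ?L. p t ?Om x = real_cond_exp ?L (cyl C) (D t) x" if "0 \<le> t" "t \<le> 1" for t
    unfolding p_def
  proof (rule LF.real_cond_exp_cong)
    show "AE x in ?L. D t x * indicator ?Om x = D t x" using AE_space by eventually_elim simp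
    show "(\<lambda>x. D t x * indicator ?Om x) \<in> borel_measurable ?L" "D t \<in> borel_measurable ?L"
      unfolding D_def by measurable
  qed
  have iff: "?ci (mixture t P Q) \<longleftrightarrow> (AE x in ?L. ?q t (S \<inter> T) x * ?q t ?Om x = ?q t S x * ?q t T x)" if t: "0 \<le> t" "t \<le> 1" for t
  proof -
    have "AE x in ?L. (p t (S \<inter> T) x * real_cond_exp ?L (cyl C) (D t) x = p t S x * p t T x) \<longleftrightarrow>
      ?q t (S \<inter> T) x * ?q t ?Om x = ?q t S x * ?q t T x"
      using one[OF t] lin[OF ev(1), of t] lin[OF ev(2), of t] lin[OF sets.Int[OF ev], of t] lin[OF sets.top, of t]
      by eventually_elim simp
    then show ?thesis
      unfolding cond_exp_prod_density_iff[OF L.prob_space_axioms dists_prob_space[OF mix] F dens[OF t] ev, folded p_def]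
      by (rule eventually_subst)
  qed
  obtain r s t where rst: "ts = {r, s, t}" "r \<noteq> s" "r \<noteq> t" "s \<noteq> t" using ts(1) by (auto simp: card_3_iff)
  have zero: "AE x in ?L. ?q t (S \<inter> T) x * ?q t ?Om x = ?q t S x * ?q t T x" if "t \<in> ts" for t
  proof -
    have "0 \<le> t" "t \<le> 1" using that ts(2) by auto
    moreover have "?ci (mixture t P Q)"
      using ci[OF that] ST unfolding cond_indep_iff_AE[OF mix V(1,2)] by blast
    ultimately show ?thesis using iff by blast
  qed
  have "r \<in> ts" "s \<in> ts" "t \<in> ts" using rst by auto
  note rst_in = zero[OF this(1)] zero[OF this(2)] zero[OF this(3)]
  have m1: "mixture 1 P Q = Q"
    using measure_mixture[OF P' Q', of _ 1] by (intro prob_algebra_eqI[OF mixture_in_prob_algebra[OF P' Q'] Q']) auto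
  have "AE x in ?L. b (S \<inter> T) x * b ?Om x = b S x * b T x"
    using rst_in by eventually_elim (rule bilinear_extrapolate[OF rst(2-4)])
  then show "?ci Q"
    using iff[of 1] unfolding m1 by simp
qed

lemma kernel_product_cong:
  assumes "\<And>v. v \<in> set vs \<Longrightarrow> m v = m' v"
  shows "kernel_product E X m vs = kernel_product E X m' vs"
  using assms by (induction vs) auto

text \<open>Before \<open>v\<close> is sampled the three products agree; at \<open>v\<close> the mixture enters; later kernels are linear.\<close>

lemma kernel_product_mixture:
  assumes m: "m \<in> kernels E" and q: "q \<in> measurable (prod_borel X (pa E v)) (prob_algebra (borel_at X v))"
    and "build_order E vs" "set vs \<subseteq> V" "v \<in> set vs" and t: "0 \<le> t" "t \<le> 1"
    and mt: "mt = m(v := \<lambda>x\<in>space (prod_borel X (pa E v)). mixture t (m v x) (q x))"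
  shows "kernel_product E X mt vs = mixture t (kernel_product E X m vs) (kernel_product E X (m(v := q)) vs)"
proof -
  let ?q = "m(v := q)"
  have mv: "m v \<in> measurable (prod_borel X (pa E v)) (prob_algebra (borel_at X v))" if "v \<in> V"
    using m that by (auto simp: kernels_def)
  have k: "?q \<in> kernels E" "mt \<in> kernels E" if "v \<in> V"
    using m q measurable_mixture[OF mv[OF that] q, of t] unfolding mt
    by (auto simp: kernels_def cong: measurable_cong)
  show ?thesis
    using assms(3-5)
  proof (induction vs)
    case (Cons u vs)
    let ?W = "set vs"
    have vV: "v \<in> V" using Cons.prems by auto
    have u: "u \<notin> ?W" "pa E u \<subseteq> ?W" "build_order E vs" "insert u ?W \<subseteq> V" "u \<in> V" "?W \<subseteq> V" using Cons.prems by auto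
    have ker: "n \<in> {m, ?q, mt} \<Longrightarrow> n \<in> kernels E" for n using m k[OF vV] by auto
    have A: "kernel_product E X n vs \<in> space (prob_algebra (prod_borel X ?W))"
      "extend_kernel E n u ?W \<in> measurable (prod_borel X ?W) (prob_algebra (prod_borel X (insert u ?W)))"
      "kernel_product E X n (u # vs) \<in> space (prob_algebra (prod_borel X (insert u ?W)))" if "n \<in> {m, ?q, mt}" for n
      using kernel_product_prob[OF ker[OF that] u(3,6)] measurable_extend_kernel[OF ker[OF that] u(4,2)] 
        kernel_product_prob[OF ker[OF that], of "u # vs"] Cons.prems by auto
    show ?case
    proof (rule prob_algebra_eqI[OF A(3) mixture_in_prob_algebra[OF A(3) A(3)]])
      fix S assume S: "S \<in> sets (prod_borel X (insert u ?W))"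
      let ?m = "\<lambda>n. measure (kernel_product E X n (u # vs)) S"
      have "?m mt = (1 - t) * ?m m + t * ?m ?q"
      proof (cases "u = v")
        case False
        then have "kernel_product E X mt vs = mixture t (kernel_product E X m vs) (kernel_product E X ?q vs)"
          using Cons.prems(3) by (intro Cons.IH[OF u(3,6)]) simp
        moreover have "extend_kernel E mt u ?W = extend_kernel E m u ?W" "extend_kernel E ?q u ?W = extend_kernel E m u ?W"
          using False by (auto simp: extend_kernel_def[abs_def] mt)
        ultimately show ?thesis
          using measure_bind_mixture[OF A(1)[of m] A(1)[of ?q] A(2)[of m] S t] unfolding kernel_product_Cons by simp
      next
        case True
        have eq: "kernel_product E X mt vs = kernel_product E X m vs" "kernel_product E X ?q vs = kernel_product E X m vs"
          using u(1) True by (intro kernel_product_cong; auto simp: mt)+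
        let ?P = "kernel_product E X m vs" and ?k = "\<lambda>n x. measure (extend_kernel E n u ?W x) S"
        have P: "?P \<in> space (prob_algebra (prod_borel X ?W))" using A(1)[of m] by simp
        interpret P: prob_space ?P by (rule prob_algebraD[OF P])
        have bind: "?m n = (\<integral>x. ?k n x \<partial>?P)" if "n \<in> {m, ?q, mt}" for n
          using measure_bind_prob[OF P A(2)[OF that] S] eq that unfolding kernel_product_Cons by auto
        have int: "integrable ?P (?k n)" if "n \<in> {m, ?q, mt}" for n
        proof (rule P.integrable_const_bound[where B=1])
          show "?k n \<in> borel_measurable ?P"
            using measurable_compose[OF kernel_measurable[OF P A(2)[OF that]] measurable_measure_subprob_algebra[OF S]] .
          show "AE x in ?P. norm (?k n x) \<le> 1"
            using prob_space.prob_le_1[OF prob_algebraD(1)[OF measurable_space[OF A(2)[OF that]]]]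
            by (intro AE_I2) (simp add: prob_algebraD(3)[OF P])
        qed
        have "?k mt x = (1 - t) * ?k m x + t * ?k ?q x" if "x \<in> space ?P" for x
        proof -
          have x: "x \<in> space (prod_borel X ?W)" using that prob_algebraD(3)[OF P] by simp
          let ?S = "{y \<in> mspace (X u). x(u := y) \<in> S}"
          let ?x = "restrict x (pa E u)"
          have xpa: "?x \<in> space (prod_borel X (pa E u))"
            by (rule measurable_space[OF measurable_restrict_prod[OF u(2,6)] x])
          have "?S \<in> sets (borel_at X u)" by (rule section_in_sets[OF u(4) x S])
          then show ?thesis
            using measure_extend_kernel[OF ker u(4,2) x S] True xpa
              measure_mixture[OF measurable_space[OF mv[OF vV]] measurable_space[OF q] _ t]
            by (simp add: mt)
        qed
        then have "(\<integral>x. ?k mt x \<partial>?P) = (\<integral>x. (1 - t) * ?k m x + t * ?k ?q x \<partial>?P)"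
          by (intro Bochner_Integration.integral_cong) auto
        also have "\<dots> = (1 - t) * (\<integral>x. ?k m x \<partial>?P) + t * (\<integral>x. ?k ?q x \<partial>?P)"
          using int[of m] int[of ?q] by (subst Bochner_Integration.integral_add) auto
        finally show ?thesis using bind[of mt] bind[of m] bind[of ?q] by (simp only: insertI1 insertI2 simp_thms)
      qed
      then show "?m mt = measure (mixture t (kernel_product E X m (u # vs)) (kernel_product E X ?q (u # vs))) S"
        using measure_mixture[OF A(3)[of m] A(3)[of ?q] S t] by simp
    qed (simp_all only: insert_iff simp_thms)
  qed simp
qed

end

section \<open>The logic of a network that transmits along an active path\<close>

lemma colliders_iff:
  "colliders E p = {p ! i | i. collider_at E p i}"
proof (induction E p rule: colliders.induct)
  case (1 E x y z r)
  show ?case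
  proof (intro set_eqI iffI)
    fix v assume "v \<in> colliders E (x # y # z # r)"
    then consider "v = y" "(x, y) \<in> E" "(z, y) \<in> E" | "v \<in> colliders E (y # z # r)"
      by (auto split: if_splits)
    then show "v \<in> {(x # y # z # r) ! i | i. collider_at E (x # y # z # r) i}"
    proof cases
      case 1
      then show ?thesis by (intro CollectI exI[of _ 1]) (auto simp: collider_at_def)
    next
      case 2
      then obtain i where "v = (y # z # r) ! i" "collider_at E (y # z # r) i" using 1 by auto
      then show ?thesis by (intro CollectI exI[of _ "Suc i"]) (auto simp: collider_at_def nth_Cons')
    qed
  next
    fix v assume "v \<in> {(x # y # z # r) ! i | i. collider_at E (x # y # z # r) i}"
    then obtain i where i: "v = (x # y # z # r) ! i" "collider_at E (x # y # z # r) i" by auto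
    then obtain j where j: "i = Suc j" by (cases i) (auto simp: collider_at_def)
    show "v \<in> colliders E (x # y # z # r)"
    proof (cases j)
      case 0
      then show ?thesis using i j by (auto simp: collider_at_def)
    next
      case (Suc k)
      then have "collider_at E (y # z # r) j" "v = (y # z # r) ! j" using i j by (auto simp: collider_at_def)
      then show ?thesis using 1 by auto
    qed
  qed
qed (auto simp: collider_at_def less_Suc_eq)

text \<open>Only which assignments are possible matters for the violating network, not their probabilities. The
locale describes assignments of on and off to the vertices by their sets of vertices that are on.\<close>

locale clean_path =
  fixes E :: "('v \<times> 'v) set" and C :: "'v set" and p :: "'v list"
  assumes acyc: "acyclic E" and dist: "distinct p" and act: "active E C p"
    and tails: "colliders E p \<subseteq> ancestors (E \<inter> (UNIV \<times> - set p)) C"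
begin

definition "transmitters = set p - colliders E p"

definition "next_on x y \<longleftrightarrow> (\<exists>i. Suc i < length p \<and> x = p ! i \<and> y = p ! Suc i)"

text \<open>\<open>F\<close> is the set of parents of \<open>v\<close> that are on. A non-collider of the path copies an \<open>on\<close> of its
predecessor if that is a parent. A collider raises an alarm if its predecessor is on and its successor is
off. A vertex off the path passes on alarms, but ignores parents that are non-colliders of the path.\<close>

definition forced_on :: "'v \<Rightarrow> 'v set \<Rightarrow> bool" where
  "forced_on v F \<longleftrightarrow>
     v \<in> transmitters \<and> (\<exists>u\<in>F. next_on u v) \<or>
     v \<in> colliders E p \<and> (\<exists>u\<in>F. \<exists>w. w \<notin> F \<and> next_on u v \<and> next_on v w) \<or>
     v \<notin> set p \<and> (\<exists>u\<in>F. u \<notin> transmitters)"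

text \<open>If the path traverses the arrow from \<open>w\<close> to \<open>v\<close> backwards, an \<open>on\<close> of \<open>v\<close> has to be passed on to
the parent \<open>w\<close>. This is achieved by switching \<open>v\<close> off whenever \<open>w\<close> is off.\<close>

definition forced_off :: "'v \<Rightarrow> 'v set \<Rightarrow> bool" where
  "forced_off v F \<longleftrightarrow> v \<in> transmitters \<and> (\<exists>w\<in>pa E v. w \<notin> F \<and> next_on v w)"

definition permitted :: "'v \<Rightarrow> 'v set \<Rightarrow> bool \<Rightarrow> bool" where
  "permitted v F b \<longleftrightarrow> (forced_on v F \<longrightarrow> b) \<and> (forced_off v F \<and> \<not> forced_on v F \<longrightarrow> \<not> b)"

definition consistent :: "'v set \<Rightarrow> bool" where
  "consistent H \<longleftrightarrow> (\<forall>v. permitted v (pa E v \<inter> H) (v \<in> H))"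

lemma adjacent: "next_on x y \<Longrightarrow> (x, y) \<in> E \<or> (y, x) \<in> E"
  using act unfolding active_def open_walk_nth next_on_def by auto

lemma next_on_set: "next_on x y \<Longrightarrow> x \<in> set p \<and> y \<in> set p"
  unfolding next_on_def by auto

lemma next_onI: "Suc i < length p \<Longrightarrow> next_on (p ! i) (p ! Suc i)"
  unfolding next_on_def by blast

lemma collider_next_on:
  "v \<in> colliders E p \<longleftrightarrow> (\<exists>u w. next_on u v \<and> next_on v w \<and> (u, v) \<in> E \<and> (w, v) \<in> E)"
proof
  assume "v \<in> colliders E p"
  then obtain i where i: "v = p ! i" "collider_at E p i" unfolding colliders_iff by auto
  then obtain j where j: "i = Suc j" by (cases i) (auto simp: collider_at_def)
  have "next_on (p ! j) v" "next_on v (p ! Suc i)" "(p ! j, v) \<in> E" "(p ! Suc i, v) \<in> E"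
    using i j next_onI[of j] next_onI[of i] by (auto simp: collider_at_def)
  then show "\<exists>u w. next_on u v \<and> next_on v w \<and> (u, v) \<in> E \<and> (w, v) \<in> E" by blast
next
  assume "\<exists>u w. next_on u v \<and> next_on v w \<and> (u, v) \<in> E \<and> (w, v) \<in> E"
  then obtain u w where uw: "(u, v) \<in> E" "(w, v) \<in> E" "next_on u v" "next_on v w" by auto
  obtain i where i: "Suc i < length p" "u = p ! i" "v = p ! Suc i"
    using uw(3) unfolding next_on_def by blast
  obtain j where j: "Suc j < length p" "v = p ! j" "w = p ! Suc j"
    using uw(4) unfolding next_on_def by blast
  have "j = Suc i" using nth_eq_iff_index_eq[OF dist, of j "Suc i"] i j by auto
  then show "v \<in> colliders E p"
    unfolding colliders_iff using uw i j by (intro CollectI exI[of _ "Suc i"]) (auto simp: collider_at_def)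
qed

lemma next_on_unique: "next_on x y \<Longrightarrow> next_on x z \<Longrightarrow> y = z" "next_on y x \<Longrightarrow> next_on z x \<Longrightarrow> y = z"
  using dist unfolding next_on_def by (auto simp: nth_eq_iff_index_eq)

lemma collider_parents:
  assumes "v \<in> colliders E p"
  shows "next_on u v \<Longrightarrow> (u, v) \<in> E \<and> u \<in> transmitters" "next_on v w \<Longrightarrow> (w, v) \<in> E \<and> w \<in> transmitters"
proof -
  obtain u' w' where uw: "next_on u' v" "next_on v w'" "(u', v) \<in> E" "(w', v) \<in> E"
    using assms collider_next_on by auto
  {
    assume "next_on u v"
    then have "u = u'" using uw next_on_unique by blast
    moreover have "u' \<notin> colliders E p"
    proof
      assume "u' \<in> colliders E p"
      then obtain w'' where "next_on u' w''" "(w'', u') \<in> E" using collider_next_on by auto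
      then have "(v, u') \<in> E" using uw next_on_unique by blast
      then show False using uw acyclic_asym[OF acyc] by blast
    qed
    ultimately show "(u, v) \<in> E \<and> u \<in> transmitters" using uw next_on_set by (auto simp: transmitters_def)
  }
  {
    assume "next_on v w"
    then have "w = w'" using uw next_on_unique by blast
    moreover have "w' \<notin> colliders E p"
    proof
      assume "w' \<in> colliders E p"
      then obtain u'' where "next_on u'' w'" "(u'', w') \<in> E" using collider_next_on by auto
      then have "(v, w') \<in> E" using uw next_on_unique by blast
      then show False using uw acyclic_asym[OF acyc] by blast
    qed
    ultimately show "(w, v) \<in> E \<and> w \<in> transmitters" using uw next_on_set by (auto simp: transmitters_def)
  }
qed

lemma transmitters_disjoint: "transmitters \<inter> C = {}"
proof -
  have "p ! i \<in> colliders E p \<or> p ! i \<notin> C" if i: "i < length p" for i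
  proof -
    have "open_walk E C p" "hd p \<notin> C" "last p \<notin> C" "p \<noteq> []" using act by (auto simp: active_def)
    consider "i = 0" | "i = length p - 1" | j where "i = Suc j" "Suc (Suc j) < length p"
      using i by (cases i) force+
    then show ?thesis
    proof cases
      case 3
      then have "open_at E C (p ! j) (p ! i) (p ! Suc i)"
        using \<open>open_walk E C p\<close> unfolding open_walk_nth by auto
      moreover have "collider_at E p i" if "(p ! j, p ! i) \<in> E" "(p ! Suc i, p ! i) \<in> E"
        using 3 that by (auto simp: collider_at_def)
      ultimately show ?thesis unfolding colliders_iff by (auto simp: open_at_def split: if_splits)
    qed (use \<open>hd p \<notin> C\<close> \<open>last p \<notin> C\<close> \<open>p \<noteq> []\<close> in \<open>auto simp: hd_conv_nth last_conv_nth\<close>)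
  qed
  then have "v \<in> colliders E p \<or> v \<notin> C" if "v \<in> set p" for v
    using that by (metis in_set_conv_nth)
  then show ?thesis by (auto simp: transmitters_def)
qed

lemma ends_transmit: "hd p \<in> transmitters" "last p \<in> transmitters"
proof -
  have ne: "p \<noteq> []" using act by (auto simp: active_def)
  have hd: "hd q \<notin> colliders E q" if "q \<noteq> []" "distinct q" for q
    using colliders_Cons_subset[of E "hd q" "tl q"] that
    by (metis distinct.simps(2) list.collapse subsetD)
  have "hd p \<notin> colliders E p" using hd[of p] ne dist by simp
  moreover have "last p \<notin> colliders E p"
    using hd[of "rev p"] ne dist by (simp add: colliders_rev hd_rev)
  ultimately show "hd p \<in> transmitters" "last p \<in> transmitters" using ne by (auto simp: transmitters_def)
qed

lemma consistent_empty: "consistent {}"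
  by (auto simp: consistent_def permitted_def forced_on_def)

lemma consistent_transmitters: "consistent transmitters"
  unfolding consistent_def permitted_def
proof (intro allI conjI impI)
  fix v
  assume "forced_on v (pa E v \<inter> transmitters)"
  then show "v \<in> transmitters"
    unfolding forced_on_def using collider_parents[of v] by (auto simp: pa_def)
next
  fix v
  assume "forced_off v (pa E v \<inter> transmitters) \<and> \<not> forced_on v (pa E v \<inter> transmitters)"
  then obtain w where w: "(w, v) \<in> E" "w \<notin> transmitters" "next_on v w" 
    by (auto simp: forced_off_def pa_def)
  then have "w \<in> colliders E p" using next_on_set by (auto simp: transmitters_def)
  then have "(v, w) \<in> E" using collider_parents w by blast
  then show "v \<notin> transmitters" using w acyclic_asym[OF acyc] by blast
qed

text \<open>If all of \<open>C\<close> is off, no alarm was raised: the alarm of a collider would spread along its clean tail into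
\<open>C\<close>. So the message never breaks at a collider, and it passes every other edge of the path by
construction.\<close>

lemma consistent_propagates:
  assumes con: "consistent H" and C: "H \<inter> C = {}" and a: "hd p \<in> H"
  shows "last p \<in> H"
proof -
  have col: "v \<notin> H" if vc: "v \<in> colliders E p" for v
  proof
    assume v: "v \<in> H"
    obtain c where c: "c \<in> C" "(v, c) \<in> (E \<inter> (UNIV \<times> - set p))\<^sup>*"
      using subsetD[OF tails vc] unfolding ancestors_def by blast
    have "c \<in> H \<and> c \<notin> transmitters" using c(2)
    proof (induction rule: rtrancl_induct)
      case base
      then show ?case using v vc by (auto simp: transmitters_def)
    next
      case (step y z)
      then have "forced_on z (pa E z \<inter> H)" by (auto simp: forced_on_def pa_def)
      then show ?case using step con by (auto simp: consistent_def permitted_def transmitters_def)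
    qed
    then show False using c C by auto
  qed
  have ne: "p \<noteq> []" using act by (auto simp: active_def)
  have "p ! i \<in> transmitters \<longrightarrow> p ! i \<in> H" if "i < length p" for i
    using that
  proof (induction i rule: less_induct)
    case (less i)
    show ?case
    proof
      assume t: "p ! i \<in> transmitters"
      show "p ! i \<in> H"
      proof (cases i)
        case 0
        then show ?thesis using a ne by (simp add: hd_conv_nth)
      next
        case (Suc j)
        let ?x = "p ! j" and ?y = "p ! i"
        have n: "next_on ?x ?y" using Suc less.prems by (auto simp: next_on_def)
        show ?thesis
        proof (cases "?x \<in> colliders E p")
          case False
          then have x: "?x \<in> transmitters" using Suc less.prems by (auto simp: transmitters_def)
          then have xH: "?x \<in> H" using less.IH[of j] Suc less.prems by auto
          show ?thesis
          proof (cases "(?x, ?y) \<in> E")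
            case True
            then have "forced_on ?y (pa E ?y \<inter> H)" using t n xH by (auto simp: forced_on_def pa_def)
            then show ?thesis using con by (auto simp: consistent_def permitted_def)
          next
            case False
            then have e: "(?y, ?x) \<in> E" using adjacent[OF n] by auto
            show ?thesis
            proof (rule ccontr)
              assume "?y \<notin> H"
              then have off: "forced_off ?x (pa E ?x \<inter> H)" using x e n by (auto simp: forced_off_def pa_def)
              have "\<not> forced_on ?x (pa E ?x \<inter> H)"
              proof
                assume "forced_on ?x (pa E ?x \<inter> H)"
                then obtain u where "(u, ?x) \<in> E" "next_on u ?x"
                  using x by (auto simp: forced_on_def transmitters_def pa_def)
                then have "?x \<in> colliders E p" using e n collider_next_on by auto
                then show False using x by (simp add: transmitters_def)
              qed
              then show False using off con xH by (auto simp: consistent_def permitted_def)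
            qed
          qed
        next
          case True
          then obtain u where u: "next_on u ?x" using collider_next_on by auto
          then obtain k where k: "Suc k < length p" "u = p ! k" "?x = p ! Suc k" unfolding next_on_def by auto
          have "Suc k = j" using k Suc less.prems nth_eq_iff_index_eq[OF dist, of "Suc k" j] by auto
          have ue: "(u, ?x) \<in> E" "u \<in> transmitters" and ye: "(?y, ?x) \<in> E"
            using collider_parents[OF True] u n by auto
          have "k < i" "k < length p" using k(1) Suc \<open>Suc k = j\<close> by auto
          from less.IH[OF this] have "u \<in> H" using ue(2) k(2) by simp
          show ?thesis
          proof (rule ccontr)
            assume "?y \<notin> H"
            then have "forced_on ?x (pa E ?x \<inter> H)"
              using True \<open>u \<in> H\<close> u n ue by (auto simp: forced_on_def pa_def)
            then show False using con col[OF True] by (auto simp: consistent_def permitted_def)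
          qed
        qed
      qed
    qed
  qed
  from this[of "length p - 1"] show ?thesis
    using ends_transmit ne by (simp add: last_conv_nth)
qed

end

section \<open>A two-valued network for an active path\<close>

lemma singleton_in_borel_at:
  assumes "y \<in> mspace (X v)"
  shows "{y} \<in> sets (borel_at X v)"
proof -
  interpret Metric_space "mspace (X v)" "mdist (X v)" by (rule Metric_space_mspace_mdist)
  have "closedin (mtopology_of (X v)) {y}"
    unfolding mtopology_of_def using assms by (intro closedin_Hausdorff_singleton Hausdorff_space_mtopology) auto
  then have "openin (mtopology_of (X v)) (mspace (X v) - {y})"
    unfolding closedin_def by simp
  then have "space (borel_at X v) - (mspace (X v) - {y}) \<in> sets (borel_at X v)"
    by (intro sets.compl_sets open_in_borel_at)
  moreover have "space (borel_at X v) - (mspace (X v) - {y}) = {y}" using assms by (auto simp: space_borel_at)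
  ultimately show ?thesis by simp
qed

context separable_product
begin

text \<open>On an event that fixes \<open>X\<^sub>C\<close> the conditional probability of \<open>S\<close> is constant, so independence would
multiply the two positive probabilities.\<close>

lemma not_cond_indep_on_atom:
  assumes P: "P \<in> dists" and V: "A \<subseteq> V" "B \<subseteq> V" "C \<subseteq> V"
    and S: "S \<in> sets (cyl A)" and T: "T \<in> sets (cyl B)" and U: "U \<in> sets (cyl C)"
    and atom: "\<And>x y. x \<in> U \<Longrightarrow> y \<in> U \<Longrightarrow> restrict x C = restrict y C"
    and pos: "0 < measure P (S \<inter> U)" "0 < measure P (T \<inter> U)" and zero: "measure P (S \<inter> (T \<inter> U)) = 0"
  shows "\<not> cond_indep X P A B C"
proof
  assume ci: "cond_indep X P A B C"
  interpret prob_space P by (rule dists_prob_space[OF P])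
  let ?f = "given P C S"
  have UOm: "U \<subseteq> Om" using sets.sets_into_space[OF U] by simp
  have "U \<noteq> {}" using pos(1) by auto
  then obtain z where z: "z \<in> U" by auto
  have const: "?f x = ?f z" if x: "x \<in> U" for x
  proof -
    have "?f -` {?f z} \<inter> space (cyl C) \<in> sets (cyl C)"
      by (rule measurable_sets[OF borel_measurable_cond_exp]) simp
    then obtain W where W: "?f -` {?f z} \<inter> Om = (\<lambda>x. restrict x C) -` W \<inter> Om"
      using sets_cyl[OF V(3)] by auto
    have "z \<in> ?f -` {?f z} \<inter> Om" using z UOm by auto
    then have "restrict z C \<in> W" unfolding W by auto
    then have "x \<in> (\<lambda>x. restrict x C) -` W \<inter> Om" using atom[OF x z] x UOm by auto
    then show ?thesis unfolding W[symmetric] by auto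
  qed
  have int: "(\<integral>x\<in>W. ?f x \<partial>P) = ?f z * prob W" if "W \<in> events" "W \<subseteq> U" for W
  proof -
    have "(\<integral>x\<in>W. ?f x \<partial>P) = (\<integral>x. ?f z * indicator W x \<partial>P)"
      unfolding set_lebesgue_integral_def using const that(2)
      by (intro Bochner_Integration.integral_cong) (auto simp: indicator_def)
    then show ?thesis using sets.sets_into_space[OF that(1)] by (simp add: Int_absorb2)
  qed
  have ev: "S \<in> events" "T \<in> events" "U \<in> events" using dists_events[OF P] V S T U by auto
  have "prob (S \<inter> U) = ?f z * prob U"
    using set_integral_real_cond_exp_indicator[OF dists_subalgebra[OF P V(3)] ev(1) U] int[OF ev(3)] by simp
  then have "?f z \<noteq> 0" using pos by auto
  moreover have "prob (S \<inter> (T \<inter> U)) = ?f z * prob (T \<inter> U)"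
    using ci S T U int[of "T \<inter> U"] ev unfolding cond_indep_iff[OF P V] by auto
  ultimately show False using pos zero by simp
qed

lemma singleton_in_prod_borel:
  assumes "W \<subseteq> V" "z \<in> space (prod_borel X W)"
  shows "{z} \<in> sets (prod_borel X W)"
proof -
  have "{z} = Pi\<^sub>E W (\<lambda>v. {z v})"
    using assms(2) by (subst PiE_singleton) (auto simp: space_prod_borel PiE_iff)
  also have "\<dots> \<in> boxes X W"
    using assms(2) by (auto simp: boxes_def space_prod_borel PiE_iff intro!: exI[of _ "\<lambda>v. {z v}"] singleton_in_borel_at)
  finally show ?thesis using boxes_in_prod_borel[OF finite_subset[OF assms(1) finV]] by auto
qed

text \<open>The probability of a point is the product of the probabilities of its coordinates given the previous
ones.\<close>

lemma kernel_product_point_pos: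
  assumes m: "m \<in> kernels E" and z: "z \<in> Om"
    and pos: "\<And>v. v \<in> V \<Longrightarrow> 0 < measure (m v (restrict z (pa E v))) {z v}"
    and "build_order E vs" "set vs \<subseteq> V"
  shows "0 < measure (kernel_product E X m vs) {restrict z (set vs)}"
  using assms(4,5)
proof (induction vs)
  case Nil
  have "measure (return (prod_borel X {}) (\<lambda>_. undefined)) {\<lambda>_. undefined :: 'a} = 1"
    using singleton_in_prod_borel[of "{}" "\<lambda>_. undefined"] by (subst measure_return) (auto simp: space_prod_borel)
  then show ?case by (simp add: restrict_def)
next
  case (Cons v vs)
  let ?W = "set vs"
  let ?Q = "kernel_product E X m vs" and ?z = "restrict z ?W" and ?z' = "restrict z (insert v ?W)"
  let ?c = "measure (m v (restrict z (pa E v))) {z v}"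
  have v: "v \<notin> ?W" "pa E v \<subseteq> ?W" "build_order E vs" "insert v ?W \<subseteq> V" "v \<in> V" "?W \<subseteq> V" using Cons.prems by auto
  have Q: "?Q \<in> space (prob_algebra (prod_borel X ?W))" using kernel_product_prob[OF m v(3,6)] .
  interpret Q: prob_space ?Q by (rule prob_algebraD[OF Q])
  have zs: "{?z'} \<in> sets (prod_borel X (insert v ?W))" "{?z} \<in> sets (prod_borel X ?W)"
    using singleton_in_prod_borel[OF v(4) restrict_Om[OF v(4) z]] singleton_in_prod_borel[OF v(6) restrict_Om[OF v(6) z]] .
  have "measure (kernel_product E X m (v # vs)) {?z'} =
      (\<integral>x. measure (m v (restrict x (pa E v))) {y \<in> mspace (X v). x(v := y) \<in> {?z'}} \<partial>?Q)"
    by (rule measure_kernel_product_Cons[OF m Cons.prems zs(1)])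
  also have "\<dots> = (\<integral>x. ?c * indicator {?z} x \<partial>?Q)"
  proof (intro Bochner_Integration.integral_cong refl)
    fix x assume "x \<in> space ?Q"
    then have x: "x \<in> extensional ?W" using prob_algebraD(3)[OF Q] by (auto simp: space_prod_borel PiE_iff)
    have up: "x(v := y) = ?z' \<longleftrightarrow> x = ?z \<and> y = z v" for y
    proof
      assume eq: "x(v := y) = ?z'"
      have "x w = ?z w" for w
        using fun_cong[OF eq, of w] x v(1) by (cases "w = v"; cases "w \<in> ?W") (auto simp: extensional_def)
      moreover have "y = z v" using fun_cong[OF eq, of v] by simp
      ultimately show "x = ?z \<and> y = z v" by auto
    next
      assume "x = ?z \<and> y = z v"
      then show "x(v := y) = ?z'" by (auto simp: fun_eq_iff)
    qed
    show "measure (m v (restrict x (pa E v))) {y \<in> mspace (X v). x(v := y) \<in> {?z'}} = ?c * indicator {?z} x"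
    proof (cases "x = ?z")
      case True
      have "{y \<in> mspace (X v). x(v := y) \<in> {?z'}} = {z v}" using True up z v(5) by auto
      moreover have "restrict x (pa E v) = restrict z (pa E v)" 
        using v(2) by (auto simp: True restrict_def fun_eq_iff)
      ultimately show ?thesis using True by simp
    next
      case False
      then have "{y \<in> mspace (X v). x(v := y) \<in> {?z'}} = {}" using up by auto
      then show ?thesis using False by (simp only: measure_empty) simp
    qed
  qed
  also have "\<dots> = ?c * measure ?Q {?z}"
  proof -
    have "{?z} \<subseteq> space ?Q" using sets.sets_into_space[OF zs(2)] prob_algebraD(3)[OF Q] by blast
    then show ?thesis by (simp add: Int_absorb2)
  qed
  finally show ?case using pos[OF v(5)] Cons.IH[OF v(3,6)] by (simp only: list.set mult_pos_pos)
qed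

lemma kernel_product_null:
  assumes m: "m \<in> kernels E" and o: "build_order E vs" and V: "set vs = V" and v: "v \<in> V"
    and S: "S \<in> sets (borel_at X v)" and U: "U \<in> sets (cyl (pa E v))"
    and null: "\<And>x. x \<in> U \<Longrightarrow> measure (m v (restrict x (pa E v))) S = 0"
  shows "measure (kernel_product E X m vs) ({x \<in> Om. x v \<in> S} \<inter> U) = 0"
proof -
  obtain us ws where vs: "vs = us @ v # ws" using v V by (metis split_list)
  have "pa E v \<subseteq> set ws" "set ws \<subseteq> V"
    using build_order_append[of E us "v # ws"] o V vs by auto
  then have "U \<in> sets (cyl (set ws))" using cyl_mono[of "pa E v" "set ws"] U by blast
  then have "measure (kernel_product E X m vs) ({x \<in> Om. x v \<in> S} \<inter> U) =
      (\<integral>x\<in>U. measure (m v (restrict x (pa E v))) S \<partial>kernel_product E X m vs)"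
    using kernel_product_disintegration[OF m _ _ S] o V vs by auto
  also have "\<dots> = (\<integral>x. 0 \<partial>kernel_product E X m vs)"
    unfolding set_lebesgue_integral_def using null
    by (intro Bochner_Integration.integral_cong) (auto simp: indicator_def)
  finally show ?thesis by simp
qed

end

text \<open>The vertex \<open>v\<close> is on when its coordinate is \<open>hi v\<close>. Each kernel charges only \<open>lo v\<close> and \<open>hi v\<close>, but it
has to be defined for all values of the parents; every value other than \<open>hi\<close> is read as off.\<close>

locale binary_network = separable_product X V + clean_path E C p
  for X :: "'v \<Rightarrow> 'a metric" and V and E :: "('v \<times> 'v) set" and C p +
  fixes lo hi :: "'v \<Rightarrow> 'a"
  assumes EV: "E \<subseteq> V \<times> V" and pV: "set p \<subseteq> V" and CV: "C \<subseteq> V"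
    and lohi: "\<And>v. v \<in> V \<Longrightarrow> lo v \<in> mspace (X v) \<and> hi v \<in> mspace (X v) \<and> lo v \<noteq> hi v"
begin

definition on_set :: "'v set \<Rightarrow> ('v \<Rightarrow> 'a) \<Rightarrow> 'v set" where
  "on_set W x = {u \<in> W. x u = hi u}"

definition choice :: "'v \<Rightarrow> 'v set \<Rightarrow> 'a measure" where
  "choice v F =
     (if forced_on v F then return (borel_at X v) (hi v)
      else if forced_off v F then return (borel_at X v) (lo v)
      else mixture (1/2) (return (borel_at X v) (lo v)) (return (borel_at X v) (hi v)))"

definition net :: "'v \<Rightarrow> ('v \<Rightarrow> 'a) \<Rightarrow> 'a measure" where
  "net = (\<lambda>v\<in>V. \<lambda>x\<in>space (prod_borel X (pa E v)). choice v (on_set (pa E v) x))"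

lemma pa_subset: "pa E v \<subseteq> V" using EV by (auto simp: pa_def)

lemma on_set_vimage:
  assumes "W \<subseteq> D" "D \<subseteq> V"
  shows "{x \<in> space (prod_borel X D). on_set W x = F} \<in> sets (prod_borel X D)"
proof (cases "F \<subseteq> W")
  case True
  have "{x \<in> space (prod_borel X D). on_set W x = F} = {x \<in> space (prod_borel X D). \<forall>u\<in>W. (x u = hi u) = (u \<in> F)}"
    using True by (auto simp: on_set_def)
  also have "\<dots> \<in> sets (prod_borel X D)"
  proof (intro sets.sets_Collect_finite_All)
    show "finite W" using assms finV by (meson finite_subset)
    fix u assume u: "u \<in> W"
    have "(\<lambda>x. x u) -` {hi u} \<inter> space (prod_borel X D) \<in> sets (prod_borel X D)"
      using u assms lohi by (intro measurable_sets[OF measurable_prod_component] singleton_in_borel_at) auto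
    then have "{x \<in> space (prod_borel X D). x u = hi u} \<in> sets (prod_borel X D)"
      by (simp add: vimage_def Int_def conj_commute)
    then show "{x \<in> space (prod_borel X D). (x u = hi u) = (u \<in> F)} \<in> sets (prod_borel X D)"
      by (cases "u \<in> F") (auto intro: sets.sets_Collect_neg)
  qed
  finally show ?thesis .
next
  case False
  then have "{x \<in> space (prod_borel X D). on_set W x = F} = {}" by (auto simp: on_set_def)
  then show ?thesis by (simp only: sets.empty_sets)
qed

lemma point_mass: "v \<in> V \<Longrightarrow> y \<in> {lo v, hi v} \<Longrightarrow> return (borel_at X v) y \<in> space (prob_algebra (borel_at X v))"
  using lohi by (auto simp: space_prob_algebra space_borel_at intro!: prob_space_return)

lemma choice_prob: "v \<in> V \<Longrightarrow> choice v F \<in> space (prob_algebra (borel_at X v))"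
  unfolding choice_def by (auto intro!: point_mass mixture_in_prob_algebra)

lemma measure_choice:
  assumes v: "v \<in> V" and S: "S \<in> sets (borel_at X v)"
  shows "measure (choice v F) S = (if forced_on v F then indicator S (hi v)
      else if forced_off v F then indicator S (lo v) else (indicator S (lo v) + indicator S (hi v)) / 2)"
  using measure_mixture[OF point_mass[OF v] point_mass[OF v] S, of "lo v" "hi v" "1/2"] S
  by (auto simp: choice_def measure_return)

lemma net_bayes: "net \<in> bayes_nets V E X"
  unfolding bayes_nets_def net_def
proof (intro restrict_PiE[THEN iffD2] Pi_I IntI)
  fix v assume v: "v \<in> V"
  let ?M = "prod_borel X (pa E v)"
  have fin: "finite (Pow (pa E v))" using finite_subset[OF pa_subset finV] by simp
  have "on_set (pa E v) \<in> measurable ?M (count_space (Pow (pa E v)))"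
  proof (subst measurable_count_space_eq2[OF fin], intro conjI ballI)
    fix F assume "F \<in> Pow (pa E v)"
    have "on_set (pa E v) -` {F} \<inter> space ?M = {x \<in> space ?M. on_set (pa E v) x = F}" by auto
    then show "on_set (pa E v) -` {F} \<inter> space ?M \<in> sets ?M" using on_set_vimage[OF order_refl pa_subset] by simp
  qed (auto simp: on_set_def)
  moreover have "choice v \<in> measurable (count_space (Pow (pa E v))) (prob_algebra (borel_at X v))"
    using choice_prob[OF v] by auto
  ultimately have "(\<lambda>x. choice v (on_set (pa E v) x)) \<in> measurable ?M (prob_algebra (borel_at X v))"
    by (rule measurable_compose)
  then show "(\<lambda>x\<in>space ?M. choice v (on_set (pa E v) x)) \<in> measurable ?M (prob_algebra (borel_at X v))"
    by (simp cong: measurable_cong)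
qed auto

lemma net_apply:
  assumes "v \<in> V" "x \<in> Om"
  shows "net v (restrict x (pa E v)) = choice v (on_set (pa E v) x)"
proof -
  have "on_set (pa E v) (restrict x (pa E v)) = on_set (pa E v) x" by (auto simp: on_set_def)
  then show ?thesis using assms restrict_Om[OF pa_subset assms(2)] by (simp add: net_def)
qed

context
  fixes vs assumes order: "build_order E vs" and vsV: "set vs = V"
begin

abbreviation (input) "law \<equiv> kernel_product E X net vs"

lemma law_dists: "law \<in> dists"
  by (rule kernel_product_dists[OF bayes_nets_kernels[OF net_bayes] order vsV])

lemma consistent_point_pos:
  assumes con: "consistent H"
  shows "0 < measure law {\<lambda>v\<in>V. if v \<in> H then hi v else lo v}"
proof -
  let ?z = "\<lambda>v\<in>V. if v \<in> H then hi v else lo v"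
  have z: "?z \<in> Om" using lohi by auto
  have "0 < measure (net v (restrict ?z (pa E v))) {?z v}" if v: "v \<in> V" for v
  proof -
    have F: "on_set (pa E v) ?z = pa E v \<inter> H"
      using pa_subset lohi by (auto simp: on_set_def split: if_splits)
    have "{?z v} \<in> sets (borel_at X v)" using v lohi by (intro singleton_in_borel_at) auto
    then show ?thesis
      using con v lohi[OF v] unfolding net_apply[OF v z] F
      by (auto simp: measure_choice consistent_def permitted_def)
  qed
  from kernel_product_point_pos[OF bayes_nets_kernels[OF net_bayes] z this order]
  have "0 < measure law {restrict ?z (set vs)}" by (simp only: vsV order_refl)
  then show ?thesis by (simp only: vsV restrict_restrict Int_absorb)
qed

lemma AE_consistent: "AE x in law. consistent (on_set V x)"
proof -
  interpret prob_space law by (rule dists_prob_space[OF law_dists])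
  have "AE x in law. \<forall>F\<in>Pow (pa E v). on_set (pa E v) x = F \<longrightarrow> permitted v F (x v = hi v)" if v: "v \<in> V" for v
  proof (intro AE_finite_allI)
    show "finite (Pow (pa E v))" using finite_subset[OF pa_subset finV] by simp
    fix F assume "F \<in> Pow (pa E v)"
    define S where "S = {y \<in> mspace (X v). \<not> permitted v F (y = hi v)}"
    have "S \<in> {{}, {hi v}, mspace (X v) - {hi v}, mspace (X v)}"
    proof -
      have "permitted v F (y = hi v) = (if y = hi v then permitted v F True else permitted v F False)" for y
        by simp
      then show ?thesis
        unfolding S_def using lohi[OF v] by (cases "permitted v F True"; cases "permitted v F False") auto
    qed
    moreover have "{hi v} \<in> sets (borel_at X v)" "mspace (X v) \<in> sets (borel_at X v)"
      using lohi[OF v] singleton_in_borel_at sets.top[of "borel_at X v"] by (auto simp: space_borel_at)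
    ultimately have S: "S \<in> sets (borel_at X v)" by auto
    have m0: "measure (choice v F) S = 0"
      unfolding measure_choice[OF v S] using lohi[OF v] by (auto simp: S_def permitted_def)
    let ?U = "{x \<in> Om. on_set (pa E v) x = F}"
    have "(\<lambda>x. restrict x (pa E v)) -` {x \<in> space (prod_borel X (pa E v)). on_set (pa E v) x = F} \<inter> Om = ?U"
      using restrict_Om[OF pa_subset] by (auto simp: on_set_def)
    then have U: "?U \<in> sets (cyl (pa E v))"
      unfolding sets_cyl[OF pa_subset]
      by (intro CollectI exI conjI) (erule sym, rule on_set_vimage[OF order_refl pa_subset])
    have "measure law ({x \<in> Om. x v \<in> S} \<inter> ?U) = 0"
      using m0 net_apply[OF v] by (intro kernel_product_null[OF bayes_nets_kernels[OF net_bayes] order vsV v S U]) auto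
    moreover have "{x \<in> Om. x v \<in> S} \<inter> ?U \<in> events"
    proof (intro sets.Int dists_events[OF law_dists pa_subset U])
      have "{x \<in> Om. x v \<in> S} = (\<lambda>x. x v) -` S \<inter> space (cyl V)" by auto
      also have "\<dots> \<in> sets (cyl V)" by (rule measurable_sets[OF measurable_cyl_component[OF v order_refl] S])
      finally show "{x \<in> Om. x v \<in> S} \<in> events" by (rule dists_events[OF law_dists order_refl])
    qed
    ultimately have "AE x in law. x \<notin> {x \<in> Om. x v \<in> S} \<inter> ?U" by (simp add: prob_eq_0)
    then show "AE x in law. on_set (pa E v) x = F \<longrightarrow> permitted v F (x v = hi v)"
      using AE_space
    proof eventually_elim
      case (elim x)
      then have x: "x \<in> Om" "x v \<in> mspace (X v)" using v by (auto simp: dists_space[OF law_dists])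
      then show ?case using elim(1) by (auto simp: S_def)
    qed
  qed
  then have "AE x in law. \<forall>v\<in>V. \<forall>F\<in>Pow (pa E v). on_set (pa E v) x = F \<longrightarrow> permitted v F (x v = hi v)"
    by (rule AE_finite_allI[OF finV])
  then show ?thesis
  proof eventually_elim
    case (elim x)
    have "permitted v (pa E v \<inter> on_set V x) (v \<in> on_set V x)" for v
    proof (cases "v \<in> V")
      case True
      have "on_set (pa E v) x \<in> Pow (pa E v)" by (auto simp: on_set_def)
      then have "permitted v (on_set (pa E v) x) (x v = hi v)" using elim True by blast
      moreover have "pa E v \<inter> on_set V x = on_set (pa E v) x" using pa_subset by (auto simp: on_set_def)
      ultimately show ?thesis using True by (simp add: on_set_def)
    next
      case False
      then have "v \<notin> set p" "pa E v = {}" using pV EV by (auto simp: pa_def)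
      then show ?thesis using False colliders_subset[of E p]
        by (auto simp: permitted_def forced_on_def forced_off_def transmitters_def on_set_def)
    qed
    then show ?case by (simp add: consistent_def)
  qed
qed

lemma law_not_cond_indep:
  assumes V: "A \<subseteq> V" "B \<subseteq> V" and ends: "hd p \<in> A" "last p \<in> B"
  shows "\<not> cond_indep X law A B C"
proof -
  interpret prob_space law by (rule dists_prob_space[OF law_dists])
  let ?a = "hd p" and ?b = "last p"
  let ?S = "{x \<in> Om. x ?a = hi ?a}" and ?T = "{x \<in> Om. x ?b \<noteq> hi ?b}" and ?U = "{x \<in> Om. \<forall>c\<in>C. x c = lo c}"
  have ab: "?a \<in> V" "?b \<in> V" using V ends by auto
  have comp: "{x \<in> Om. x v \<in> R} \<in> sets (cyl W)" if "v \<in> W" "W \<subseteq> V" "R \<in> sets (borel_at X v)" for v W R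
  proof -
    have "{x \<in> Om. x v \<in> R} = (\<lambda>x. x v) -` R \<inter> space (cyl W)" by auto
    also have "\<dots> \<in> sets (cyl W)" by (rule measurable_sets[OF measurable_cyl_component[OF that(1,2)] that(3)])
    finally show ?thesis .
  qed
  have S: "?S \<in> sets (cyl A)"
    using comp[OF ends(1) V(1) singleton_in_borel_at] lohi[OF ab(1)] by simp
  have "{x \<in> Om. x ?b = hi ?b} \<in> sets (cyl B)"
    using comp[OF ends(2) V(2) singleton_in_borel_at] lohi[OF ab(2)] by simp
  then have "space (cyl B) - {x \<in> Om. x ?b = hi ?b} \<in> sets (cyl B)" by (rule sets.compl_sets)
  moreover have "space (cyl B) - {x \<in> Om. x ?b = hi ?b} = ?T" by auto
  ultimately have T: "?T \<in> sets (cyl B)" by simp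
  have "{x \<in> space (cyl C). \<forall>c\<in>C. x c = lo c} \<in> sets (cyl C)"
  proof (intro sets.sets_Collect_finite_All)
    fix c assume c: "c \<in> C"
    then show "{x \<in> space (cyl C). x c = lo c} \<in> sets (cyl C)"
      using comp[OF c CV singleton_in_borel_at, of "lo c"] lohi[of c] CV by auto
  qed (use finite_subset[OF CV finV] in auto)
  then have U: "?U \<in> sets (cyl C)" by simp
  have abC: "?a \<notin> C" "?b \<notin> C" using act by (auto simp: active_def)
  have le: "measure law {z} \<le> measure law W" if "z \<in> W" "W \<in> events" for z W
    using that by (intro finite_measure_mono) auto
  note ev = dists_events[OF law_dists V(1) S] dists_events[OF law_dists V(2) T] dists_events[OF law_dists CV U]
  show ?thesis
  proof (rule not_cond_indep_on_atom[OF law_dists V CV S T U])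
    show "restrict x C = restrict y C" if "x \<in> ?U" "y \<in> ?U" for x y
      using that by (auto simp: restrict_def fun_eq_iff)
    let ?z1 = "\<lambda>v\<in>V. if v \<in> transmitters then hi v else lo v"
    have "?z1 \<in> ?S \<inter> ?U"
      using lohi ends_transmit ab transmitters_disjoint CV by (auto simp: disjoint_iff)
    from le[OF this sets.Int[OF ev(1,3)]] consistent_point_pos[OF consistent_transmitters]
    show "0 < prob (?S \<inter> ?U)" by linarith
    let ?z0 = "\<lambda>v\<in>V. if v \<in> {} then hi v else lo v"
    have "?z0 \<in> ?T \<inter> ?U" using lohi ab CV by auto
    from le[OF this sets.Int[OF ev(2,3)]] consistent_point_pos[OF consistent_empty]
    show "0 < prob (?T \<inter> ?U)" by linarith
    have "AE x in law. x \<notin> ?S \<inter> (?T \<inter> ?U)"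
      using AE_consistent
    proof eventually_elim
      case (elim x)
      show ?case
      proof
        assume x: "x \<in> ?S \<inter> (?T \<inter> ?U)"
        then have "?a \<in> on_set V x" "?b \<notin> on_set V x" using ab by (auto simp: on_set_def)
        moreover have "on_set V x \<inter> C = {}"
        proof -
          have "c \<notin> on_set V x" if "c \<in> C" for c
            using that x lohi[of c] CV by (auto simp: on_set_def)
          then show ?thesis by auto
        qed
        ultimately show False using consistent_propagates[OF elim] by blast
      qed
    qed
    then show "prob (?S \<inter> (?T \<inter> ?U)) = 0"
      using ev by (subst prob_eq_0) auto
  qed
qed

end

end

context separable_product
begin

text \<open>The event that \<open>C\<close> is off is an atom of \<open>X\<^sub>C\<close>. There \<open>hd p\<close> on and \<open>last p\<close> off exclude each other by
\<open>consistent_propagates\<close>. The assignment with exactly the non-colliders on and the one with everything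
off show that each of the two has positive probability.\<close>

theorem d_connected_witness:
  assumes dag: "acyclic E" "E \<subseteq> V \<times> V" and V: "A \<subseteq> V" "B \<subseteq> V" "C \<subseteq> V"
    and two: "\<And>v. v \<in> V \<Longrightarrow> \<exists>x\<in>mspace (X v). \<exists>y\<in>mspace (X v). x \<noteq> y"
    and con: "\<not> d_separated V E A B C"
  shows "\<exists>m\<in>bayes_nets V E X. \<forall>vs. build_order E vs \<and> set vs = V \<longrightarrow>
    \<not> cond_indep X (kernel_product E X m vs) A B C"
proof -
  obtain p0 where p0: "is_path V E p0" "\<not> blocked E C p0" "hd p0 \<in> A" "last p0 \<in> B"
    using con unfolding d_separated_def by auto
  then have "distinct p0" "active E C p0" using active_path_iff[of V E p0 C] by auto
  then obtain p where p: "distinct p" "active E C p" "hd p = hd p0" "last p = last p0"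
      "colliders E p \<subseteq> ancestors (E \<inter> (UNIV \<times> - set p)) C"
    using active_path_with_clean_tails[OF dag(1)] by metis
  have "\<forall>v\<in>V. \<exists>xy. fst xy \<in> mspace (X v) \<and> snd xy \<in> mspace (X v) \<and> fst xy \<noteq> snd xy"
    using two by fastforce
  then obtain f where f: "\<forall>v\<in>V. fst (f v) \<in> mspace (X v) \<and> snd (f v) \<in> mspace (X v) \<and> fst (f v) \<noteq> snd (f v)"
    by (rule bchoice[THEN exE])
  have "set p \<subseteq> V" using active_subset[OF dag(2) p(2)] p(3) p0(3) V by auto
  then interpret binary_network X V E C p "\<lambda>v. fst (f v)" "\<lambda>v. snd (f v)"
    using p dag V f by unfold_locales auto
  show ?thesis
    using law_not_cond_indep[OF _ _ V(1,2)] p0 p by (intro bexI[OF _ net_bayes]) auto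
qed

end

section \<open>Faithful networks are open and dense\<close>

lemma topological_ordering_exists:
  assumes "finite E" "acyclic E" "finite W"
  shows "\<exists>vs. topological_ordering W E vs"
  using assms(3)
proof (induction "card W" arbitrary: W)
  case 0
  then show ?case by (intro exI[of _ "[]"]) (auto simp: topological_ordering_def)
next
  case (Suc n)
  have "wf (E\<inverse>)" using assms(1,2) by (rule finite_acyclic_wf_converse)
  moreover have "W \<noteq> {}" using Suc by auto
  ultimately obtain v where v: "v \<in> W" "\<And>w. (v, w) \<in> E \<Longrightarrow> w \<notin> W"
    by (metis wfE_min' converse_iff)
  then obtain vs where vs: "topological_ordering (W - {v}) E vs"
    using Suc by (metis card_Suc_Diff1 diff_Suc_1 finite_Diff card_Diff_singleton)
  have "topological_ordering W E (vs @ [v])"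
    unfolding topological_ordering_def
  proof (intro conjI allI impI)
    show "distinct (vs @ [v])" "set (vs @ [v]) = W" using vs v by (auto simp: topological_ordering_def)
    fix i j assume ij: "i < length (vs @ [v])" "j < length (vs @ [v])" "((vs @ [v]) ! i, (vs @ [v]) ! j) \<in> E"
    have "(vs @ [v]) ! j \<in> W" using ij(2) \<open>set (vs @ [v]) = W\<close> nth_mem by blast
    then have "i < length vs" using ij v(2) by (cases "i = length vs") auto
    moreover have "i < j" if "j < length vs"
      using vs ij that \<open>i < length vs\<close> by (auto simp: topological_ordering_def nth_append)
    ultimately show "i < j" using ij(2) by (cases "j = length vs") auto
  qed
  then show ?case by blast
qed

lemma build_orderI:
  assumes "distinct xs" "\<And>us v ws. xs = us @ v # ws \<Longrightarrow> pa E v \<subseteq> set ws"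
  shows "build_order E xs"
  using assms
proof (induction xs)
  case (Cons x xs)
  have "build_order E xs"
  proof (rule Cons.IH)
    show "pa E v \<subseteq> set ws" if "xs = us @ v # ws" for us v ws
      using Cons.prems(2)[of "x # us" v ws] that by simp
  qed (use Cons.prems in simp)
  then show ?case using Cons.prems(1) Cons.prems(2)[of "[]" x xs] by simp
qed simp

lemma topological_ordering_build_order:
  assumes "topological_ordering W E vs" "E \<subseteq> W \<times> W"
  shows "build_order E (rev vs)"
proof (rule build_orderI)
  show "distinct (rev vs)" using assms by (simp add: topological_ordering_def)
  fix us v ws assume "rev vs = us @ v # ws"
  then have "rev (rev vs) = rev (us @ v # ws)" by simp
  then have vs: "vs = rev ws @ v # rev us" by simp
  show "pa E v \<subseteq> set ws"
  proof
    fix u assume "u \<in> pa E v"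
    then have e: "(u, v) \<in> E" by (simp add: pa_def)
    then have "u \<in> set vs" using assms by (auto simp: topological_ordering_def)
    then obtain i where i: "i < length vs" "u = vs ! i" by (auto simp: in_set_conv_nth)
    have "v = vs ! length ws" "length ws < length vs" using vs by (auto simp: nth_append)
    then have "i < length ws" using assms(1) i e unfolding topological_ordering_def by blast
    then have "u = rev ws ! i" using i vs by (simp add: nth_append)
    then show "u \<in> set ws" using \<open>i < length ws\<close> by (metis length_rev nth_mem set_rev)
  qed
qed

context separable_product
begin

lemma bayes_nets_upd:
  assumes "m \<in> bayes_nets V E X" "v \<in> V"
    and "k \<in> measurable (prod_borel X (pa E v)) (prob_algebra (borel_at X v))"
      "k \<in> extensional (space (prod_borel X (pa E v)))"
  shows "m(v := k) \<in> bayes_nets V E X"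
  using assms unfolding bayes_nets_def by (auto simp: PiE_iff extensional_def)

lemma bayes_nets_hybrid:
  assumes "m \<in> bayes_nets V E X" "m' \<in> bayes_nets V E X"
  shows "(\<lambda>v. if v \<in> W then m v else m' v) \<in> bayes_nets V E X"
  using assms unfolding bayes_nets_def by (auto simp: PiE_iff extensional_def)

lemma tv_dist_self: "tv_dist P P = 0"
  unfolding tv_dist_def using sets.empty_sets[of P] by (auto intro: cSUP_const)

lemma tv_dist_nets_upd:
  assumes m: "m \<in> bayes_nets V E X" "m(v := k) \<in> bayes_nets V E X" and v: "v \<in> V"
    and ne: "\<And>u. u \<in> V \<Longrightarrow> mspace (X u) \<noteq> {}" and E: "E \<subseteq> V \<times> V"
    and le: "\<And>x. x \<in> space (prod_borel X (pa E v)) \<Longrightarrow> tv_dist (m v x) (k x) \<le> t"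
  shows "tv_dist_nets V E X m (m(v := k)) \<le> t"
proof -
  have S_ne: "space (prod_borel X (pa E u)) \<noteq> {}" for u
    using ne E by (auto simp: space_prod_borel PiE_eq_empty_iff pa_def)
  let ?s = "\<lambda>u. SUP x\<in>space (prod_borel X (pa E u)). tv_dist (m u x) ((m(v := k)) u x)"
  have "tv_dist_nets V E X m (m(v := k)) = (\<Sum>u\<in>V. ?s u)"
    using m by (simp add: tv_dist_nets_def)
  also have "\<dots> = ?s v + (\<Sum>u\<in>V - {v}. ?s u)" using finV v by (rule sum.remove)
  also have "(\<Sum>u\<in>V - {v}. ?s u) = 0"
    using S_ne by (intro sum.neutral ballI) (simp add: tv_dist_self)
  also have "?s v \<le> t" using S_ne le by (intro cSUP_least) auto
  finally show ?thesis by (simp only: add_0_right)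
qed

text \<open>Suppose that all networks in the ball around \<open>m\<close> satisfy the independence. The claim proved by induction
on \<open>W\<close> is that the kernels at \<open>W\<close> may be changed arbitrarily without losing it. To change the kernel at
one more vertex, move it along a segment: for small parameters the induction hypothesis applies, and the
end point is reached by \<open>cond_indep_mixture_extrapolate\<close>.\<close>

lemma not_cond_indep_dense:
  assumes dag: "dag V E" and V: "A \<subseteq> V" "B \<subseteq> V" "C \<subseteq> V"
    and two: "\<And>v. v \<in> V \<Longrightarrow> \<exists>x\<in>mspace (X v). \<exists>y\<in>mspace (X v). x \<noteq> y"
    and con: "\<not> d_separated V E A B C"
    and order: "build_order E vs" "set vs = V"
    and m: "m \<in> bayes_nets V E X" and e: "0 < e"
  shows "\<exists>m'\<in>bayes_nets V E X. tv_dist_nets V E X m m' < e \<and> \<not> cond_indep X (kernel_product E X m' vs) A B C"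
proof (rule ccontr)
  let ?BN = "bayes_nets V E X" and ?d = "tv_dist_nets V E X" and ?D = "\<lambda>m. kernel_product E X m vs"
  assume "\<not> ?thesis"
  then have near: "cond_indep X (?D m') A B C" if "m' \<in> ?BN" "?d m m' < e" for m' using that by blast
  have E: "acyclic E" "E \<subseteq> V \<times> V" using dag by (auto simp: dag_def)
  have ne: "mspace (X v) \<noteq> {}" if "v \<in> V" for v using two[OF that] by auto
  interpret BN: Metric_space ?BN ?d by (rule Metric_space_bayes_nets[OF dag ne])
  have D: "?D m' \<in> dists" if "m' \<in> ?BN" for m'
    by (rule kernel_product_dists[OF bayes_nets_kernels[OF that] order])
  have all: "cond_indep X (?D m') A B C"
    if "finite W" "W \<subseteq> V" "m' \<in> ?BN" "?d m (\<lambda>v. if v \<in> W then m v else m' v) < e" for W m'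
    using that
  proof (induction W arbitrary: m' rule: finite_induct)
    case empty
    then show ?case by (intro near) auto
  next
    case (insert v W)
    let ?h = "\<lambda>u. if u \<in> insert v W then m u else m' u"
    let ?m0 = "m'(v := m v)"
    let ?k = "\<lambda>t. \<lambda>x\<in>space (prod_borel X (pa E v)). mixture t (m v x) (m' v x)"
    have v: "v \<in> V" using insert by auto
    have h: "?h \<in> ?BN" using bayes_nets_hybrid[OF m insert.prems(2)] .
    have mv: "m v \<in> measurable (prod_borel X (pa E v)) (prob_algebra (borel_at X v))"
        "m' v \<in> measurable (prod_borel X (pa E v)) (prob_algebra (borel_at X v))"
        "m v \<in> extensional (space (prod_borel X (pa E v)))"
      using m insert.prems(2) v by (auto simp: bayes_nets_def)
    have kt: "?k t \<in> measurable (prod_borel X (pa E v)) (prob_algebra (borel_at X v))" for t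
      using measurable_mixture[OF mv(1,2), of t] by (simp cong: measurable_cong)
    have m0: "?m0 \<in> ?BN" by (rule bayes_nets_upd[OF insert.prems(2) v mv(1,3)])
    have mt: "?m0(v := ?k t) \<in> ?BN" for t
      by (rule bayes_nets_upd[OF m0 v kt]) auto
    \<comment> \<open>For parameters up to \<open>r\<close> the moved network stays in the ball.\<close>
    define r where "r = min 1 (e - ?d m ?h) / 2"
    have r: "0 < r" "r < 1" "?d m ?h + r < e" using insert.prems(3) by (auto simp: r_def min_def field_simps)
    have ci: "cond_indep X (mixture t (?D ?m0) (?D m')) A B C" if t: "0 \<le> t" "t \<le> r" for t
    proof -
      have "cond_indep X (?D (?m0(v := ?k t))) A B C"
      proof (rule insert.IH[OF _ mt])
        have eq: "(\<lambda>u. if u \<in> W then m u else (?m0(v := ?k t)) u) = ?h(v := ?k t)"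
          using insert.hyps by (auto simp: fun_eq_iff)
        have hk: "?h(v := ?k t) \<in> ?BN" by (rule bayes_nets_upd[OF h v kt]) auto
        have "?d ?h (?h(v := ?k t)) \<le> t"
        proof (rule tv_dist_nets_upd[OF h hk v ne E(2)])
          fix x assume x: "x \<in> space (prod_borel X (pa E v))"
          have k: "m v x \<in> space (prob_algebra (borel_at X v))" "m' v x \<in> space (prob_algebra (borel_at X v))"
            using measurable_space[OF mv(1) x] measurable_space[OF mv(2) x] .
          have "tv_dist (m v x) (mixture t (m v x) (m' v x)) = tv_dist (mixture t (m v x) (m' v x)) (m v x)"
            by (rule tv_dist_commute[OF k(1) mixture_in_prob_algebra[OF k]])
          also have "\<dots> \<le> t" using tv_dist_mixture[OF k] t r by auto
          finally show "tv_dist (?h v x) (?k t x) \<le> t" using x by simp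
        qed
        moreover have "?d m (?h(v := ?k t)) \<le> ?d m ?h + ?d ?h (?h(v := ?k t))"
          by (rule BN.triangle[OF m h hk])
        ultimately show "?d m (\<lambda>u. if u \<in> W then m u else (?m0(v := ?k t)) u) < e"
          unfolding eq using t r by linarith
      qed (use insert in auto)
      moreover have "?D (?m0(v := ?k t)) = mixture t (?D ?m0) (?D (?m0(v := m' v)))"
        using v order r t
        by (intro kernel_product_mixture[OF bayes_nets_kernels[OF m0] mv(2)]) auto
      moreover have "?m0(v := m' v) = m'" by auto
      ultimately show ?thesis by simp
    qed
    show ?case
    proof (rule cond_indep_mixture_extrapolate[OF D[OF m0] D[OF insert.prems(2)] V])
      show "card {r, r / 2, r / 3} = 3" "{r, r / 2, r / 3} \<subseteq> {0..1}" using r by auto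
      show "cond_indep X (mixture t (?D ?m0) (?D m')) A B C" if "t \<in> {r, r / 2, r / 3}" for t
        using that r by (intro ci) auto
    qed
  qed
  obtain w where w: "w \<in> ?BN" "\<not> cond_indep X (?D w) A B C"
    using d_connected_witness[OF E V two con] order by blast
  \<comment> \<open>Outside \<open>V\<close> both networks have the value \<open>undefined\<close>.\<close>
  have "(\<lambda>v. if v \<in> V then m v else w v) = m"
    using m w(1) by (auto simp: bayes_nets_def fun_eq_iff PiE_iff extensional_def)
  then show False using all[OF finV order_refl w(1)] w(2) e BN.mdist_zero[OF m] by simp
qed

end

theorem mainTheorem2:
  fixes V :: "'v set" and E :: "('v \<times> 'v) set" and X :: "'v \<Rightarrow> 'a metric"
  assumes "dag V E"
    and "\<And>v. v \<in> V \<Longrightarrow> mcomplete_of (X v)"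
    and "\<And>v. v \<in> V \<Longrightarrow> separable_space (mtopology_of (X v))"
    and "\<And>v. v \<in> V \<Longrightarrow> \<exists>x\<in>mspace (X v). \<exists>y\<in>mspace (X v). x \<noteq> y"
  shows "openin (Metric_space.mtopology (bayes_nets V E X) (tv_dist_nets V E X))
           (distribution_map V E X -` faithful_dists V E X \<inter> bayes_nets V E X) \<and>
         Metric_space.mtopology (bayes_nets V E X) (tv_dist_nets V E X) closure_of
           (distribution_map V E X -` faithful_dists V E X \<inter> bayes_nets V E X) =
         bayes_nets V E X"
proof -
  let ?BN = "bayes_nets V E X" and ?d = "tv_dist_nets V E X"
  have E: "finite V" "acyclic E" "E \<subseteq> V \<times> V" using assms(1) by (auto simp: dag_def)
  interpret separable_product X V by unfold_locales (use E assms(3) in auto)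
  have ne: "mspace (X v) \<noteq> {}" if "v \<in> V" for v using assms(4)[OF that] by auto
  interpret BN: Metric_space ?BN ?d by (rule Metric_space_bayes_nets[OF assms(1) ne])
  have "finite E" using E finite_subset by (metis finite_SigmaI)
  then have "\<exists>vs. topological_ordering V E vs" by (rule topological_ordering_exists[OF _ E(2,1)])
  then have "topological_ordering V E (SOME vs. topological_ordering V E vs)" by (rule someI_ex)
  then obtain ts where ts: "ts = (SOME vs. topological_ordering V E vs)" "topological_ordering V E ts" by blast
  define vs where "vs = rev ts"
  have order: "build_order E vs" "set vs = V"
    unfolding vs_def using topological_ordering_build_order[OF ts(2) E(3)] ts(2)
    by (auto simp: topological_ordering_def)
  let ?D = "\<lambda>m. kernel_product E X m vs"
  have D: "?D m \<in> dists" if "m \<in> ?BN" for m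
    by (rule kernel_product_dists[OF bayes_nets_kernels[OF that] order])
  define bad where "bad = {(A, B, C). A \<subseteq> V \<and> B \<subseteq> V \<and> C \<subseteq> V \<and> \<not> d_separated V E A B C}"
  have "bad \<subseteq> Pow V \<times> Pow V \<times> Pow V" by (auto simp: bad_def)
  then have fin: "finite bad" by (rule finite_subset) (use E(1) in auto)
  define G where "G T = {m \<in> ?BN. \<forall>(A, B, C)\<in>T. \<not> cond_indep X (?D m) A B C}" for T
  have faithful: "distribution_map V E X -` faithful_dists V E X \<inter> ?BN = G bad"
    using kernel_product_markov[OF E(2) bayes_nets_kernels order]
    unfolding distribution_map_def ts(1)[symmetric] vs_def[symmetric] faithful_dists_def G_def bad_def by auto
  have step: "openin BN.mtopology (G T) \<and> (\<forall>m\<in>?BN. \<forall>e>0. \<exists>m'\<in>G T. ?d m m' < e)" if "finite T" "T \<subseteq> bad" for T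
    using that
  proof (induction T rule: finite_induct)
    case empty
    have "G {} = ?BN" by (auto simp: G_def)
    moreover have "openin BN.mtopology ?BN" using openin_topspace[of BN.mtopology] by simp
    moreover have "\<exists>m'\<in>?BN. ?d m m' < e" if "m \<in> ?BN" "0 < e" for m and e :: real
      using that by (intro bexI[of _ m]) auto
    ultimately show ?case by simp
  next
    case (insert \<tau> T)
    obtain A B C where \<tau>: "\<tau> = (A, B, C)" by (cases \<tau>) auto
    have ABC: "A \<subseteq> V" "B \<subseteq> V" "C \<subseteq> V" "\<not> d_separated V E A B C" using insert.prems \<tau> by (auto simp: bad_def)
    have IH: "openin BN.mtopology (G T)" "\<And>m e. m \<in> ?BN \<Longrightarrow> 0 < e \<Longrightarrow> \<exists>m'\<in>G T. ?d m m' < e"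
      using insert by auto
    have G: "G (insert \<tau> T) = G T \<inter> G {\<tau>}" by (auto simp: G_def)
    have op: "openin BN.mtopology (G {\<tau>})"
      unfolding BN.openin_mtopology
    proof (intro conjI ballI allI impI)
      show "G {\<tau>} \<subseteq> ?BN" by (auto simp: G_def)
      fix m assume "m \<in> G {\<tau>}"
      then have m: "m \<in> ?BN" "\<not> cond_indep X (?D m) A B C" by (auto simp: G_def \<tau>)
      obtain r where r: "0 < r" "\<forall>Q\<in>dists. tv_dist (?D m) Q < r \<longrightarrow> \<not> cond_indep X Q A B C"
        using not_cond_indep_robust[OF D[OF m(1)] ABC(1-3) m(2)] by auto
      have "BN.mball m r \<subseteq> G {\<tau>}"
      proof
        fix m' assume m': "m' \<in> BN.mball m r"
        then have "m' \<in> ?BN" "?d m m' < r" by auto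
        then have "tv_dist (?D m) (?D m') < r"
          using kernel_product_tv_le[OF m(1) _ order(1)] order(2) m(1) by (fastforce simp: tv_dist_nets_def)
        then show "m' \<in> G {\<tau>}" using r D[OF \<open>m' \<in> ?BN\<close>] \<open>m' \<in> ?BN\<close> by (auto simp: G_def \<tau>)
      qed
      then show "\<exists>r>0. BN.mball m r \<subseteq> G {\<tau>}" using r(1) by blast
    qed
    show ?case
      unfolding G
    proof (intro conjI ballI allI impI)
      show "openin BN.mtopology (G T \<inter> G {\<tau>})" using IH(1) op by blast
      fix m and e :: real assume m: "m \<in> ?BN" and e: "0 < e"
      obtain m1 where m1: "m1 \<in> G T" "?d m m1 < e" using IH(2)[OF m e] by auto
      then have m1': "m1 \<in> ?BN" by (auto simp: G_def)
      obtain r where r: "0 < r" "BN.mball m1 r \<subseteq> G T"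
        using IH(1) m1(1) unfolding BN.openin_mtopology by blast
      obtain m2 where m2: "m2 \<in> ?BN" "?d m1 m2 < min r (e - ?d m m1)" "\<not> cond_indep X (?D m2) A B C"
        using not_cond_indep_dense[OF assms(1) ABC(1-3) assms(4) ABC(4) order m1', of "min r (e - ?d m m1)"] r m1
        by auto
      show "\<exists>m'\<in>G T \<inter> G {\<tau>}. ?d m m' < e"
      proof (intro bexI[of _ m2] IntI)
        show "?d m m2 < e" using BN.triangle[OF m m1' m2(1)] m2(2) by linarith
        show "m2 \<in> G T" using r(2) m2 m1' by auto
        show "m2 \<in> G {\<tau>}" using m2 by (auto simp: G_def \<tau>)
      qed
    qed
  qed
  have "BN.mtopology closure_of (G bad) = ?BN"
  proof
    show "BN.mtopology closure_of (G bad) \<subseteq> ?BN" using closure_of_subset_topspace[of BN.mtopology] by simp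
    show "?BN \<subseteq> BN.mtopology closure_of (G bad)"
      unfolding BN.metric_closure_of
    proof (intro subsetI CollectI conjI allI impI)
      fix m and e :: real assume m: "m \<in> ?BN" and e: "0 < e"
      then obtain m' where "m' \<in> G bad" "?d m m' < e" using step[OF fin order_refl] by blast
      moreover from this have "m' \<in> ?BN" by (auto simp: G_def)
      ultimately show "\<exists>y\<in>G bad. y \<in> BN.mball m e" using m by auto
    qed
  qed
  then show ?thesis using step[OF fin order_refl] unfolding faithful by blast
qed

end
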